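(* For each positive integer $n$ let $d_n(t)$ be the worst-case total-variation distance to stationarity at time $t$ of the inversion walk on labelled tournaments on $[n]$, and let $T(s):=\binom{s+1}{2}$. Let $C_\star:=\frac12\big(\sum_{j\ge1}2^{-j(2j-1)}\big)^{1/2}$ and $\kappa:=\prod_{j\ge1}(1-2^{-j})^{-1}$. Then: (i) For every $n$ and every integer $s\in\{0,1,\dots,n\}$, $$d_n(n-s)\ \ge\ 1-\kappa\,2^{\,n-T(s)}.$$ Consequently, if $s_n\in\{0,1,\dots,n\}$ is an integer sequence with $T(s_n)-n\to+\infty$ as $n\to\infty$, then $d_n(n-s_n)\to1$. (ii) If $s_n\in\{0,1,\dots,n\}$ is an integer sequence with $T(s_n)-n\to-\infty$ as $n\to\infty$, then $d_n(n-s_n)\to0$. (iii) For every $n$ and every integer $c\ge0$, $d_n(n+c)\le C_\star\,2^{-c}$. In particular, for every fixed real $a\ge0$ with $a\ne\sqrt2$, as $n\to\infty$, $$d_n\big(n-\lfloor a\sqrt n\rfloor\big)\longrightarrow\begin{cases}1,& a>\sqrt2,\\ 0,& 0\le a<\sqrt2.\end{cases}$$ Moreover, if $$\sigma_n:=\max\{s\in\mathbb{Z}_{\ge0}:\ T(s)\le n\}=\left\lfloor\frac{\sqrt{8n+1}-1}{2}\right\rfloor,$$ then for every fixed $\varepsilon\in(0,1)$, $$n-\sigma_n-1\ \le\ t_{\mathrm{mix}}^{(n)}(\varepsilon)\ \le\ n-\sigma_n+1$$ for all sufficiently large $n$. In particular, $t_{\mathrm{mix}}^{(n)}(\varepsilon)=n-\sigma_n+O(1)=n-\sqrt{2n}+O(1)$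 as $n\to\infty$. Furthermore, the sequence of inversion walks has cutoff at times $n-\sigma_n$ with every window $w_n$ satisfying $w_n\to\infty$ and $w_n=o(n)$; that is, for every such sequence $(w_n)$ and every fixed $\delta>0$, $$\lim_{n\to\infty}d_n(n-\sigma_n-\delta w_n)=1,\qquad \lim_{n\to\infty}d_n(n-\sigma_n+\delta w_n)=0.$$
   Context: A (labelled) tournament on $[n]=\{1,\dots,n\}$ is an orientation of the complete graph $K_n$: for each unordered pair $\{i,j\}$ exactly one of $i\to j$, $j\to i$ is present. There are $2^m$ of them, $m=\binom n2$. For $X\subseteq[n]$, inverting $X$ in a tournament means reversing every arc with both endpoints in $X$. The inversion walk $W_n$ is the discrete-time Markov chain on labelled tournaments on $[n]$ which, from the current tournament, chooses $X\subseteq[n]$ uniformly among all $2^n$ subsets (independently at each step) and inverts $X$. Its stationary distribution $\pi$ is uniform on the $2^m$ tournaments. For an integer $t\ge0$, $$d_n(t):=\max_{T_0}\big\|\mathcal L(W_n(t)\mid W_n(0)=T_0)-\pi\big\|_{\mathrm{TV}},$$ where the maximum is over all tournaments $T_0$ on $[n]$, $\mathcal L$ denotes law, and $\|\mu-\nu\|_{\mathrm{TV}}=\max_E|\mu(E)-\nu(E)|$. The mixing time is $t_{\mathrm{mix}}^{(n)}(\varepsilon):=\min\{t\ge0:\ d_n(t)\le\varepsilon\}$. Numerically $C_\star<0.36$ and $\kappa<3.47$. In the cutoff-window statement, non-integer times are rounded to the nearest integer. *)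

theory Defs
  imports "HOL-Probability.Probability" "HOL-Library.Landau_Symbols"
begin

definition tournaments :: "nat \<Rightarrow> (nat \<times> nat) set set" where
  "tournaments n = {T. T \<subseteq> {1..n} \<times> {1..n} \<and> (\<forall>i\<in>{1..n}. (i, i) \<notin> T) \<and>
     (\<forall>i\<in>{1..n}. \<forall>j\<in>{1..n}. i \<noteq> j \<longrightarrow> ((i, j) \<in> T \<longleftrightarrow> (j, i) \<notin> T))}"

definition invert :: "nat set \<Rightarrow> (nat \<times> nat) set \<Rightarrow> (nat \<times> nat) set" where
  "invert X T = {(i, j). if i \<in> X \<and> j \<in> X then (j, i) \<in> T else (i, j) \<in> T}"

lemma finite_tournaments: "finite (tournaments n)"
  by (rule finite_subset[of _ "Pow ({1..n} \<times> {1..n})"]) (auto simp: tournaments_def)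

lemma tournaments_nonempty: "tournaments n \<noteq> {}"
proof -
  have "{(i, j). i \<in> {1..n} \<and> j \<in> {1..n} \<and> i < j} \<in> tournaments n"
    by (auto simp: tournaments_def)
  thus ?thesis by blast
qed

lemma invert_in_tournaments:
  assumes T: "T \<in> tournaments n" and X: "X \<subseteq> {1..n}"
  shows "invert X T \<in> tournaments n"
proof -
  have mem: "(i, j) \<in> invert X T \<longleftrightarrow> (if i \<in> X \<and> j \<in> X then (j, i) \<in> T else (i, j) \<in> T)" for i j
    by (simp add: invert_def)
  have sub: "T \<subseteq> {1..n} \<times> {1..n}" and irr: "\<And>i. i \<in> {1..n} \<Longrightarrow> (i, i) \<notin> T"
    and tot: "\<And>i j. i \<in> {1..n} \<Longrightarrow> j \<in> {1..n} \<Longrightarrow> i \<noteq> j \<Longrightarrow> ((i, j) \<in> T) = ((j, i) \<notin> T)"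
    using T unfolding tournaments_def by blast+
  have 1: "invert X T \<subseteq> {1..n} \<times> {1..n}"
  proof (rule subrelI)
    fix i j assume "(i, j) \<in> invert X T"
    hence "(j, i) \<in> T \<or> (i, j) \<in> T" unfolding mem by presburger
    thus "(i, j) \<in> {1..n} \<times> {1..n}" using sub by blast
  qed
  have 2: "(i, i) \<notin> invert X T" if "i \<in> {1..n}" for i
    using irr[OF that] unfolding mem by presburger
  have 3: "((i, j) \<in> invert X T) = ((j, i) \<notin> invert X T)"
    if "i \<in> {1..n}" "j \<in> {1..n}" "i \<noteq> j" for i j
    using tot[OF that] unfolding mem by presburger
  show ?thesis
    unfolding tournaments_def using 1 2 3 by blast
qed

definition inversion_kernel :: "nat \<Rightarrow> (nat \<times> nat) set \<Rightarrow> (nat \<times> nat) set pmf" where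
  "inversion_kernel n T = map_pmf (\<lambda>X. invert X T) (pmf_of_set (Pow {1..n}))"

text \<open>\<open>walk_law n T0 t\<close> is the law of \<open>W\<^sub>n(t)\<close> given \<open>W\<^sub>n(0) = T0\<close>.\<close>

primrec walk_law :: "nat \<Rightarrow> (nat \<times> nat) set \<Rightarrow> nat \<Rightarrow> (nat \<times> nat) set pmf" where
  "walk_law n T0 0 = return_pmf T0"
| "walk_law n T0 (Suc t) = bind_pmf (walk_law n T0 t) (inversion_kernel n)"

definition stationary :: "nat \<Rightarrow> (nat \<times> nat) set pmf" where
  "stationary n = pmf_of_set (tournaments n)"

text \<open>Total variation distance of two distributions supported on a finite state space \<open>S\<close>.\<close>

definition tv_dist :: "'a set \<Rightarrow> 'a pmf \<Rightarrow> 'a pmf \<Rightarrow> real" where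
  "tv_dist S \<mu> \<nu> = Max ((\<lambda>E. \<bar>measure_pmf.prob \<mu> E - measure_pmf.prob \<nu> E\<bar>) ` Pow S)"

definition d :: "nat \<Rightarrow> nat \<Rightarrow> real" where
  "d n t = Max ((\<lambda>T0. tv_dist (tournaments n) (walk_law n T0 t) (stationary n)) ` tournaments n)"

definition t_mix :: "nat \<Rightarrow> real \<Rightarrow> nat" where
  "t_mix n \<epsilon> = (LEAST t. d n t \<le> \<epsilon>)"

definition tri :: "nat \<Rightarrow> nat" where
  "tri s = (s + 1) choose 2"

text \<open>Sums and products over \<open>j \<ge> 1\<close> are indexed by \<open>Suc j\<close>.\<close>

definition C_star :: real where
  "C_star = 1 / 2 * sqrt (\<Sum>j. 1 / 2 ^ (Suc j * (2 * Suc j - 1)))"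

definition kappa :: real where
  "kappa = (\<Prod>j. inverse (1 - 1 / 2 ^ Suc j))"

definition sigma_n :: "nat \<Rightarrow> nat" where
  "sigma_n n = Max {s. tri s \<le> n}"

end

theory Submission
  imports Defs "HOL-Library.Z2" "HOL-Library.Function_Algebras" "HOL-Real_Asymp.Real_Asymp"
begin

text \<open>
  Encode tournaments as vectors over the field with two elements, one coordinate per pair; a step adds
  the off-diagonal part of \<open>x x\<^sup>T\<close> for a uniform vector \<open>x\<close>.

  Lower bound: at time \<open>n - s\<close> the displacement from the start is the off-diagonal part of a Gram matrix
  whose kernel has dimension at least \<open>s\<close>. There are at most \<open>2\<^sup>n\<close> choices of the diagonal, and a uniform symmetric
  matrix has such a kernel with probability at most \<open>kappa / 2 ^ tri s\<close>.

  Upper bound: the Fourier coefficient at a graph \<open>b\<close> is the \<open>t\<close>-th power of the normalised Gauss sum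
  of the quadratic form of \<open>b\<close>. It vanishes unless the form is zero on its radical, and then it equals
  \<open>2 ^ (- h * t)\<close> up to sign, where \<open>2 * h\<close> is the rank. Such a form factors through a form in \<open>2 * h\<close> variables that
  vanishes at the image of every basis vector; a form in \<open>2 * h\<close> variables with Gauss sum of size \<open>2 ^ h\<close> has at most
  \<open>(4 ^ h + 2 ^ h) / 2\<close> zeros. Dropping this vanishing constraint gives the bound after time \<open>n\<close>; using it
  gains the factor \<open>2 ^ (- n)\<close> that moves the \<open>L\<^sup>2\<close> threshold to \<open>tri s \<approx> n\<close>.
\<close>

section \<open>Linear algebra over the field with two elements\<close>

text \<open>By default \<open>+\<close> and \<open>*\<close> on \<open>bit\<close> are simplified to bit operations, which blocks ring reasoning.\<close>

declare add_bit_eq_xor [simp del] mult_bit_eq_and [simp del]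

text \<open>Both bounds turn on one exponent. With \<open>r = 2 * h\<close> and time
  \<open>n - s\<close>, the count with the vanishing constraint makes the rank \<open>r\<close> part
  of the squared \<open>L2\<close> bound about \<open>2 ^ (r * s - r * (r - 1) / 2 - n)\<close>.
  This is largest at \<open>r = s\<close> and \<open>r = s + 1\<close>, where the exponent is
  \<open>tri s - n\<close>; the lower bound has error \<open>2 ^ (n - tri s)\<close>. The gain is
  available because forms in the walk have no diagonal terms, so every \<open>unit_vec i\<close> is
  a zero and each of the \<open>n\<close> vertices must be sent to a zero of the factored form. The
  obstacle is low rank: the proportion of zeros can be \<open>(1 + 1 / 2 ^ h) / 2\<close>, whose
  \<open>n\<close>-th power is \<open>O(1 / 2 ^ n)\<close> only for \<open>2 ^ h \<ge> n\<close>.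
  For smaller \<open>h\<close> the proportion is at most 3/4, and exponential decay beats the
  remaining factor \<open>n ^ (2 * s)\<close> since \<open>s = O(sqrt n)\<close>. Every object is
  counted together with an ordered basis. The number of bases of an \<open>r\<close>-dimensional
  space is \<open>2 ^ (r * r)\<close> times a product that stays above 1/4 (upper bound) and above
  \<open>1 / kappa\<close> (lower bound); this is where \<open>kappa\<close> comes from.\<close>

definition Vec :: "'i set \<Rightarrow> ('i \<Rightarrow> bit) set" where
  "Vec I = {x. \<forall>i. i \<notin> I \<longrightarrow> x i = 0}"

text \<open>Over the field with two elements the scalars are 0 and 1 and each vector is its own
  negative, so these are exactly the linear subspaces.\<close>

definition subgrp :: "('i \<Rightarrow> bit) set \<Rightarrow> bool" where
  "subgrp A \<longleftrightarrow> 0 \<in> A \<and> (\<forall>x\<in>A. \<forall>y\<in>A. x + y \<in> A)"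

text \<open>The nontrivial additive character \<open>(-1) ^ a\<close>.\<close>

definition sgn2 :: "bit \<Rightarrow> real" where
  "sgn2 a = (if a = 0 then 1 else -1)"

lemma bit_add_self [simp]: "a + a = (0::bit)"
  by (cases a) simp_all

lemma bit_add_eq_0_iff: "a + b = 0 \<longleftrightarrow> a = (b::bit)"
  by (cases a; cases b) simp_all

lemma bit_fun_add_self [simp]: "x + x = (0::'i \<Rightarrow> bit)"
  by (simp add: fun_eq_iff)

lemma bit_fun_add_add_self [simp]: "x + (x + y) = (y::'i \<Rightarrow> bit)"
  by (simp add: add.assoc[symmetric])

lemma bit_fun_add_eq_0_iff: "x + y = 0 \<longleftrightarrow> x = (y::'i \<Rightarrow> bit)"
  by (simp add: fun_eq_iff bit_add_eq_0_iff)

lemma sgn2_add: "sgn2 (a + b) = sgn2 a * sgn2 b"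
  by (cases a; cases b) (simp_all add: sgn2_def)

lemma sgn2_0 [simp]: "sgn2 0 = 1" and sgn2_1 [simp]: "sgn2 1 = - 1"
  by (simp_all add: sgn2_def)

lemma abs_sgn2 [simp]: "\<bar>sgn2 a\<bar> = 1"
  by (simp add: sgn2_def)

lemma sgn2_square [simp]: "sgn2 a * sgn2 a = 1"
  by (simp add: sgn2_def)

lemma subgrp_Vec [simp]: "subgrp (Vec I)"
  by (simp add: subgrp_def Vec_def)

lemma Vec_0 [simp]: "0 \<in> Vec I"
  by (simp add: Vec_def)

lemma Vec_add [simp]: "x \<in> Vec I \<Longrightarrow> y \<in> Vec I \<Longrightarrow> x + y \<in> Vec I"
  by (simp add: Vec_def)

lemma bij_betw_Vec_Pow: "bij_betw (\<lambda>x. {i. x i = 1}) (Vec I) (Pow I)"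
proof (rule bij_betw_byWitness[where f' = "\<lambda>A i. of_bool (i \<in> A)"], goal_cases)
  case 1
  show ?case
  proof
    fix x :: "'a \<Rightarrow> bit"
    show "(\<lambda>i. of_bool (i \<in> {i. x i = 1})) = x"
    proof
      fix i show "of_bool (i \<in> {i. x i = 1}) = x i" by (cases "x i") simp_all
    qed
  qed
qed (auto simp: Vec_def)

lemma finite_Vec [simp]: "finite I \<Longrightarrow> finite (Vec I)"
  using bij_betw_finite[OF bij_betw_Vec_Pow[of I]] by simp

lemma card_Vec: "finite I \<Longrightarrow> card (Vec I) = 2 ^ card I"
  using bij_betw_same_card[OF bij_betw_Vec_Pow[of I]] by (simp add: card_Pow)

lemma subgrpD: "subgrp A \<Longrightarrow> x \<in> A \<Longrightarrow> y \<in> A \<Longrightarrow> x + y \<in> A"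
  and subgrp_0: "subgrp A \<Longrightarrow> 0 \<in> A"
  by (auto simp: subgrp_def)

lemma subgrp_image:
  fixes f :: "('i \<Rightarrow> bit) \<Rightarrow> ('k \<Rightarrow> bit)"
  assumes "subgrp A" "\<And>x y. x \<in> A \<Longrightarrow> y \<in> A \<Longrightarrow> f (x + y) = f x + f y"
  shows "subgrp (f ` A)"
proof -
  have "f (0 + 0) = f 0 + f 0" using assms by (intro assms(2)) (auto simp: subgrp_def)
  hence "f 0 = 0" by simp
  hence "0 \<in> f ` A" using subgrp_0[OF assms(1)] by (metis imageI)
  moreover have "f x + f y \<in> f ` A" if "x \<in> A" "y \<in> A" for x y
    unfolding assms(2)[OF that, symmetric] using subgrpD[OF assms(1) that] by (rule imageI)
  ultimately show ?thesis unfolding subgrp_def by blast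
qed

text \<open>Translation by one preimage of \<open>y\<close> carries the kernel onto the fibre; in
  characteristic 2 this translation is its own inverse.\<close>

lemma card_fibre:
  fixes f :: "('i \<Rightarrow> bit) \<Rightarrow> ('k \<Rightarrow> bit)"
  assumes A: "subgrp A" and add: "\<And>x y. x \<in> A \<Longrightarrow> y \<in> A \<Longrightarrow> f (x + y) = f x + f y"
    and y: "y \<in> f ` A"
  shows "card {a\<in>A. f a = y} = card {a\<in>A. f a = 0}"
proof -
  obtain a where a: "a \<in> A" "f a = y" using y by blast
  have "bij_betw (\<lambda>x. a + x) {x\<in>A. f x = 0} {x\<in>A. f x = y}"
    by (rule bij_betw_byWitness[where f' = "\<lambda>x. a + x"])
       (use a in \<open>auto simp: add subgrpD[OF A]\<close>)
  thus ?thesis by (rule bij_betw_same_card[symmetric])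
qed

lemma card_hom:
  fixes f :: "('i \<Rightarrow> bit) \<Rightarrow> ('k \<Rightarrow> bit)"
  assumes A: "subgrp A" and fin: "finite A"
    and add: "\<And>x y. x \<in> A \<Longrightarrow> y \<in> A \<Longrightarrow> f (x + y) = f x + f y"
  shows "card A = card (f ` A) * card {a\<in>A. f a = 0}"
proof -
  have "card A = (\<Sum>a\<in>A. 1)" by simp
  also have "\<dots> = (\<Sum>y\<in>f ` A. \<Sum>a\<in>{a\<in>A. f a = y}. 1)"
    by (rule sum.image_gen[OF fin])
  also have "\<dots> = (\<Sum>y\<in>f ` A. card {a\<in>A. f a = 0})"
    by (rule sum.cong) (simp_all only: card_eq_sum[symmetric] card_fibre[OF A add])
  finally show ?thesis by simp
qed

text \<open>Orthogonality of characters: translating by an element where \<open>f\<close> is 1 flips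
  every sign, so the sum equals its own negative.\<close>

lemma sum_sgn2_hom:
  fixes f :: "('i \<Rightarrow> bit) \<Rightarrow> bit"
  assumes A: "subgrp A" and fin: "finite A"
    and add: "\<And>x y. x \<in> A \<Longrightarrow> y \<in> A \<Longrightarrow> f (x + y) = f x + f y"
  shows "(\<Sum>a\<in>A. sgn2 (f a)) = (if \<forall>a\<in>A. f a = 0 then real (card A) else 0)"
proof (cases "\<forall>a\<in>A. f a = 0")
  case True
  thus ?thesis by simp
next
  case False
  then obtain c where c: "c \<in> A" "f c = 1" by auto
  have "bij_betw (\<lambda>x. c + x) A A"
    by (rule bij_betw_byWitness[where f' = "\<lambda>x. c + x"]) (use c in \<open>auto simp: subgrpD[OF A]\<close>)
  hence "(\<Sum>a\<in>A. sgn2 (f a)) = (\<Sum>a\<in>A. sgn2 (f (c + a)))"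
    by (rule sum.reindex_bij_betw[symmetric])
  also have "\<dots> = (\<Sum>a\<in>A. - sgn2 (f a))"
    using c by (intro sum.cong) (simp_all add: add sgn2_add)
  finally have "(\<Sum>a\<in>A. sgn2 (f a)) = 0" by (simp add: sum_negf)
  thus ?thesis by (simp only: if_not_P[OF False])
qed

section \<open>Spans, independent lists and the counting of ordered bases\<close>

primrec lspan :: "('i \<Rightarrow> bit) list \<Rightarrow> ('i \<Rightarrow> bit) set" where
  "lspan [] = {0}"
| "lspan (y # ys) = lspan ys \<union> (\<lambda>v. y + v) ` lspan ys"

text \<open>Independence is kept as a property of lists because ordered bases are counted: each
  vector is chosen outside the span of those already in the tail.\<close>

primrec indep :: "('i \<Rightarrow> bit) list \<Rightarrow> bool" where
  "indep [] \<longleftrightarrow> True"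
| "indep (y # ys) \<longleftrightarrow> y \<notin> lspan ys \<and> indep ys"

lemma subgrp_lspan [simp]: "subgrp (lspan ys)"
proof (induction ys)
  case Nil
  show ?case by (simp add: subgrp_def)
next
  case (Cons y ys)
  have "a + b \<in> lspan (y # ys)" if a: "a \<in> lspan (y # ys)" and b: "b \<in> lspan (y # ys)" for a b
  proof -
    obtain u where u: "u \<in> lspan ys" "a = u \<or> a = y + u" using a by auto
    obtain v where v: "v \<in> lspan ys" "b = v \<or> b = y + v" using b by auto
    have "a + b = u + v \<or> a + b = y + (u + v)"
      using u(2) v(2) by (auto simp: add_ac)
    thus ?thesis using subgrpD[OF Cons u(1) v(1)] by auto
  qed
  thus ?case using subgrp_0[OF Cons] by (auto simp: subgrp_def)
qed

lemma finite_lspan [simp]: "finite (lspan ys)"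
  by (induction ys) auto

lemma lspan_subset: "subgrp A \<Longrightarrow> set ys \<subseteq> A \<Longrightarrow> lspan ys \<subseteq> A"
  by (induction ys) (auto simp: subgrp_0 intro: subgrpD)

lemma set_subset_lspan: "set ys \<subseteq> lspan ys"
proof (induction ys)
  case (Cons y ys)
  have "y + 0 \<in> lspan (y # ys)" using subgrp_0[OF subgrp_lspan, of ys] by auto
  thus ?case using Cons by auto
qed simp

lemma card_lspan: "indep ys \<Longrightarrow> card (lspan ys) = 2 ^ length ys"
proof (induction ys)
  case (Cons y ys)
  have "lspan ys \<inter> (\<lambda>v. y + v) ` lspan ys = {}"
  proof (rule ccontr)
    assume "lspan ys \<inter> (\<lambda>v. y + v) ` lspan ys \<noteq> {}"
    then obtain v where "v \<in> lspan ys" "y + v \<in> lspan ys" by blast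
    hence "v + (v + y) \<in> lspan ys" by (metis subgrpD[OF subgrp_lspan] add.commute)
    thus False using Cons.prems by simp
  qed
  moreover have "card ((\<lambda>v. y + v) ` lspan ys) = card (lspan ys)"
    by (intro card_image) (auto simp: inj_on_def)
  ultimately show ?case using Cons by (simp add: card_Un_disjoint)
qed simp

definition indep_lists :: "('i \<Rightarrow> bit) set \<Rightarrow> nat \<Rightarrow> ('i \<Rightarrow> bit) list set" where
  "indep_lists A k = {ys. set ys \<subseteq> A \<and> length ys = k \<and> indep ys}"

lemma indep_lists_0: "indep_lists A 0 = {[]}"
  by (auto simp: indep_lists_def)

lemma finite_indep_lists [simp]: "finite A \<Longrightarrow> finite (indep_lists A k)"
  by (rule finite_subset[OF _ finite_lists_length_eq[of A k]]) (auto simp: indep_lists_def)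

lemma indep_lists_Suc:
  "indep_lists A (Suc k) = (\<lambda>(ys, y). y # ys) ` (SIGMA ys:indep_lists A k. A - lspan ys)"
  by (auto simp: indep_lists_def length_Suc_conv image_iff)

text \<open>After \<open>i\<close> choices the span has \<open>2 ^ i\<close> elements to avoid. Once
  \<open>i\<close> reaches the dimension of \<open>A\<close> the factor is 0, so the formula also
  holds for \<open>k\<close> beyond it.\<close>

lemma card_indep_lists:
  assumes A: "subgrp A" "finite A"
  shows "card (indep_lists A k) = (\<Prod>i<k. card A - 2 ^ i)"
proof (induction k)
  case (Suc k)
  have "card (indep_lists A (Suc k)) = card (SIGMA ys:indep_lists A k. A - lspan ys)"
    unfolding indep_lists_Suc by (intro card_image) (auto simp: inj_on_def)
  also have "\<dots> = (\<Sum>ys\<in>indep_lists A k. card (A - lspan ys))"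
    using A by (intro card_SigmaI) auto
  also have "\<dots> = (\<Sum>ys\<in>indep_lists A k. card A - 2 ^ k)"
  proof (intro sum.cong refl)
    fix ys assume "ys \<in> indep_lists A k"
    hence *: "set ys \<subseteq> A" "length ys = k" "indep ys" by (auto simp: indep_lists_def)
    have "lspan ys \<subseteq> A" using A * by (intro lspan_subset) auto
    thus "card (A - lspan ys) = card A - 2 ^ k" 
      using A * by (simp add: card_Diff_subset card_lspan)
  qed
  also have "\<dots> = (\<Prod>i<Suc k. card A - 2 ^ i)" using Suc by simp
  finally show ?case .
qed (simp add: indep_lists_0)

lemma indep_lists_lspan:
  assumes "subgrp A" "finite A" "card A = 2 ^ k" "ys \<in> indep_lists A k"
  shows "lspan ys = A"
  using assms lspan_subset[of A ys]
  by (intro card_subset_eq) (auto simp: indep_lists_def card_lspan)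

text \<open>An independent list in \<open>A\<close> of maximal length spans \<open>A\<close>; a
  maximum exists because \<open>2 ^ length ys \<le> card A\<close> bounds the lengths.\<close>

lemma card_subgrp:
  assumes A: "subgrp A" "finite A"
  obtains k where "card A = 2 ^ k"
proof -
  have bd: "length ys < card A" if "set ys \<subseteq> A" "indep ys" for ys
  proof -
    have "2 ^ length ys \<le> card A"
      using card_mono[OF A(2) lspan_subset[OF A(1) that(1)]] card_lspan[OF that(2)] by simp
    moreover have "length ys < 2 ^ length ys" by (rule less_exp)
    ultimately show ?thesis by linarith
  qed
  define P where "P k \<longleftrightarrow> (\<exists>ys. set ys \<subseteq> A \<and> indep ys \<and> length ys = k)" for k
  have P0: "P 0" unfolding P_def by (intro exI[of _ "[]"]) simp
  have "\<forall>k. P k \<longrightarrow> k \<le> card A" unfolding P_def using bd less_imp_le by blast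
  then obtain k where k: "P k" "\<And>j. P j \<Longrightarrow> j \<le> k" using P0 Nat.ex_has_greatest_nat by metis
  then obtain ys where ys: "set ys \<subseteq> A" "indep ys" "length ys = k" unfolding P_def by blast
  have "A \<subseteq> lspan ys"
  proof
    fix y assume "y \<in> A"
    show "y \<in> lspan ys"
    proof (rule ccontr)
      assume "y \<notin> lspan ys"
      hence "P (Suc k)" unfolding P_def using ys \<open>y \<in> A\<close> by (intro exI[of _ "y # ys"]) auto
      thus False using k(2) by force
    qed
  qed
  hence "lspan ys = A" using lspan_subset[OF A(1) ys(1)] by blast
  thus ?thesis using card_lspan[OF ys(2)] that by metis
qed

lemma indep_le_card:
  assumes "subgrp A" "finite A" "card A = 2 ^ n" "set ys \<subseteq> A" "indep ys"
  shows "length ys \<le> n"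
  using card_mono[OF assms(2) lspan_subset[OF assms(1,4)]] card_lspan[OF assms(5)] assms(3)
  by simp

section \<open>The standard pairing, annihilators and duality\<close>

definition dot :: "'i set \<Rightarrow> ('i \<Rightarrow> bit) \<Rightarrow> ('i \<Rightarrow> bit) \<Rightarrow> bit" where
  "dot I x y = (\<Sum>i\<in>I. x i * y i)"

lemma dot_add_left: "dot I (x + y) z = dot I x z + dot I y z"
  by (simp add: dot_def algebra_simps sum.distrib)

lemma dot_add_right: "dot I z (x + y) = dot I z x + dot I z y"
  by (simp add: dot_def algebra_simps sum.distrib)

lemma dot_0 [simp]: "dot I 0 z = 0" "dot I z 0 = 0"
  by (simp_all add: dot_def)

lemma dot_commute: "dot I x y = dot I y x"
  by (simp add: dot_def mult.commute)

definition unit_vec :: "'i \<Rightarrow> 'i \<Rightarrow> bit" where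
  "unit_vec i = (\<lambda>j. of_bool (j = i))"

lemma unit_vec_Vec: "i \<in> I \<Longrightarrow> unit_vec i \<in> Vec I"
  by (auto simp: unit_vec_def Vec_def)

lemma dot_unit_vec: "finite I \<Longrightarrow> i \<in> I \<Longrightarrow> dot I x (unit_vec i) = x i"
proof -
  assume I: "finite I" "i \<in> I"
  have "dot I x (unit_vec i) = (\<Sum>j\<in>I. if j = i then x j else 0)"
    unfolding dot_def unit_vec_def by (intro sum.cong) auto
  thus ?thesis using I by (simp add: sum.delta)
qed

lemma dot_nondegenerate:
  assumes "finite I" "x \<in> Vec I" "\<And>y. y \<in> Vec I \<Longrightarrow> dot I x y = 0"
  shows "x = 0"
proof
  fix i show "x i = 0 i"
  proof (cases "i \<in> I")
    case True
    thus ?thesis using assms(3)[OF unit_vec_Vec[OF True]] dot_unit_vec[OF assms(1) True] by simp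
  next
    case False
    thus ?thesis using assms(2) by (simp add: Vec_def)
  qed
qed

lemma sum_sgn2_dot:
  assumes "finite I" "x \<in> Vec I"
  shows "(\<Sum>y\<in>Vec I. sgn2 (dot I x y)) = (if x = 0 then 2 ^ card I else 0)"
proof -
  have "(\<Sum>y\<in>Vec I. sgn2 (dot I x y)) = 
      (if \<forall>y\<in>Vec I. dot I x y = 0 then real (card (Vec I)) else 0)"
    using assms by (intro sum_sgn2_hom) (auto simp: dot_add_right)
  moreover have "(\<forall>y\<in>Vec I. dot I x y = 0) \<longleftrightarrow> x = 0"
    using dot_nondegenerate[OF assms] by auto
  ultimately show ?thesis using assms by (simp add: card_Vec)
qed

definition ann :: "'i set \<Rightarrow> ('i \<Rightarrow> bit) set \<Rightarrow> ('i \<Rightarrow> bit) set" where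
  "ann I U = {p \<in> Vec I. \<forall>u\<in>U. dot I p u = 0}"

lemma subgrp_ann [simp]: "subgrp (ann I U)"
  by (auto simp: ann_def subgrp_def dot_add_left)

lemma finite_ann [simp]: "finite I \<Longrightarrow> finite (ann I U)"
  by (simp add: ann_def)

text \<open>Double counting of the sum of \<open>sgn2 (dot I p u)\<close> over all \<open>p\<close>
  and all \<open>u\<close> in \<open>U\<close>: summing over \<open>u\<close> first leaves only
  \<open>p\<close> in the annihilator, summing over \<open>p\<close> first leaves only
  \<open>u = 0\<close>.\<close>

lemma card_ann:
  assumes I: "finite I" and U: "subgrp U" "U \<subseteq> Vec I"
  shows "card U * card (ann I U) = 2 ^ card I"
proof -
  have fU: "finite U" by (rule finite_subset[OF U(2) finite_Vec[OF I]])
  have "real (card U * card (ann I U)) = (\<Sum>p\<in>ann I U. real (card U))" by simp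
  also have "\<dots> = (\<Sum>p\<in>Vec I. if \<forall>u\<in>U. dot I p u = 0 then real (card U) else 0)"
    using I unfolding ann_def by (subst sum.inter_filter[symmetric]) auto
  also have "\<dots> = (\<Sum>p\<in>Vec I. \<Sum>u\<in>U. sgn2 (dot I p u))"
    by (intro sum.cong refl sum_sgn2_hom[symmetric] U fU dot_add_right)
  also have "\<dots> = (\<Sum>u\<in>U. \<Sum>p\<in>Vec I. sgn2 (dot I u p))"
    by (subst sum.swap) (simp add: dot_commute)
  also have "\<dots> = (\<Sum>u\<in>U. if u = 0 then 2 ^ card I else 0)"
    using I U by (intro sum.cong refl sum_sgn2_dot) auto
  also have "\<dots> = real (2 ^ card I)"
    using fU subgrp_0[OF U(1)] by simp
  finally show ?thesis by (simp only: of_nat_eq_iff)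
qed

lemma ann_lspan: "ann I (lspan ys) = {p \<in> Vec I. \<forall>y\<in>set ys. dot I p y = 0}"
proof -
  have "(\<forall>u\<in>lspan ys. dot I p u = 0) \<longleftrightarrow> (\<forall>y\<in>set ys. dot I p y = 0)" for p
  proof
    assume *: "\<forall>y\<in>set ys. dot I p y = 0"
    have "subgrp {u. dot I p u = 0}" by (auto simp: subgrp_def dot_add_right)
    hence "lspan ys \<subseteq> {u. dot I p u = 0}" using * by (intro lspan_subset) auto
    thus "\<forall>u\<in>lspan ys. dot I p u = 0" by auto
  qed (use set_subset_lspan in auto)
  thus ?thesis by (simp add: ann_def)
qed

text \<open>Otherwise \<open>v\<close> would lie in the double annihilator of \<open>U\<close>,
  which contains \<open>U\<close> and has the same size by applying \<open>card_ann\<close>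
  twice.\<close>

lemma ann_separates:
  assumes I: "finite I" and U: "subgrp U" "U \<subseteq> Vec I" and v: "v \<in> Vec I" "v \<notin> U"
  shows "\<exists>p\<in>ann I U. dot I p v = 1"
proof (rule ccontr)
  assume "\<not> ?thesis"
  hence 0: "dot I p v = 0" if "p \<in> ann I U" for p using that by auto
  have fU: "finite U" by (rule finite_subset[OF U(2) finite_Vec[OF I]])
  define U' where "U' = ann I (ann I U)"
  have U': "subgrp U'" "finite U'" unfolding U'_def using I by simp_all
  have "insert v U \<subseteq> U'"
    using 0 v U by (auto simp: U'_def ann_def dot_commute)
  hence "card U < card U'" using v(2) U' fU by (intro psubset_card_mono) auto
  moreover have "card (ann I U) * card U' = 2 ^ card I" unfolding U'_def
    by (intro card_ann I subgrp_ann) (auto simp: ann_def)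
  moreover have "card U * card (ann I U) = 2 ^ card I" by (intro card_ann I U)
  ultimately have "card (ann I U) * card U' = card (ann I U) * card U" "card U < card U'"
    by (simp_all add: mult.commute)
  moreover have "card (ann I U) \<noteq> 0"
    using subgrp_0[OF subgrp_ann, of I U] I by (metis card_0_eq empty_iff finite_ann)
  ultimately show False by simp
qed

section \<open>Quadratic forms and Gauss sums\<close>

lemma additive_eq_dot:
  fixes f :: "('i \<Rightarrow> bit) \<Rightarrow> bit"
  assumes "finite I" "\<And>x y. x \<in> Vec I \<Longrightarrow> y \<in> Vec I \<Longrightarrow> f (x + y) = f x + f y" "y \<in> Vec I"
  shows "f y = dot I (\<lambda>k. f (unit_vec k)) y"
  using assms
proof (induction I arbitrary: y rule: finite_induct)
  case empty
  hence "y = 0" by (auto simp: Vec_def)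
  moreover have "f (0 + 0) = f 0 + f 0" by (rule empty.prems(1)) (simp_all flip: zero_fun_def)
  hence "f 0 = 0" by simp
  ultimately show ?case by (simp add: dot_def flip: zero_fun_def)
next
  case (insert i I)
  define z where "z = y(i := 0)"
  have sub: "x \<in> Vec (insert i I)" if "x \<in> Vec I" for x using that by (auto simp: Vec_def)
  have z: "z \<in> Vec I" using insert.prems by (auto simp: z_def Vec_def)
  have IH: "f z = dot I (\<lambda>k. f (unit_vec k)) z"
    by (rule insert.IH) (use insert.prems(1) sub z in auto)
  have dz: "dot I g y = dot I g z" for g
    unfolding dot_def z_def using insert.hyps by (intro sum.cong) auto
  show ?case
  proof (cases "y i = 0")
    case True
    hence 0: "y i = 0" .
    hence "z = y" by (auto simp: z_def)
    thus ?thesis using IH insert.hyps 0 by (simp add: dot_def)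
  next
    case False
    hence 1: "y i = 1" by simp
    have y: "y = unit_vec i + z" using 1 by (auto simp: z_def unit_vec_def fun_eq_iff)
    have "f y = f (unit_vec i) + f z" unfolding y
      by (rule insert.prems(1)) (use sub z in \<open>auto intro: unit_vec_Vec\<close>)
    also have "\<dots> = dot (insert i I) (\<lambda>k. f (unit_vec k)) y"
      using insert.hyps 1 dz[of "\<lambda>k. f (unit_vec k)"] IH by (simp add: dot_def)
    finally show ?thesis .
  qed
qed

definition outer_sq :: "('i \<Rightarrow> bit) \<Rightarrow> 'i \<times> 'i \<Rightarrow> bit" where
  "outer_sq x = (\<lambda>(i, j). x i * x j)"

text \<open>Written as the pairing of \<open>b\<close> with \<open>outer_sq x\<close>, so that the
  character indexed by \<open>b\<close>, evaluated at the increment of one step, is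
  \<open>sgn2\<close> of this form.\<close>

definition qf :: "('i \<times> 'i) set \<Rightarrow> ('i \<times> 'i \<Rightarrow> bit) \<Rightarrow> ('i \<Rightarrow> bit) \<Rightarrow> bit" where
  "qf I b x = dot I b (outer_sq x)"

text \<open>The alternating bilinear form attached to \<open>qf\<close>. In characteristic 2 it does
  not determine the quadratic form: diagonal coefficients contribute twice and disappear.\<close>

definition polar :: "('i \<times> 'i) set \<Rightarrow> ('i \<times> 'i \<Rightarrow> bit) \<Rightarrow> ('i \<Rightarrow> bit) \<Rightarrow> ('i \<Rightarrow> bit) \<Rightarrow> bit" where
  "polar I b x y = dot I b (\<lambda>(i, j). x i * y j + x j * y i)"

lemma qf_add: "qf I b (x + y) = qf I b x + qf I b y + polar I b x y"
proof -
  have "outer_sq (x + y) = outer_sq x + outer_sq y + (\<lambda>(i, j). x i * y j + x j * y i)"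
    by (auto simp: outer_sq_def fun_eq_iff algebra_simps)
  thus ?thesis by (simp add: qf_def polar_def dot_add_right)
qed

lemma polar_commute: "polar I b x y = polar I b y x"
  unfolding polar_def by (intro arg_cong2[where f = "dot I"] refl) (auto simp: add.commute mult.commute)

lemma polar_add_left: "polar I b (x + y) z = polar I b x z + polar I b y z"
  unfolding polar_def dot_add_right[symmetric]
  by (intro arg_cong2[where f = "dot I"] refl) (auto simp: algebra_simps)

lemma polar_add_right: "polar I b z (x + y) = polar I b z x + polar I b z y"
  by (simp add: polar_commute[of I b z] polar_add_left)

lemma polar_eq_qf: "polar I b x y = qf I b (x + y) + (qf I b x + qf I b y)"
proof -
  have *: "p = a + c + p + (a + c)" for a c p :: bit
    by (cases a; cases c; cases p) simp_all
  show ?thesis unfolding qf_add by (rule *)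
qed

text \<open>An opaque name for \<open>{1..n}\<close>, which the simplifier would otherwise turn into \<open>{Suc 0..n}\<close>.\<close>

definition verts :: "nat \<Rightarrow> nat set" where
  "verts n = {1..n}"

lemma finite_verts [simp]: "finite (verts n)" and card_verts [simp]: "card (verts n) = n"
  by (simp_all add: verts_def)

definition edges :: "nat \<Rightarrow> (nat \<times> nat) set" where
  "edges n = {(i, j). 1 \<le> i \<and> i < j \<and> j \<le> n}"

lemma finite_edges [simp]: "finite (edges n)"
  by (rule finite_subset[of _ "{1..n} \<times> {1..n}"]) (auto simp: edges_def)

lemma card_strict_upper: "card {(a, c). a < c \<and> c < (r::nat)} = r choose 2"
proof (induction r)
  case (Suc r)
  have "{(a, c). a < c \<and> c < Suc r} = {(a, c). a < c \<and> c < r} \<union> (\<lambda>a. (a, r)) ` {..<r}"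
    by (auto simp: less_Suc_eq)
  moreover have "finite {(a, c). a < c \<and> c < r}"
    by (rule finite_subset[of _ "{..<r} \<times> {..<r}"]) auto
  moreover have "card ((\<lambda>a. (a, r)) ` {..<r}) = r"
    by (subst card_image) (auto simp: inj_on_def)
  moreover have "{(a, c). a < c \<and> c < r} \<inter> (\<lambda>a. (a, r)) ` {..<r} = {}" by auto
  ultimately have "card {(a, c). a < c \<and> c < Suc r} = (r choose 2) + r"
    using Suc by (subst \<open>{(a, c). a < c \<and> c < Suc r} = _\<close>, subst card_Un_disjoint) auto
  thus ?case by (simp add: numeral_2_eq_2)
qed simp

lemma card_edges: "card (edges n) = n choose 2"
proof -
  have "bij_betw (\<lambda>(a, c). (Suc a, Suc c)) {(a, c). a < c \<and> c < n} (edges n)"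
    by (rule bij_betw_byWitness[where f' = "\<lambda>(a, c). (a - 1, c - 1)"]) (auto simp: edges_def)
  from bij_betw_same_card[OF this] show ?thesis by (simp add: card_strict_upper)
qed

lemma card_upper: "card {(a, c). a \<le> c \<and> c < (r::nat)} = (r choose 2) + r"
proof -
  have "{(a, c). a \<le> c \<and> c < r} = {(a, c). a < c \<and> c < r} \<union> (\<lambda>a. (a, a)) ` {..<r}"
    by (auto simp: le_less)
  moreover have "finite {(a, c). a < c \<and> c < r}"
    by (rule finite_subset[of _ "{..<r} \<times> {..<r}"]) auto
  moreover have "card ((\<lambda>a. (a, a)) ` {..<r}) = r"
    by (subst card_image) (auto simp: inj_on_def)
  moreover have "{(a, c). a < c \<and> c < r} \<inter> (\<lambda>a. (a, a)) ` {..<r} = {}" by auto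
  ultimately show ?thesis
    using card_strict_upper[of r]
    by (subst \<open>{(a, c). a \<le> c \<and> c < r} = _\<close>, subst card_Un_disjoint) auto
qed

lemma finite_upper [simp]: "finite {(a, c). a \<le> c \<and> c < (r::nat)}"
  "finite {(a, c). a < c \<and> c < (r::nat)}"
  by (rule finite_subset[of _ "{..<r} \<times> {..<r}"]; auto)+

lemma polar_unit_vec:
  assumes "(i, j) \<in> edges n"
  shows "polar (edges n) b (unit_vec i) (unit_vec j) = b (i, j)"
proof -
  have "polar (edges n) b (unit_vec i) (unit_vec j) = 
     (\<Sum>p\<in>edges n. if p = (i, j) then b p else 0)"
    unfolding polar_def dot_def
  proof (intro sum.cong refl)
    fix p assume p: "p \<in> edges n"
    obtain a c where ac: "p = (a, c)" by (cases p)
    \<comment> \<open>Pairs in \<open>edges n\<close> are increasing, so the transposed product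
      never fires and only the coefficient at \<open>(i, j)\<close> survives.\<close>
    have "\<not> (a = j \<and> c = i)" using p ac assms by (auto simp: edges_def)
    thus "b p * (case p of (k, l) \<Rightarrow> unit_vec i k * unit_vec j l + unit_vec i l * unit_vec j k) =
        (if p = (i, j) then b p else 0)"
      unfolding ac unit_vec_def by (cases "a = i"; cases "c = j") auto
  qed
  thus ?thesis using assms by (simp add: sum.delta)
qed

text \<open>Forms indexed by \<open>edges n\<close> have no diagonal terms. This is the constraint
  behind the factor \<open>2 ^ (- n)\<close> in the second count.\<close>

lemma qf_unit_vec: "qf (edges n) b (unit_vec i) = 0"
  unfolding qf_def dot_def by (intro sum.neutral) (auto simp: outer_sq_def unit_vec_def edges_def)

section \<open>Row space and radical of a form\<close>

definition polar_row :: "nat \<Rightarrow> (nat \<times> nat \<Rightarrow> bit) \<Rightarrow> (nat \<Rightarrow> bit) \<Rightarrow> nat \<Rightarrow> bit" where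
  "polar_row n b x = (\<lambda>k. if k \<in> verts n then polar (edges n) b x (unit_vec k) else 0)"

definition polar_space :: "nat \<Rightarrow> (nat \<times> nat \<Rightarrow> bit) \<Rightarrow> (nat \<Rightarrow> bit) set" where
  "polar_space n b = polar_row n b ` Vec (verts n)"

definition polar_radical :: "nat \<Rightarrow> (nat \<times> nat \<Rightarrow> bit) \<Rightarrow> (nat \<Rightarrow> bit) set" where
  "polar_radical n b = {x \<in> Vec (verts n). \<forall>y\<in>Vec (verts n). polar (edges n) b x y = 0}"

lemma polar_row_add: "polar_row n b (x + y) = polar_row n b x + polar_row n b y"
  by (auto simp: polar_row_def fun_eq_iff polar_add_left)

lemma polar_row_Vec [simp]: "polar_row n b x \<in> Vec (verts n)"
  by (auto simp: polar_row_def Vec_def)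

lemma dot_row:
  assumes "y \<in> Vec (verts n)"
  shows "dot (verts n) (polar_row n b x) y = polar (edges n) b x y"
proof -
  have "polar (edges n) b x y = dot (verts n) (\<lambda>k. polar (edges n) b x (unit_vec k)) y"
    by (rule additive_eq_dot[where f = "polar (edges n) b x", OF finite_verts polar_add_right assms])
  also have "\<dots> = dot (verts n) (polar_row n b x) y"
    unfolding dot_def polar_row_def by (intro sum.cong) auto
  finally show ?thesis by simp
qed

lemma polar_space_subgrp [simp]: "subgrp (polar_space n b)"
  unfolding polar_space_def by (rule subgrp_image) (simp_all add: polar_row_add)

lemma polar_space_subset: "polar_space n b \<subseteq> Vec (verts n)"
  by (auto simp: polar_space_def)

lemma finite_polar_space [simp]: "finite (polar_space n b)"
  by (simp add: polar_space_def)

text \<open>Symmetry of the polar form makes its kernel the annihilator of its row space. Hence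
  pairing with a basis of the row space gives coordinates modulo the radical.\<close>

lemma polar_radical_eq_ann: "polar_radical n b = ann (verts n) (polar_space n b)"
proof -
  have "(\<forall>u\<in>polar_row n b ` Vec (verts n). dot (verts n) x u = 0) \<longleftrightarrow> (\<forall>y\<in>Vec (verts n). polar (edges n) b x y = 0)"
    if "x \<in> Vec (verts n)" for x
    using that by (auto simp: dot_commute[of _ x] dot_row polar_commute[of _ _ x])
  thus ?thesis unfolding polar_radical_def ann_def polar_space_def by blast
qed

lemma polar_radical_eq_kernel: "polar_radical n b = {x \<in> Vec (verts n). polar_row n b x = 0}"
proof -
  have "(\<forall>y\<in>Vec (verts n). polar (edges n) b x y = 0) \<longleftrightarrow> polar_row n b x = 0" for x
    using dot_nondegenerate[of "verts n" "polar_row n b x"] by (auto simp flip: dot_row)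
  thus ?thesis by (simp add: polar_radical_def)
qed

lemma polar_radical_subgrp [simp]: "subgrp (polar_radical n b)"
  by (simp add: polar_radical_eq_ann)

lemma polar_radical_subset: "polar_radical n b \<subseteq> Vec (verts n)"
  by (auto simp: polar_radical_def)

lemma finite_polar_radical [simp]: "finite (polar_radical n b)"
  by (simp add: polar_radical_eq_ann)

lemma card_polar_space_radical: "card (polar_space n b) * card (polar_radical n b) = 2 ^ n"
  using card_hom[of "Vec (verts n)" "polar_row n b"]
  by (simp add: polar_row_add card_Vec polar_space_def polar_radical_eq_kernel)

definition gauss_sum :: "nat \<Rightarrow> (nat \<times> nat \<Rightarrow> bit) \<Rightarrow> real" where
  "gauss_sum n b = (\<Sum>x\<in>Vec (verts n). sgn2 (qf (edges n) b x))"

text \<open>In the double sum substitute \<open>x\<close> by \<open>y + x\<close>: the phase becomes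
  \<open>q x + polar x y\<close>. Summing over \<open>y\<close> kills every \<open>x\<close> outside
  the radical, and on the radical the form is additive, so the remaining character sum is either
  full or zero.\<close>

lemma gauss_sum_square:
  "(gauss_sum n b)\<^sup>2 = (if \<forall>x\<in>polar_radical n b. qf (edges n) b x = 0 then 2 ^ n * real (card (polar_radical n b)) else 0)"
proof -
  let ?V = "Vec (verts n)" and ?q = "qf (edges n) b" and ?p = "polar (edges n) b"
  have "(gauss_sum n b)\<^sup>2 = (\<Sum>y\<in>?V. \<Sum>x\<in>?V. sgn2 (?q x) * sgn2 (?q y))"
    unfolding gauss_sum_def power2_eq_square sum_product by (rule sum.swap)
  also have "\<dots> = (\<Sum>y\<in>?V. \<Sum>x\<in>?V. sgn2 (?q (y + x)) * sgn2 (?q y))"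
  proof (rule sum.cong[OF refl])
    fix y assume y: "y \<in> ?V"
    have "bij_betw (\<lambda>x. y + x) ?V ?V"
      by (rule bij_betw_byWitness[where f' = "\<lambda>x. y + x"]) (use y in auto)
    thus "(\<Sum>x\<in>?V. sgn2 (?q x) * sgn2 (?q y)) = (\<Sum>x\<in>?V. sgn2 (?q (y + x)) * sgn2 (?q y))"
      by (rule sum.reindex_bij_betw[symmetric])
  qed
  also have "\<dots> = (\<Sum>y\<in>?V. \<Sum>x\<in>?V. sgn2 (?q x) * sgn2 (?p x y))"
  proof -
    have *: "sgn2 (q1 + q2 + p) * sgn2 q1 = sgn2 q2 * sgn2 p" for q1 q2 p
      by (cases q1; cases q2; cases p) simp_all
    show ?thesis by (simp add: qf_add * polar_commute)
  qed
  also have "\<dots> = (\<Sum>x\<in>?V. sgn2 (?q x) * (\<Sum>y\<in>?V. sgn2 (?p x y)))"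
    by (subst sum.swap) (simp add: sum_distrib_left)
  also have "\<dots> = (\<Sum>x\<in>?V. if x \<in> polar_radical n b then 2 ^ n * sgn2 (?q x) else 0)"
  proof (rule sum.cong[OF refl])
    fix x assume x: "x \<in> ?V"
    have "(\<Sum>y\<in>?V. sgn2 (?p x y)) = (if \<forall>y\<in>?V. ?p x y = 0 then real (card ?V) else 0)"
      by (intro sum_sgn2_hom) (auto simp: polar_add_right)
    thus "sgn2 (?q x) * (\<Sum>y\<in>?V. sgn2 (?p x y)) = (if x \<in> polar_radical n b then 2 ^ n * sgn2 (?q x) else 0)"
      using x by (simp add: polar_radical_def card_Vec)
  qed
  also have "\<dots> = (\<Sum>x\<in>{x\<in>?V. x \<in> polar_radical n b}. 2 ^ n * sgn2 (?q x))"
    by (rule sum.inter_filter[symmetric]) simp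
  also have "{x\<in>?V. x \<in> polar_radical n b} = polar_radical n b" using polar_radical_subset by auto
  also have "(\<Sum>x\<in>polar_radical n b. 2 ^ n * sgn2 (?q x)) = 2 ^ n * (\<Sum>x\<in>polar_radical n b. sgn2 (?q x))"
    by (simp add: sum_distrib_left)
  also have "(\<Sum>x\<in>polar_radical n b. sgn2 (?q x)) = 
     (if \<forall>x\<in>polar_radical n b. ?q x = 0 then real (card (polar_radical n b)) else 0)"
  proof (rule sum_sgn2_hom)
    fix x y assume "x \<in> polar_radical n b" "y \<in> polar_radical n b"
    hence "?p x y = 0" by (auto simp: polar_radical_def)
    thus "?q (x + y) = ?q x + ?q y" by (simp add: qf_add)
  qed auto
  finally show ?thesis by simp
qed

text \<open>The forms of rank \<open>r\<close> with nonzero Gauss sum.\<close>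

definition visible :: "nat \<Rightarrow> nat \<Rightarrow> (nat \<times> nat \<Rightarrow> bit) set" where
  "visible n r = {b \<in> Vec (edges n). card (polar_space n b) = 2 ^ r \<and> (\<forall>x\<in>polar_radical n b. qf (edges n) b x = 0)}"

lemma finite_visible [simp]: "finite (visible n r)"
  by (simp add: visible_def)

lemma card_radical_visible:
  assumes "b \<in> visible n r"
  shows "2 ^ r * card (polar_radical n b) = 2 ^ n"
  using assms card_polar_space_radical[of n b] by (simp add: visible_def)

lemma gauss_sum_visible:
  assumes "b \<in> visible n r"
  shows "(gauss_sum n b)\<^sup>2 * 2 ^ r = (2 ^ n)\<^sup>2"
proof -
  have "(2::real) ^ r * real (card (polar_radical n b)) = 2 ^ n"
    using card_radical_visible[OF assms] by (metis of_nat_mult of_nat_numeral of_nat_power)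
  moreover have "(gauss_sum n b)\<^sup>2 = 2 ^ n * real (card (polar_radical n b))"
    using assms by (simp add: visible_def gauss_sum_square)
  ultimately show ?thesis by (simp add: power2_eq_square mult_ac)
qed

lemma gauss_sum_cases:
  assumes "b \<in> Vec (edges n)" "gauss_sum n b \<noteq> 0"
  obtains r where "b \<in> visible n r"
proof -
  obtain r where "card (polar_space n b) = 2 ^ r"
    using card_subgrp[OF polar_space_subgrp finite_polar_space] by metis
  moreover have "\<forall>x\<in>polar_radical n b. qf (edges n) b x = 0"
    using gauss_sum_square[of n b] assms(2) by (metis power_not_zero)
  ultimately show ?thesis using that assms(1) by (auto simp: visible_def)
qed

lemma visible_rank_le:
  assumes "b \<in> visible n r"
  shows "r \<le> n"
proof -
  have "(2::nat) ^ r dvd 2 ^ n" using card_radical_visible[OF assms] by (metis dvd_triv_left)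
  thus ?thesis by (simp add: power_dvd_imp_le)
qed

text \<open>The Gauss sum is an integer, and its square times \<open>2 ^ r\<close> is a square.\<close>

lemma visible_rank_even:
  assumes "b \<in> visible n r"
  shows "even r"
proof -
  define N :: int where "N = (\<Sum>x\<in>Vec (verts n). if qf (edges n) b x = 0 then 1 else -1)"
  have N: "gauss_sum n b = of_int N"
    unfolding gauss_sum_def N_def of_int_sum by (intro sum.cong) (auto simp: sgn2_def)
  have "real_of_int (N\<^sup>2 * 2 ^ r) = real_of_int ((2 ^ n)\<^sup>2)"
    by (simp only: of_int_mult of_int_power of_int_numeral gauss_sum_visible[OF assms, unfolded N])
  hence "N\<^sup>2 * 2 ^ r = (2 ^ n)\<^sup>2" by (simp only: of_int_eq_iff)
  moreover have "int (nat \<bar>N\<bar>) ^ 2 = N\<^sup>2" by simp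
  ultimately have "int (nat \<bar>N\<bar> ^ 2 * 2 ^ r) = int (2 ^ (2 * n))"
    by (simp only: of_nat_mult of_nat_power of_nat_numeral power_mult mult.commute[of 2 n])
  hence *: "nat \<bar>N\<bar> ^ 2 * 2 ^ r = (2::nat) ^ (2 * n)" by (simp only: of_nat_eq_iff)
  hence "nat \<bar>N\<bar> ^ 2 dvd (2::nat) ^ (2 * n)" by (metis dvd_triv_left)
  hence "nat \<bar>N\<bar> dvd (2::nat) ^ (2 * n)" by (metis dvd_power_same dvd_trans dvd_triv_left power2_eq_square)
  then obtain k where "nat \<bar>N\<bar> = 2 ^ k" using divides_primepow_nat two_is_prime_nat by metis
  hence "(2 ^ k) ^ 2 * 2 ^ r = (2::nat) ^ (2 * n)" using * by (simp only:)
  hence "(2::nat) ^ (2 * k + r) = 2 ^ (2 * n)" by (simp only: power_add power_mult[symmetric] mult.commute[of k 2])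
  hence "2 * k + r = 2 * n" by simp
  thus ?thesis by presburger
qed

lemma visible_rank_0:
  assumes "b \<in> visible n 0"
  shows "b = 0"
proof
  fix p :: "nat \<times> nat"
  obtain i j where p: "p = (i, j)" by (cases p)
  show "b p = 0 p"
  proof (cases "p \<in> edges n")
    case True
    have "card (polar_radical n b) = card (Vec (verts n))" using card_radical_visible[OF assms] by (simp add: card_Vec)
    hence "polar_radical n b = Vec (verts n)" by (intro card_subset_eq polar_radical_subset) auto
    moreover have "unit_vec i \<in> Vec (verts n)" "unit_vec j \<in> Vec (verts n)"
      using True p by (auto simp: edges_def verts_def intro!: unit_vec_Vec)
    ultimately have "polar (edges n) b (unit_vec i) (unit_vec j) = 0"
      unfolding polar_radical_def by blast
    thus ?thesis using polar_unit_vec True p by simp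
  next
    case False
    thus ?thesis using assms by (cases p) (auto simp: visible_def Vec_def)
  qed
qed

section \<open>Counting forms of given rank\<close>

abbreviation utri :: "nat \<Rightarrow> (nat \<times> nat) set" where
  "utri r \<equiv> {(a, c). a \<le> c \<and> c < r}"

abbreviation sutri :: "nat \<Rightarrow> (nat \<times> nat) set" where
  "sutri r \<equiv> {(a, c). a < c \<and> c < r}"

lemma sum_square_split:
  fixes f :: "nat \<Rightarrow> nat \<Rightarrow> 'a::comm_monoid_add"
  shows "(\<Sum>a<r. \<Sum>c<r. f a c) = (\<Sum>(a, c)\<in>utri r. if a = c then f a c else f a c + f c a)"
proof -
  have "(\<Sum>a<r. \<Sum>c<r. f a c) = (\<Sum>(a, c)\<in>{..<r} \<times> {..<r}. f a c)"
    by (simp add: sum.cartesian_product)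
  also have "{..<r} \<times> {..<r} = (utri r) \<union> {(a, c). c < a \<and> a < r}" by auto
  also have "(\<Sum>(a, c)\<in>\<dots>. f a c) = (\<Sum>(a, c)\<in>utri r. f a c) + (\<Sum>(a, c)\<in>{(a, c). c < a \<and> a < r}. f a c)"
    by (rule sum.union_disjoint) 
      (auto intro: finite_subset[of _ "{..<r} \<times> {..<r}"])
  also have "(\<Sum>(a, c)\<in>{(a, c). c < a \<and> a < r}. f a c) = (\<Sum>(a, c)\<in>sutri r. f c a)"
    by (rule sum.reindex_bij_witness[of _ "\<lambda>(a, c). (c, a)" "\<lambda>(a, c). (c, a)"]) auto
  also have "\<dots> = (\<Sum>(a, c)\<in>utri r. if a = c then 0 else f c a)"
    by (rule sum.mono_neutral_cong_left) (use finite_upper[of r] in \<open>auto dest: le_neq_implies_less\<close>)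
  also have "(\<Sum>(a, c)\<in>utri r. f a c) + \<dots> = (\<Sum>(a, c)\<in>utri r. if a = c then f a c else f a c + f c a)"
    unfolding sum.distrib[symmetric] by (intro sum.cong) auto
  finally show ?thesis .
qed

definition comb :: "nat \<Rightarrow> (nat \<Rightarrow> 'i \<Rightarrow> bit) \<Rightarrow> (nat \<Rightarrow> bit) \<Rightarrow> 'i \<Rightarrow> bit" where
  "comb r U z = (\<lambda>i. \<Sum>a<r. z a * U a i)"

lemma comb_Vec: "(\<And>a. a < r \<Longrightarrow> U a \<in> Vec I) \<Longrightarrow> comb r U z \<in> Vec I"
  unfolding Vec_def comb_def by auto

lemma dot_comb: "dot I y (comb r U z) = (\<Sum>a<r. z a * dot I y (U a))"
  unfolding dot_def comb_def sum_distrib_left by (subst sum.swap) (simp add: mult_ac)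

text \<open>Restricting a form to combinations of given vectors yields a form in the coefficients.
  The polar form supplies only the off-diagonal entries; the diagonal ones are values of the form
  itself, hence the index set \<open>utri r\<close> rather than \<open>sutri r\<close>.\<close>

lemma qf_comb:
  "qf I b (comb r U z) = qf (utri r) (\<lambda>(a, c). if a = c then qf I b (U a) else polar I b (U a) (U c)) z"
proof -
  define C where "C a c = (\<Sum>(i, j)\<in>I. b (i, j) * (U a i * U c j))" for a c
  have "qf I b (comb r U z) = (\<Sum>(i, j)\<in>I. \<Sum>a<r. \<Sum>c<r. z a * z c * (b (i, j) * (U a i * U c j)))"
    unfolding qf_def dot_def outer_sq_def comb_def
  proof (intro sum.cong refl)
    fix p assume "p \<in> I"
    obtain i j where p: "p = (i, j)" by (cases p)
    have "b p * ((\<Sum>a<r. z a * U a i) * (\<Sum>a<r. z a * U a j)) = 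
        (\<Sum>a<r. \<Sum>c<r. b p * (z a * U a i * (z c * U c j)))"
      unfolding sum_product unfolding sum_distrib_left ..
    also have "\<dots> = (\<Sum>a<r. \<Sum>c<r. z a * z c * (b p * (U a i * U c j)))"
      by (intro sum.cong refl) (simp only: mult_ac)
    finally show "b p * (case p of (i, j) \<Rightarrow> (\<Sum>a<r. z a * U a i) * (\<Sum>a<r. z a * U a j)) = 
        (case p of (i, j) \<Rightarrow> \<Sum>a<r. \<Sum>c<r. z a * z c * (b (i, j) * (U a i * U c j)))"
      by (simp only: p prod.case)
  qed
  also have "\<dots> = (\<Sum>a<r. \<Sum>(i, j)\<in>I. \<Sum>c<r. z a * z c * (b (i, j) * (U a i * U c j)))"
    unfolding case_prod_beta by (rule sum.swap)
  also have "\<dots> = (\<Sum>a<r. \<Sum>c<r. \<Sum>(i, j)\<in>I. z a * z c * (b (i, j) * (U a i * U c j)))"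
    unfolding case_prod_beta by (intro sum.cong refl sum.swap)
  also have "\<dots> = (\<Sum>a<r. \<Sum>c<r. z a * z c * C a c)"
    by (simp add: C_def sum_distrib_left case_prod_beta)
  also have "\<dots> = (\<Sum>(a, c)\<in>utri r. if a = c then z a * z c * C a c else z a * z c * C a c + z c * z a * C c a)"
    by (rule sum_square_split)
  also have "\<dots> = (\<Sum>(a, c)\<in>utri r. (if a = c then qf I b (U a) else polar I b (U a) (U c)) * (z a * z c))"
  proof (intro sum.cong refl)
    fix p assume "p \<in> utri r"
    have "qf I b (U a) = C a a" for a
      by (simp add: qf_def dot_def outer_sq_def C_def case_prod_beta)
    moreover have "polar I b (U a) (U c) = C a c + C c a" for a c
      by (simp add: polar_def dot_def C_def case_prod_beta sum.distrib algebra_simps)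
    ultimately show "(case p of (a, c) \<Rightarrow> if a = c then z a * z c * C a c else z a * z c * C a c + z c * z a * C c a)
       = (case p of (a, c) \<Rightarrow> (if a = c then qf I b (U a) else polar I b (U a) (U c)) * (z a * z c))"
      by (cases p) (simp add: algebra_simps)
  qed
  also have "\<dots> = qf (utri r) (\<lambda>(a, c). if a = c then qf I b (U a) else polar I b (U a) (U c)) z"
    by (simp add: qf_def dot_def outer_sq_def case_prod_beta)
  finally show ?thesis .
qed

text \<open>When \<open>ys\<close> is a basis of \<open>polar_space n b\<close>, these are
  coordinates on the quotient by the radical.\<close>

definition coords :: "nat \<Rightarrow> (nat \<Rightarrow> bit) list \<Rightarrow> (nat \<Rightarrow> bit) \<Rightarrow> nat \<Rightarrow> bit" where
  "coords n ys u = (\<lambda>a. if a < length ys then dot (verts n) (ys ! a) u else 0)"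

lemma coords_Vec [simp]: "coords n ys u \<in> Vec {..<length ys}"
  by (auto simp: coords_def Vec_def)

lemma coords_add: "coords n ys (u + v) = coords n ys u + coords n ys v"
  by (auto simp: coords_def fun_eq_iff dot_add_right)

lemma coords_unit_vec: "i \<in> verts n \<Longrightarrow> a < length ys \<Longrightarrow> coords n ys (unit_vec i) a = (ys ! a) i"
  by (simp add: coords_def dot_unit_vec)

lemma coords_eq_0_iff: "coords n ys u = 0 \<longleftrightarrow> (\<forall>y\<in>set ys. dot (verts n) u y = 0)"
proof -
  have "coords n ys u = 0 \<longleftrightarrow> (\<forall>a<length ys. dot (verts n) (ys ! a) u = 0)"
    by (auto simp: coords_def fun_eq_iff)
  thus ?thesis by (auto simp: all_set_conv_all_nth dot_commute)
qed

definition coord_lists :: "nat \<Rightarrow> nat \<Rightarrow> (nat \<Rightarrow> bit) list set" where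
  "coord_lists n r = {ys. set ys \<subseteq> Vec (verts n) \<and> length ys = r}"

lemma finite_coord_lists [simp]: "finite (coord_lists n r)"
  by (simp add: coord_lists_def finite_lists_length_eq)

lemma card_coord_lists: "card (coord_lists n r) = 2 ^ (n * r)"
  by (simp add: coord_lists_def card_lists_length_eq card_Vec power_mult)

lemma indep_lists_polar_space:
  "ys \<in> indep_lists (polar_space n b) r \<Longrightarrow> ys \<in> coord_lists n r"
  using polar_space_subset by (auto simp: indep_lists_def coord_lists_def)

lemma coords_kernel:
  assumes "b \<in> visible n r" "ys \<in> indep_lists (polar_space n b) r"
  shows "{u \<in> Vec (verts n). coords n ys u = 0} = polar_radical n b"
proof -
  have "lspan ys = polar_space n b"
    using assms by (intro indep_lists_lspan[where k = r]) (auto simp: visible_def)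
  thus ?thesis by (simp add: polar_radical_eq_ann coords_eq_0_iff flip: ann_lspan)
qed

text \<open>Pure counting: the kernel is the radical, of size \<open>2 ^ n / 2 ^ r\<close>, so the
  image already has all \<open>2 ^ r\<close> elements.\<close>

lemma coords_surj:
  assumes "b \<in> visible n r" "ys \<in> indep_lists (polar_space n b) r"
  shows "coords n ys ` Vec (verts n) = Vec {..<r}"
proof -
  have len: "length ys = r" using assms by (simp add: indep_lists_def)
  have "card (Vec (verts n)) = card (coords n ys ` Vec (verts n)) * card (polar_radical n b)"
    unfolding coords_kernel[OF assms, symmetric] by (rule card_hom) (simp_all add: coords_add)
  hence "card (coords n ys ` Vec (verts n)) * card (polar_radical n b) = 2 ^ r * card (polar_radical n b)"
    by (simp only: card_radical_visible[OF assms(1)] card_Vec finite_verts card_verts)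
  moreover have "card (polar_radical n b) \<noteq> 0"
    using card_radical_visible[OF assms(1)] by (intro notI) simp
  ultimately have "card (coords n ys ` Vec (verts n)) = 2 ^ r" by (simp only: mult_cancel2) simp
  hence "card (coords n ys ` Vec (verts n)) = card (Vec {..<r})" by (simp add: card_Vec)
  moreover have "coords n ys ` Vec (verts n) \<subseteq> Vec {..<r}"
    unfolding len[symmetric] by (intro image_subsetI coords_Vec)
  ultimately show ?thesis by (intro card_subset_eq) auto
qed

text \<open>Lift each coordinate vector to some \<open>U a\<close>. The combination of lifts with
  the coordinates of \<open>u\<close> differs from \<open>u\<close> by a radical vector, and a
  visible form does not change under such a shift.\<close>

lemma qf_factor:
  assumes "b \<in> visible n r" "ys \<in> indep_lists (polar_space n b) r"
  obtains g where "g \<in> Vec (utri r)" 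
    "\<And>u. u \<in> Vec (verts n) \<Longrightarrow> qf (edges n) b u = qf (utri r) g (coords n ys u)"
proof -
  have len: "length ys = r" using assms by (simp add: indep_lists_def)
  have "\<forall>a. \<exists>u. a < r \<longrightarrow> u \<in> Vec (verts n) \<and> coords n ys u = unit_vec a"
  proof
    fix a show "\<exists>u. a < r \<longrightarrow> u \<in> Vec (verts n) \<and> coords n ys u = unit_vec a"
    proof (cases "a < r")
      case True
      hence "unit_vec a \<in> Vec {..<r}" by (intro unit_vec_Vec) auto
      hence "unit_vec a \<in> coords n ys ` Vec (verts n)" by (simp only: coords_surj[OF assms])
      then obtain u where "u \<in> Vec (verts n)" "unit_vec a = coords n ys u" by (rule imageE)
      thus ?thesis by metis
    qed auto
  qed
  then obtain U where U: "\<And>a. a < r \<Longrightarrow> U a \<in> Vec (verts n)" "\<And>a. a < r \<Longrightarrow> coords n ys (U a) = unit_vec a"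
    by metis
  define g0 where "g0 = (\<lambda>(a, c). if a = c then qf (edges n) b (U a) else polar (edges n) b (U a) (U c))"
  define g where "g p = (if p \<in> utri r then g0 p else 0)" for p
  have "qf (edges n) b u = qf (utri r) g (coords n ys u)" if u: "u \<in> Vec (verts n)" for u
  proof -
    define z where "z = coords n ys u"
    define u' where "u' = comb r U z"
    have z: "z \<in> Vec {..<r}" unfolding z_def len[symmetric] by simp
    have u': "u' \<in> Vec (verts n)" unfolding u'_def by (intro comb_Vec U)
    have "coords n ys u' = z"
    proof
      fix c
      show "coords n ys u' c = z c"
      proof (cases "c < r")
        case True
        have "coords n ys u' c = (\<Sum>a<r. z a * coords n ys (U a) c)"
          using True by (simp add: coords_def u'_def dot_comb len)
        also have "\<dots> = (\<Sum>a<r. if a = c then z a else 0)"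
          by (intro sum.cong) (auto simp: U unit_vec_def)
        also have "\<dots> = z c" using True by simp
        finally show ?thesis .
      next
        case False
        thus ?thesis using z by (simp add: coords_def len Vec_def)
      qed
    qed
    \<comment> \<open>Here \<open>u' + u\<close> is the difference of the two vectors, since the
      characteristic is 2.\<close>
    hence "coords n ys (u' + u) = 0" unfolding coords_add z_def by simp
    hence rad: "u' + u \<in> polar_radical n b"
      unfolding coords_kernel[OF assms, symmetric] using u u' by simp
    hence "qf (edges n) b (u' + u) = 0" using assms(1) by (auto simp: visible_def)
    moreover have "polar (edges n) b u' (u' + u) = 0"
      using rad u' by (subst polar_commute) (auto simp: polar_radical_def)
    moreover have "u = u' + (u' + u)" by simp
    ultimately have "qf (edges n) b u = qf (edges n) b u'"
      by (metis qf_add add_0_right)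
    also have "\<dots> = qf (utri r) g0 z" unfolding u'_def g0_def by (rule qf_comb)
    also have "\<dots> = qf (utri r) g z" unfolding qf_def dot_def g_def by (intro sum.cong) auto
    finally show ?thesis unfolding z_def .
  qed
  moreover have "g \<in> Vec (utri r)" by (auto simp: g_def Vec_def)
  ultimately show ?thesis using that by blast
qed

lemma edge_unit_vecs:
  assumes "(i, j) \<in> edges n"
  shows "i \<in> verts n" "j \<in> verts n" "unit_vec i \<in> Vec (verts n)" "unit_vec j \<in> Vec (verts n)"
  using assms by (auto simp: edges_def verts_def intro!: unit_vec_Vec)

text \<open>Makes the encodings injective: the reduced form and the coordinates of the unit vectors
  recover every coefficient of \<open>b\<close>.\<close>

lemma visible_entry:
  assumes "(i, j) \<in> edges n"
    "\<And>u. u \<in> Vec (verts n) \<Longrightarrow> qf (edges n) b u = qf (utri r) g (coords n ys u)"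
  shows "b (i, j) = polar (utri r) g (coords n ys (unit_vec i)) (coords n ys (unit_vec j))"
proof -
  have "b (i, j) = polar (edges n) b (unit_vec i) (unit_vec j)"
    using polar_unit_vec[OF assms(1)] by simp
  also have "\<dots> = polar (utri r) g (coords n ys (unit_vec i)) (coords n ys (unit_vec j))"
    unfolding polar_eq_qf using edge_unit_vecs[OF assms(1)]
    by (simp add: assms(2) coords_add)
  finally show ?thesis .
qed

lemma visible_eqI:
  assumes "b \<in> visible n r" "b' \<in> visible n r'" "\<And>i j. (i, j) \<in> edges n \<Longrightarrow> b (i, j) = b' (i, j)"
  shows "b = b'"
proof
  fix p :: "nat \<times> nat"
  show "b p = b' p"
    using assms by (cases p; cases "p \<in> edges n") (auto simp: visible_def Vec_def)
qed

text \<open>Each form is counted with an ordered basis of its row space; the second factor is the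
  order of the general linear group of degree \<open>r\<close>.\<close>

lemma card_visible_flags:
  "card (SIGMA b:visible n r. indep_lists (polar_space n b) r) = card (visible n r) * (\<Prod>i<r. 2 ^ r - 2 ^ i)"
proof -
  have "card (SIGMA b:visible n r. indep_lists (polar_space n b) r) = (\<Sum>b\<in>visible n r. card (indep_lists (polar_space n b) r))"
    by (intro card_SigmaI) auto
  also have "\<dots> = (\<Sum>b\<in>visible n r. \<Prod>i<r. 2 ^ r - 2 ^ i)"
    by (intro sum.cong refl) (auto simp: card_indep_lists visible_def)
  finally show ?thesis by simp
qed

text \<open>Diagonal terms are doubled, hence zero. The count through polar forms thus needs only
  \<open>r choose 2\<close> bits for the reduced form.\<close>

lemma polar_utri: "polar (utri r) g x y = polar (sutri r) g x y"
  unfolding polar_def dot_def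
proof (rule sum.mono_neutral_right)
  have "x a * y a + x a * y a = 0" for a by simp
  thus "\<forall>p\<in>utri r - sutri r. g p * (case p of (i, j) \<Rightarrow> x i * y j + x j * y i) = 0"
    by (auto dest: le_neq_implies_less simp del: bit_add_self)
qed auto

text \<open>A form together with a basis \<open>ys\<close> of its row space is determined by \<open>ys\<close> and the alternating matrix of its polar
  form in the coordinates given by \<open>ys\<close>.\<close>

lemma card_visible_le_polar:
  "card (visible n r) * (\<Prod>i<r. 2 ^ r - 2 ^ i) \<le> 2 ^ (r choose 2) * 2 ^ (n * r)"
proof -
  let ?P = "SIGMA b:visible n r. indep_lists (polar_space n b) r"
  let ?R = "\<lambda>p q. snd q = snd p \<and> (\<forall>i j. (i, j) \<in> edges n \<longrightarrow> fst p (i, j) = 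
      polar (sutri r) (fst q) (coords n (snd p) (unit_vec i)) (coords n (snd p) (unit_vec j)))"
  have "\<forall>p\<in>?P. \<exists>q. q \<in> Vec (sutri r) \<times> coord_lists n r \<and> ?R p q"
  proof
    fix p assume "p \<in> ?P"
    then obtain b ys where p: "p = (b, ys)" "b \<in> visible n r" "ys \<in> indep_lists (polar_space n b) r" by blast
    obtain g where g: "g \<in> Vec (utri r)" 
      "\<And>u. u \<in> Vec (verts n) \<Longrightarrow> qf (edges n) b u = qf (utri r) g (coords n ys u)"
      using qf_factor[OF p(2,3)] by blast
    define g' where "g' q = (if q \<in> sutri r then g q else 0)" for q
    have eq: "polar (utri r) g x y = polar (sutri r) g' x y" for x y
      unfolding polar_utri unfolding polar_def dot_def g'_def by (intro sum.cong) auto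
    have "g' \<in> Vec (sutri r)" by (auto simp: g'_def Vec_def)
    thus "\<exists>q. q \<in> Vec (sutri r) \<times> coord_lists n r \<and> ?R p q"
      using visible_entry[OF _ g(2)] indep_lists_polar_space[OF p(3)] p(1)
      by (intro exI[of _ "(g', ys)"]) (auto simp: eq)
  qed
  from bchoice[OF this] obtain f where f0: "\<forall>p\<in>?P. f p \<in> Vec (sutri r) \<times> coord_lists n r \<and> ?R p (f p)" ..
  have f: "\<And>p. p \<in> ?P \<Longrightarrow> f p \<in> Vec (sutri r) \<times> coord_lists n r" "\<And>p. p \<in> ?P \<Longrightarrow> ?R p (f p)"
    using f0 by blast+
  have "inj_on f ?P"
  proof (rule inj_onI)
    fix p p' assume *: "p \<in> ?P" "p' \<in> ?P" "f p = f p'"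
    have 1: "snd p = snd p'" using f(2)[OF *(1)] f(2)[OF *(2)] *(3) by simp
    have "fst p = fst p'"
    proof (rule visible_eqI[of _ n r _ r])
      show "fst p (i, j) = fst p' (i, j)" if "(i, j) \<in> edges n" for i j
        using f(2)[OF *(1)] f(2)[OF *(2)] *(3) 1 that by simp
    qed (use * in auto)
    thus "p = p'" using 1 by (rule prod_eqI)
  qed
  hence "card ?P \<le> card (Vec (sutri r) \<times> coord_lists n r)"
    using f(1) by (intro card_inj_on_le[of f] image_subsetI finite_cartesian_product) auto
  also have "\<dots> = 2 ^ (r choose 2) * 2 ^ (n * r)"
    by (simp add: card_cartesian_product card_Vec card_strict_upper card_coord_lists)
  finally show ?thesis unfolding card_visible_flags .
qed

section \<open>Zeros of the reduced form and the constrained count\<close>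

definition zeros :: "nat \<Rightarrow> (nat \<times> nat \<Rightarrow> bit) \<Rightarrow> (nat \<Rightarrow> bit) set" where
  "zeros r g = {z \<in> Vec {..<r}. qf (utri r) g z = 0}"

lemma finite_zeros [simp]: "finite (zeros r g)"
  by (simp add: zeros_def)

lemma card_zeros:
  "2 * real (card (zeros r g)) = 2 ^ r + (\<Sum>z\<in>Vec {..<r}. sgn2 (qf (utri r) g z))"
proof -
  have "(\<Sum>z\<in>Vec {..<r}. sgn2 (qf (utri r) g z)) = 
        (\<Sum>z\<in>Vec {..<r}. 2 * (if qf (utri r) g z = 0 then 1 else 0) - 1)"
    by (intro sum.cong) (auto simp: sgn2_def)
  also have "\<dots> = 2 * (\<Sum>z\<in>Vec {..<r}. if qf (utri r) g z = 0 then 1 else 0) - 2 ^ r"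
    by (simp add: sum_subtractf card_Vec sum_distrib_left)
  also have "(\<Sum>z\<in>Vec {..<r}. if qf (utri r) g z = 0 then 1 else 0) = real (card (zeros r g))"
    unfolding zeros_def by (subst sum.inter_filter[symmetric]) auto
  finally show ?thesis by simp
qed

text \<open>All fibres of \<open>coords n ys\<close> are cosets of the radical, so the Gauss sum is
  that of the reduced form times their common size.\<close>

lemma gauss_sum_factor:
  assumes b: "b \<in> visible n r" and ys: "ys \<in> indep_lists (polar_space n b) r"
    and g: "\<And>u. u \<in> Vec (verts n) \<Longrightarrow> qf (edges n) b u = qf (utri r) g (coords n ys u)"
  shows "gauss_sum n b = real (card (polar_radical n b)) * (\<Sum>z\<in>Vec {..<r}. sgn2 (qf (utri r) g z))"
proof -
  let ?V = "Vec (verts n)"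
  have "gauss_sum n b = (\<Sum>u\<in>?V. sgn2 (qf (utri r) g (coords n ys u)))"
    unfolding gauss_sum_def by (intro sum.cong) (simp_all add: g)
  also have "\<dots> = (\<Sum>z\<in>coords n ys ` ?V. \<Sum>u\<in>{u\<in>?V. coords n ys u = z}. sgn2 (qf (utri r) g (coords n ys u)))"
    by (rule sum.image_gen) simp
  also have "\<dots> = (\<Sum>z\<in>coords n ys ` ?V. real (card (polar_radical n b)) * sgn2 (qf (utri r) g z))"
  proof (intro sum.cong refl)
    fix z assume z: "z \<in> coords n ys ` ?V"
    have "card {u\<in>?V. coords n ys u = z} = card (polar_radical n b)"
      unfolding coords_kernel[OF b ys, symmetric]
      by (rule card_fibre) (use z in \<open>simp_all add: coords_add\<close>)
    thus "(\<Sum>u\<in>{u\<in>?V. coords n ys u = z}. sgn2 (qf (utri r) g (coords n ys u))) = 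
        real (card (polar_radical n b)) * sgn2 (qf (utri r) g z)" by simp
  qed
  finally show ?thesis by (simp add: coords_surj[OF b ys] sum_distrib_left)
qed

text \<open>Dividing out the radical, the reduced Gauss sum has absolute value \<open>2 ^ h\<close>.
  Its sign (the Arf invariant) is left open, so the larger of the two possible zero counts is
  taken.\<close>

lemma card_zeros_visible:
  assumes b: "b \<in> visible n (2 * h)" and ys: "ys \<in> indep_lists (polar_space n b) (2 * h)"
    and g: "\<And>u. u \<in> Vec (verts n) \<Longrightarrow> qf (edges n) b u = qf (utri (2 * h)) g (coords n ys u)"
  shows "2 * card (zeros (2 * h) g) \<le> 4 ^ h + 2 ^ h"
proof -
  let ?c = "real (card (polar_radical n b))"
  let ?S = "\<Sum>z\<in>Vec {..<2 * h}. sgn2 (qf (utri (2 * h)) g z)"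
  have c: "2 ^ (2 * h) * ?c = 2 ^ n"
    using card_radical_visible[OF b] by (metis of_nat_mult of_nat_numeral of_nat_power)
  have gs: "gauss_sum n b = ?c * ?S" by (rule gauss_sum_factor[OF b ys]) (rule g)
  have "(?c * ?S)\<^sup>2 * 2 ^ (2 * h) = (2 ^ (2 * h) * ?c)\<^sup>2"
    using gauss_sum_visible[OF b] by (simp only: gs c)
  moreover have "?c \<noteq> 0" using c by (intro notI) simp
  ultimately have "?S\<^sup>2 = 2 ^ (2 * h)"
    by (simp add: power_mult_distrib power2_eq_square)
  also have "\<dots> = (2 ^ h)\<^sup>2" by (simp add: power_mult[symmetric] mult.commute)
  finally have "\<bar>?S\<bar> = \<bar>2 ^ h\<bar>" by (simp only: power2_eq_iff abs_eq_iff)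
  hence "\<bar>?S\<bar> = 2 ^ h" by (simp only: power_abs abs_numeral)
  hence "?S \<le> 2 ^ h" by (intro abs_le_D1[OF eq_refl])
  hence "2 * real (card (zeros (2 * h) g)) \<le> 2 ^ (2 * h) + 2 ^ h" using card_zeros[of "2 * h" g] by linarith
  hence "real (2 * card (zeros (2 * h) g)) \<le> real (4 ^ h + 2 ^ h)" by (simp add: power_mult)
  thus ?thesis by (simp only: of_nat_le_iff)
qed

text \<open>Here the basis is recorded through the coordinates of the unit vectors, all of which are zeros of
  the factored form.\<close>

lemma card_visible_le_zeros:
  "2 ^ n * (card (visible n (2 * h)) * (\<Prod>i<2 * h. 2 ^ (2 * h) - 2 ^ i)) 
     \<le> 2 ^ ((2 * h choose 2) + 2 * h) * (4 ^ h + 2 ^ h) ^ n"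
proof -
  define r where "r = 2 * h"
  let ?P = "SIGMA b:visible n r. indep_lists (polar_space n b) r"
  \<comment> \<open>Reduced forms keep their diagonal here, since whether a vector is a zero depends
    on it. This costs \<open>2 * h\<close> more bits than the polar count, but each vertex then
    ranges over zeros only.\<close>
  define G where "G = {g \<in> Vec (utri r). 2 * card (zeros r g) \<le> 4 ^ h + 2 ^ h}"
  define Q where "Q = (SIGMA g:G. PiE (verts n) (\<lambda>_. zeros r g))"
  let ?R = "\<lambda>p q. (\<forall>i\<in>verts n. snd q i = coords n (snd p) (unit_vec i)) \<and> 
      (\<forall>i j. (i, j) \<in> edges n \<longrightarrow> fst p (i, j) = polar (utri r) (fst q) (snd q i) (snd q j))"
  have finG: "finite G" by (simp add: G_def)
  have "\<forall>p\<in>?P. \<exists>q. q \<in> Q \<and> ?R p q"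
  proof
    fix p assume "p \<in> ?P"
    then obtain b ys where p: "p = (b, ys)" "b \<in> visible n r" "ys \<in> indep_lists (polar_space n b) r" by blast
    obtain g where g: "g \<in> Vec (utri r)" 
      "\<And>u. u \<in> Vec (verts n) \<Longrightarrow> qf (edges n) b u = qf (utri r) g (coords n ys u)"
      using qf_factor[OF p(2,3)] by blast
    have gG: "g \<in> G" using g card_zeros_visible[of b n h ys g] p by (simp add: G_def r_def)
    define s where "s = restrict (\<lambda>i. coords n ys (unit_vec i)) (verts n)"
    have len: "length ys = r" using p by (simp add: indep_lists_def)
    have "s \<in> PiE (verts n) (\<lambda>_. zeros r g)"
    proof (rule PiE_I)
      fix i assume i: "i \<in> verts n"
      have "qf (utri r) g (coords n ys (unit_vec i)) = 0"
        using g(2)[OF unit_vec_Vec[OF i]] by (simp add: qf_unit_vec)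
      thus "s i \<in> zeros r g" using i by (simp add: s_def zeros_def flip: len)
    qed (simp add: s_def)
    moreover have "?R p (g, s)"
    proof (intro conjI allI impI)
      fix i j assume "(i, j) \<in> edges n"
      thus "fst p (i, j) = polar (utri r) (fst (g, s)) (snd (g, s) i) (snd (g, s) j)"
        using visible_entry[OF _ g(2), of i j] edge_unit_vecs[of i j n] by (simp add: s_def p)
    qed (simp add: s_def p)
    ultimately show "\<exists>q. q \<in> Q \<and> ?R p q" using gG unfolding Q_def by blast
  qed
  from bchoice[OF this] obtain f where f0: "\<forall>p\<in>?P. f p \<in> Q \<and> ?R p (f p)" ..
  have f: "\<And>p. p \<in> ?P \<Longrightarrow> f p \<in> Q" "\<And>p. p \<in> ?P \<Longrightarrow> ?R p (f p)"
    using f0 by blast+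
  have inj: "inj_on f ?P"
  proof (rule inj_onI)
    fix p p' assume *: "p \<in> ?P" "p' \<in> ?P" "f p = f p'"
    have "fst p = fst p'"
    proof (rule visible_eqI[of _ n r _ r])
      show "fst p (i, j) = fst p' (i, j)" if "(i, j) \<in> edges n" for i j
        using f(2)[OF *(1)] f(2)[OF *(2)] *(3) that by simp
    qed (use * in auto)
    moreover have "snd p = snd p'"
    proof (rule nth_equalityI)
      have cl: "snd p \<in> coord_lists n r" "snd p' \<in> coord_lists n r" 
        using * indep_lists_polar_space by auto
      thus len: "length (snd p) = length (snd p')" by (simp add: coord_lists_def)
      fix a assume a: "a < length (snd p)"
      show "snd p ! a = snd p' ! a"
      proof
        fix i
        show "(snd p ! a) i = (snd p' ! a) i"
        proof (cases "i \<in> verts n")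
          case True
          \<comment> \<open>The entry at \<open>i\<close> of the \<open>a\<close>-th basis vector is
            the \<open>a\<close>-th coordinate of \<open>unit_vec i\<close>, so the table of
            coordinates is the basis read by columns.\<close>
          have "coords n (snd p) (unit_vec i) = coords n (snd p') (unit_vec i)"
            using f(2)[OF *(1)] f(2)[OF *(2)] *(3) True by metis
          thus ?thesis using coords_unit_vec[OF True] a len by metis
        next
          case False
          have "snd p ! a \<in> Vec (verts n)" "snd p' ! a \<in> Vec (verts n)"
            using cl a len by (auto simp: coord_lists_def)
          thus ?thesis using False by (simp add: Vec_def)
        qed
      qed
    qed
    ultimately show "p = p'" by (rule prod_eqI)
  qed
  have "finite Q" unfolding Q_def by (intro finite_SigmaI finG finite_PiE) auto
  hence "card ?P \<le> card Q" using f(1) inj by (intro card_inj_on_le[of f]) auto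
  also have "card Q = (\<Sum>g\<in>G. card (zeros r g) ^ n)"
    unfolding Q_def using finG by (subst card_SigmaI) (auto simp: card_PiE finite_PiE)
  \<comment> \<open>The factor \<open>2 ^ n\<close> is moved inside the \<open>n\<close>-th power to
    pair with the doubled zero count, which keeps the inequality in the naturals.\<close>
  finally have "2 ^ n * card ?P \<le> (\<Sum>g\<in>G. (2 * card (zeros r g)) ^ n)"
    by (simp add: power_mult_distrib sum_distrib_left[symmetric])
  also have "\<dots> \<le> (\<Sum>g\<in>G. (4 ^ h + 2 ^ h) ^ n)"
    by (intro sum_mono power_mono) (auto simp: G_def)
  also have "\<dots> = card G * (4 ^ h + 2 ^ h) ^ n" by simp
  also have "card G \<le> card (Vec (utri r))" by (intro card_mono) (auto simp: G_def)
  hence "card G * (4 ^ h + 2 ^ h) ^ n \<le> 2 ^ ((r choose 2) + r) * (4 ^ h + 2 ^ h) ^ n"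
    by (simp add: card_Vec card_upper)
  finally show ?thesis unfolding card_visible_flags r_def .
qed

section \<open>The Fourier bound\<close>

lemma real_prod_pow2_diff:
  "real (\<Prod>i<r. 2 ^ r - 2 ^ i) = 2 ^ (r * r) * (\<Prod>i<r. 1 - 1 / 2 ^ Suc i)"
proof -
  have "real (\<Prod>i<r. 2 ^ r - 2 ^ i) = (\<Prod>i<r. 2 ^ r - 2 ^ i)"
    unfolding of_nat_prod by (intro prod.cong refl) (simp add: of_nat_diff)
  also have "\<dots> = (\<Prod>i<r. 2 ^ r - 2 ^ (r - Suc i))"
    by (rule prod.nat_diff_reindex[symmetric])
  also have "\<dots> = (\<Prod>i<r. 2 ^ r * (1 - 1 / 2 ^ Suc i))"
    by (intro prod.cong refl) (simp add: power_diff field_simps del: power_Suc)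
  also have "\<dots> = 2 ^ (r * r) * (\<Prod>i<r. 1 - 1 / 2 ^ Suc i)"
    by (simp add: prod.distrib power_mult del: power_Suc)
  finally show ?thesis .
qed

lemma prod_ge_quarter: "(\<Prod>i<r. 1 - 1 / 2 ^ Suc i) \<ge> (1 / 4 :: real)"
proof -
  \<comment> \<open>The bound 1/4 alone is not inductive; the extra term
    \<open>1 / 2 ^ (r + 2)\<close> is, because it may halve at each step.\<close>
  have ge: "(\<Prod>i<Suc r. 1 - 1 / 2 ^ Suc i) \<ge> (1 / 4 + 1 / 2 ^ (r + 2) :: real)" for r
  proof (induction r)
    case (Suc r)
    define e :: real where "e = 1 / 2 ^ (r + 2)"
    have e: "0 \<le> e" "e \<le> 1 / 4" by (simp_all add: e_def field_simps)
    have "e * e \<le> e * (1 / 4)" using e by (intro mult_left_mono)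
    moreover have "(1 / 4 + e) * (1 - e) = 1 / 4 + 3 / 4 * e - e * e" by (simp add: field_simps)
    ultimately have le: "1 / 4 + e / 2 \<le> (1 / 4 + e) * (1 - e)" by linarith
    have "1 / 4 + 1 / 2 ^ (Suc r + 2) = 1 / 4 + e / 2" by (simp add: e_def)
    also have "\<dots> \<le> (1 / 4 + e) * (1 - e)" by (rule le)
    also have "\<dots> \<le> (\<Prod>i<Suc r. 1 - 1 / 2 ^ Suc i) * (1 - e)"
    proof (rule mult_right_mono)
      show "1 / 4 + e \<le> (\<Prod>i<Suc r. 1 - 1 / 2 ^ Suc i)" using Suc unfolding e_def .
      show "0 \<le> 1 - e" using e by linarith
    qed
    also have "\<dots> = (\<Prod>i<Suc (Suc r). 1 - 1 / 2 ^ Suc i)" by (simp add: e_def)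
    finally show ?case .
  qed simp
  show ?thesis
  proof (cases r)
    case (Suc k)
    have "(0::real) \<le> 1 / 2 ^ (k + 2)" by simp
    thus ?thesis using ge[of k] unfolding Suc by linarith
  qed simp
qed

section \<open>Tournaments as binary vectors, and characters as eigenfunctions of the walk\<close>

definition tcode :: "nat \<Rightarrow> (nat \<times> nat) set \<Rightarrow> nat \<times> nat \<Rightarrow> bit" where
  "tcode n T = (\<lambda>p. of_bool (p \<in> edges n \<and> p \<in> T))"

definition ind :: "nat set \<Rightarrow> nat \<Rightarrow> bit" where
  "ind X = (\<lambda>i. of_bool (i \<in> X))"

lemma tcode_Vec [simp]: "tcode n T \<in> Vec (edges n)"
  by (simp add: tcode_def Vec_def)

lemma bij_betw_tcode: "bij_betw (tcode n) (tournaments n) (Vec (edges n))"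
proof (rule bij_betw_byWitness[where f' = "\<lambda>g. {(i, j). i \<in> {1..n} \<and> j \<in> {1..n} \<and> 
      (i < j \<and> g (i, j) = 1 \<or> j < i \<and> g (j, i) = 0)}"], goal_cases)
  case 1
  show ?case
  proof
    fix T assume T: "T \<in> tournaments n"
    have sub: "T \<subseteq> {1..n} \<times> {1..n}" and irr: "\<And>i. i \<in> {1..n} \<Longrightarrow> (i, i) \<notin> T"
      and tot: "\<And>i j. i \<in> {1..n} \<Longrightarrow> j \<in> {1..n} \<Longrightarrow> i \<noteq> j \<Longrightarrow> ((i, j) \<in> T) = ((j, i) \<notin> T)"
      using T unfolding tournaments_def by blast+
    have "(i, j) \<in> T \<longleftrightarrow> i \<in> {1..n} \<and> j \<in> {1..n} \<and> 
      (i < j \<and> tcode n T (i, j) = 1 \<or> j < i \<and> tcode n T (j, i) = 0)" for i j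
    proof (cases "i \<in> {1..n} \<and> j \<in> {1..n}")
      case True
      show ?thesis
      proof (cases i j rule: linorder_cases)
        case less
        thus ?thesis using True by (simp add: tcode_def edges_def)
      next
        case equal
        thus ?thesis using True irr by auto
      next
        case greater
        thus ?thesis using True tot[of i j] by (simp add: tcode_def edges_def)
      qed
    qed (use sub in blast)
    thus "{(i, j). i \<in> {1..n} \<and> j \<in> {1..n} \<and> 
      (i < j \<and> tcode n T (i, j) = 1 \<or> j < i \<and> tcode n T (j, i) = 0)} = T" by blast
  qed
next
  case 2
  show ?case
  proof
    fix g assume g: "g \<in> Vec (edges n)"
    show "tcode n {(i, j). i \<in> {1..n} \<and> j \<in> {1..n} \<and> 
      (i < j \<and> g (i, j) = 1 \<or> j < i \<and> g (j, i) = 0)} = g"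
    proof
      fix p :: "nat \<times> nat"
      obtain i j where p: "p = (i, j)" by (cases p)
      show "tcode n {(i, j). i \<in> {1..n} \<and> j \<in> {1..n} \<and> 
          (i < j \<and> g (i, j) = 1 \<or> j < i \<and> g (j, i) = 0)} p = g p"
      proof (cases "p \<in> edges n")
        case True
        thus ?thesis by (cases "g p = 0") (auto simp: p tcode_def edges_def)
      next
        case False
        hence "g p = 0" using g unfolding Vec_def by blast
        thus ?thesis using False by (simp add: tcode_def)
      qed
    qed
  qed
next
  case 3
  thus ?case by auto
next
  case 4
  show ?case
  proof
    fix T assume "T \<in> (\<lambda>g. {(i, j). i \<in> {1..n} \<and> j \<in> {1..n} \<and> 
      (i < j \<and> g (i, j) = 1 \<or> j < i \<and> g (j, i) = 0)}) ` Vec (edges n)"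
    then obtain g :: "nat \<times> nat \<Rightarrow> bit" where T: "T = {(i, j). i \<in> {1..n} \<and> j \<in> {1..n} \<and> 
      (i < j \<and> g (i, j) = 1 \<or> j < i \<and> g (j, i) = 0)}" by blast
    have mem: "(i, j) \<in> T \<longleftrightarrow> i \<in> {1..n} \<and> j \<in> {1..n} \<and> 
      (i < j \<and> g (i, j) = 1 \<or> j < i \<and> g (j, i) = 0)" for i j by (simp add: T)
    have "(i, j) \<in> T \<longleftrightarrow> (j, i) \<notin> T" if "i \<in> {1..n}" "j \<in> {1..n}" "i \<noteq> j" for i j
      using that unfolding mem by (cases i j rule: linorder_cases) auto
    moreover have "T \<subseteq> {1..n} \<times> {1..n}" "\<forall>i\<in>{1..n}. (i, i) \<notin> T" unfolding T by auto
    ultimately show "T \<in> tournaments n" unfolding tournaments_def by blast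
  qed
qed

lemma card_tournaments: "card (tournaments n) = 2 ^ (n choose 2)"
  using bij_betw_same_card[OF bij_betw_tcode[of n]] by (simp add: card_Vec card_edges)

lemma bij_betw_ind: "bij_betw ind (Pow {1..n}) (Vec (verts n))"
proof -
  have "bij_betw (\<lambda>x. {i. x i = 1}) (Vec (verts n)) (Pow {1..n})"
    using bij_betw_Vec_Pow[of "verts n"] by (simp add: verts_def)
  moreover have "{i. ind X i = 1} = X" for X by (auto simp: ind_def)
  moreover have "ind X \<in> Vec (verts n)" if "X \<subseteq> {1..n}" for X
    using that by (auto simp: ind_def Vec_def verts_def)
  ultimately show ?thesis
    by (intro bij_betw_byWitness[where f' = "\<lambda>x. {i. x i = 1}"]) 
      (auto simp: bij_betw_def ind_def fun_eq_iff)
qed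

text \<open>An arc flips exactly when both endpoints lie in \<open>X\<close>. The identity is
  restricted to \<open>edges n\<close> because \<open>outer_sq\<close> also has diagonal and lower
  entries.\<close>

lemma tcode_invert:
  assumes "T \<in> tournaments n" "p \<in> edges n"
  shows "tcode n (invert X T) p = tcode n T p + outer_sq (ind X) p"
proof -
  obtain i j where p: "p = (i, j)" by (cases p)
  have "i \<in> {1..n}" "j \<in> {1..n}" "i \<noteq> j" using assms p by (auto simp: edges_def)
  hence "(i, j) \<in> T \<longleftrightarrow> (j, i) \<notin> T" using assms unfolding tournaments_def by blast
  thus ?thesis using assms(2) by (auto simp: p tcode_def invert_def outer_sq_def ind_def)
qed

definition chi :: "nat \<Rightarrow> (nat \<times> nat \<Rightarrow> bit) \<Rightarrow> (nat \<times> nat) set \<Rightarrow> real" where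
  "chi n b T = sgn2 (dot (edges n) b (tcode n T))"

lemma chi_invert:
  assumes "T \<in> tournaments n"
  shows "chi n b (invert X T) = chi n b T * sgn2 (qf (edges n) b (ind X))"
proof -
  have "dot (edges n) b (tcode n (invert X T)) = dot (edges n) b (tcode n T + outer_sq (ind X))"
    unfolding dot_def by (intro sum.cong) (simp_all add: tcode_invert[OF assms])
  thus ?thesis by (simp add: chi_def dot_add_right sgn2_add qf_def)
qed

lemma finite_set_inversion_kernel: "finite (set_pmf (inversion_kernel n T))"
  unfolding inversion_kernel_def set_map_pmf by (subst set_pmf_of_set) auto

lemma set_inversion_kernel:
  assumes "T \<in> tournaments n"
  shows "set_pmf (inversion_kernel n T) \<subseteq> tournaments n"
  unfolding inversion_kernel_def set_map_pmf using invert_in_tournaments[OF assms]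
  by (subst set_pmf_of_set) auto

lemma set_walk_law:
  assumes "T0 \<in> tournaments n"
  shows "set_pmf (walk_law n T0 t) \<subseteq> tournaments n"
  using assms set_inversion_kernel by (induction t) (auto simp: set_bind_pmf)

text \<open>Each character is an eigenfunction of the step, with the normalised Gauss sum as
  eigenvalue; iteration then raises the eigenvalue to the power \<open>t\<close>.\<close>

lemma expectation_kernel_chi:
  assumes "T \<in> tournaments n"
  shows "measure_pmf.expectation (inversion_kernel n T) (chi n b) = chi n b T * (gauss_sum n b / 2 ^ n)"
proof -
  have "measure_pmf.expectation (inversion_kernel n T) (chi n b) = 
      (\<Sum>X\<in>Pow {1..n}. chi n b (invert X T)) / 2 ^ n"
    unfolding inversion_kernel_def integral_map_pmf
    by (subst integral_pmf_of_set) (auto simp: card_Pow)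
  also have "(\<Sum>X\<in>Pow {1..n}. chi n b (invert X T)) = 
      (\<Sum>X\<in>Pow {1..n}. chi n b T * sgn2 (qf (edges n) b (ind X)))"
    by (simp add: chi_invert[OF assms])
  also have "\<dots> = chi n b T * gauss_sum n b"
    unfolding gauss_sum_def sum_distrib_left[symmetric]
    by (subst sum.reindex_bij_betw[OF bij_betw_ind]) simp
  finally show ?thesis by simp
qed

lemma expectation_walk_chi:
  assumes "T0 \<in> tournaments n"
  shows "measure_pmf.expectation (walk_law n T0 t) (chi n b) = chi n b T0 * (gauss_sum n b / 2 ^ n) ^ t"
proof (induction t)
  case (Suc t)
  let ?g = "gauss_sum n b / 2 ^ n"
  have "measure_pmf.expectation (walk_law n T0 (Suc t)) (chi n b) = 
     (\<Sum>T\<in>tournaments n. pmf (walk_law n T0 t) T *\<^sub>R measure_pmf.expectation (inversion_kernel n T) (chi n b))"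
    unfolding walk_law.simps
    by (rule pmf_expectation_bind) (simp_all add: finite_tournaments finite_set_inversion_kernel set_walk_law[OF assms])
  also have "\<dots> = (\<Sum>T\<in>tournaments n. chi n b T * pmf (walk_law n T0 t) T) * ?g"
    unfolding sum_distrib_right by (intro sum.cong) (simp_all add: expectation_kernel_chi)
  also have "(\<Sum>T\<in>tournaments n. chi n b T * pmf (walk_law n T0 t) T) = 
      measure_pmf.expectation (walk_law n T0 t) (chi n b)"
    using set_walk_law[OF assms] by (intro integral_measure_pmf_real[symmetric]) (auto simp: finite_tournaments)
  finally show ?case using Suc by simp
qed simp

section \<open>Plancherel and the \<open>L2\<close> bound on total variation\<close>

lemma plancherel:
  fixes f :: "('i \<Rightarrow> bit) \<Rightarrow> real"
  assumes "finite I"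
  shows "(\<Sum>b\<in>Vec I. (\<Sum>x\<in>Vec I. f x * sgn2 (dot I b x))\<^sup>2) = 2 ^ card I * (\<Sum>x\<in>Vec I. (f x)\<^sup>2)"
proof -
  let ?V = "Vec I"
  have "(\<Sum>b\<in>?V. (\<Sum>x\<in>?V. f x * sgn2 (dot I b x))\<^sup>2) = 
     (\<Sum>b\<in>?V. \<Sum>x\<in>?V. \<Sum>y\<in>?V. f x * f y * sgn2 (dot I b (x + y)))"
    unfolding power2_eq_square sum_product
    by (intro sum.cong refl) (simp add: dot_add_right sgn2_add mult_ac)
  also have "\<dots> = (\<Sum>x\<in>?V. \<Sum>b\<in>?V. \<Sum>y\<in>?V. f x * f y * sgn2 (dot I b (x + y)))"
    by (rule sum.swap)
  also have "\<dots> = (\<Sum>x\<in>?V. \<Sum>y\<in>?V. \<Sum>b\<in>?V. f x * f y * sgn2 (dot I b (x + y)))"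
    by (intro sum.cong refl sum.swap)
  also have "\<dots> = (\<Sum>x\<in>?V. \<Sum>y\<in>?V. if y = x then 2 ^ card I * (f x * f y) else 0)"
  proof (intro sum.cong refl)
    fix x y assume xy: "x \<in> ?V" "y \<in> ?V"
    have "(\<Sum>b\<in>?V. f x * f y * sgn2 (dot I b (x + y))) = f x * f y * (if x + y = 0 then 2 ^ card I else 0)"
      unfolding sum_distrib_left[symmetric] dot_commute[of I _ "x + y"] using xy assms by (subst sum_sgn2_dot) auto
    thus "(\<Sum>b\<in>?V. f x * f y * sgn2 (dot I b (x + y))) = (if y = x then 2 ^ card I * (f x * f y) else 0)"
      by (auto simp: bit_fun_add_eq_0_iff)
  qed
  also have "\<dots> = 2 ^ card I * (\<Sum>x\<in>?V. (f x)\<^sup>2)"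
    using assms by (simp add: sum.delta sum_distrib_left power2_eq_square)
  finally show ?thesis .
qed

text \<open>The two masses agree on \<open>S\<close>, so the excess on an event equals the deficit
  on its complement, and each is at most half of the absolute sum.\<close>

lemma tv_dist_le_l1:
  assumes S: "finite S" "set_pmf \<mu> \<subseteq> S" "set_pmf \<nu> \<subseteq> S"
  shows "tv_dist S \<mu> \<nu> \<le> (\<Sum>x\<in>S. \<bar>pmf \<mu> x - pmf \<nu> x\<bar>) / 2"
proof -
  have "\<bar>measure_pmf.prob \<mu> E - measure_pmf.prob \<nu> E\<bar> \<le> (\<Sum>x\<in>S. \<bar>pmf \<mu> x - pmf \<nu> x\<bar>) / 2" 
    if E: "E \<subseteq> S" for E
  proof -
    let ?f = "\<lambda>x. pmf \<mu> x - pmf \<nu> x"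
    have fin: "finite E" "finite (S - E)" using S E finite_subset by auto
    have "measure_pmf.prob \<mu> E - measure_pmf.prob \<nu> E = sum ?f E"
      by (simp add: measure_measure_pmf_finite fin sum_subtractf)
    moreover have "sum ?f S = 0"
      using S by (simp add: sum_subtractf sum_pmf_eq_1)
    moreover have "sum ?f S = sum ?f (S - E) + sum ?f E"
      by (rule sum.subset_diff[OF E S(1)])
    moreover have "\<bar>sum ?f E\<bar> \<le> (\<Sum>x\<in>E. \<bar>?f x\<bar>)" "\<bar>sum ?f (S - E)\<bar> \<le> (\<Sum>x\<in>S - E. \<bar>?f x\<bar>)"
      by (rule sum_abs)+
    moreover have "(\<Sum>x\<in>S. \<bar>?f x\<bar>) = (\<Sum>x\<in>S - E. \<bar>?f x\<bar>) + (\<Sum>x\<in>E. \<bar>?f x\<bar>)"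
      by (rule sum.subset_diff[OF E S(1)])
    ultimately show ?thesis by linarith
  qed
  thus ?thesis unfolding tv_dist_def using S(1) by (subst Max_le_iff) auto
qed

text \<open>Half the \<open>L2\<close> norm of the density with respect to uniform minus 1, on the
  Fourier side. Removing \<open>b = 0\<close> subtracts the stationary law.\<close>

definition l2_bound :: "nat \<Rightarrow> nat \<Rightarrow> real" where
  "l2_bound n t = 1 / 2 * sqrt (\<Sum>b\<in>Vec (edges n) - {0}. (gauss_sum n b / 2 ^ n) ^ (2 * t))"

lemma gauss_sum_0: "gauss_sum n 0 = 2 ^ n"
  by (simp add: gauss_sum_def qf_def card_Vec)

lemma sum_walk_chi:
  assumes T0: "T0 \<in> tournaments n" and b: "b \<in> Vec (edges n)"
  shows "(\<Sum>T\<in>tournaments n. (pmf (walk_law n T0 t) T - pmf (stationary n) T) * chi n b T) = 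
     (if b = 0 then 0 else chi n b T0 * (gauss_sum n b / 2 ^ n) ^ t)"
proof -
  have "(\<Sum>T\<in>tournaments n. pmf (walk_law n T0 t) T * chi n b T) = 
      measure_pmf.expectation (walk_law n T0 t) (chi n b)"
    using set_walk_law[OF T0] 
    by (subst integral_measure_pmf_real[of "tournaments n"]) (auto simp: finite_tournaments mult.commute)
  also have "\<dots> = chi n b T0 * (gauss_sum n b / 2 ^ n) ^ t"
    by (rule expectation_walk_chi[OF T0])
  finally have 1: "(\<Sum>T\<in>tournaments n. pmf (walk_law n T0 t) T * chi n b T) = 
      chi n b T0 * (gauss_sum n b / 2 ^ n) ^ t" .
  have "(\<Sum>T\<in>tournaments n. pmf (stationary n) T * chi n b T) = 
      (\<Sum>T\<in>tournaments n. chi n b T) / 2 ^ (n choose 2)"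
    unfolding stationary_def sum_divide_distrib
    by (intro sum.cong refl, subst pmf_of_set)
       (auto simp: finite_tournaments tournaments_nonempty card_tournaments)
  also have "(\<Sum>T\<in>tournaments n. chi n b T) = (\<Sum>x\<in>Vec (edges n). sgn2 (dot (edges n) b x))"
    unfolding chi_def by (rule sum.reindex_bij_betw[OF bij_betw_tcode])
  also have "\<dots> = (if b = 0 then 2 ^ (n choose 2) else 0)"
    using b by (simp add: sum_sgn2_dot card_edges)
  finally have 2: "(\<Sum>T\<in>tournaments n. pmf (stationary n) T * chi n b T) = (if b = 0 then 1 else 0)" by simp
  have "chi n 0 T0 = 1" by (simp add: chi_def)
  thus ?thesis unfolding left_diff_distrib sum_subtractf 1 2 by (simp add: gauss_sum_0)
qed

lemma tv_dist_walk_le: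
  assumes T0: "T0 \<in> tournaments n"
  shows "tv_dist (tournaments n) (walk_law n T0 t) (stationary n) \<le> l2_bound n t"
proof -
  let ?S = "tournaments n" and ?m = "n choose 2"
  define f where "f T = pmf (walk_law n T0 t) T - pmf (stationary n) T" for T
  define F where "F x = f (inv_into ?S (tcode n) x)" for x
  have Ff: "F (tcode n T) = f T" if "T \<in> ?S" for T
    using bij_betw_inv_into_left[OF bij_betw_tcode that] by (simp add: F_def)
  have four: "(\<Sum>x\<in>Vec (edges n). F x * sgn2 (dot (edges n) b x)) = 
     (if b = 0 then 0 else chi n b T0 * (gauss_sum n b / 2 ^ n) ^ t)" if "b \<in> Vec (edges n)" for b
  proof -
    have "(\<Sum>x\<in>Vec (edges n). F x * sgn2 (dot (edges n) b x)) = 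
       (\<Sum>T\<in>?S. F (tcode n T) * sgn2 (dot (edges n) b (tcode n T)))"
      by (rule sum.reindex_bij_betw[OF bij_betw_tcode, symmetric])
    also have "\<dots> = (\<Sum>T\<in>?S. f T * chi n b T)" by (intro sum.cong) (simp_all add: Ff chi_def)
    finally show ?thesis unfolding f_def sum_walk_chi[OF T0 that] .
  qed
  have "2 ^ ?m * (\<Sum>T\<in>?S. (f T)\<^sup>2) = 2 ^ ?m * (\<Sum>T\<in>?S. (F (tcode n T))\<^sup>2)" by (simp add: Ff)
  also have "\<dots> = 2 ^ card (edges n) * (\<Sum>x\<in>Vec (edges n). (F x)\<^sup>2)"
    using sum.reindex_bij_betw[OF bij_betw_tcode, of "\<lambda>x. (F x)\<^sup>2" n] by (simp add: card_edges)
  also have "\<dots> = (\<Sum>b\<in>Vec (edges n). (\<Sum>x\<in>Vec (edges n). F x * sgn2 (dot (edges n) b x))\<^sup>2)"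
    by (rule plancherel[symmetric]) simp
  also have "\<dots> = (\<Sum>b\<in>Vec (edges n). if b = 0 then 0 else (gauss_sum n b / 2 ^ n) ^ (2 * t))"
  proof (intro sum.cong refl)
    fix b assume "b \<in> Vec (edges n)"
    \<comment> \<open>The start enters only through a sign, so the bound is the same for every
      \<open>T0\<close>.\<close>
    have "(chi n b T0)\<^sup>2 = 1" by (simp add: chi_def power2_eq_square)
    thus "(\<Sum>x\<in>Vec (edges n). F x * sgn2 (dot (edges n) b x))\<^sup>2 = 
        (if b = 0 then 0 else (gauss_sum n b / 2 ^ n) ^ (2 * t))"
      unfolding four[OF \<open>b \<in> Vec (edges n)\<close>] 
      by (simp add: power_mult_distrib power_mult[symmetric] mult.commute)
  qed
  also have "\<dots> = (\<Sum>b\<in>Vec (edges n) - {0}. (gauss_sum n b / 2 ^ n) ^ (2 * t))"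
    by (rule sum.mono_neutral_cong_right) auto
  finally have l2: "2 ^ ?m * (\<Sum>T\<in>?S. (f T)\<^sup>2) = (\<Sum>b\<in>Vec (edges n) - {0}. (gauss_sum n b / 2 ^ n) ^ (2 * t))" .
  \<comment> \<open>Cauchy-Schwarz against the constant function 1.\<close>
  have "(\<Sum>T\<in>?S. \<bar>f T\<bar>)\<^sup>2 \<le> (\<Sum>T\<in>?S. \<bar>f T\<bar>\<^sup>2) * real (card ?S)"
    by (rule sum_squared_le_sum_of_squares)
  hence "(\<Sum>T\<in>?S. \<bar>f T\<bar>)\<^sup>2 \<le> 2 ^ ?m * (\<Sum>T\<in>?S. (f T)\<^sup>2)"
    by (simp add: card_tournaments mult.commute)
  hence "(\<Sum>T\<in>?S. \<bar>f T\<bar>) \<le> sqrt (2 ^ ?m * (\<Sum>T\<in>?S. (f T)\<^sup>2))"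
    by (rule real_le_rsqrt)
  hence "(\<Sum>T\<in>?S. \<bar>f T\<bar>) / 2 \<le> l2_bound n t"
    unfolding l2_bound_def l2 by simp
  moreover have "tv_dist ?S (walk_law n T0 t) (stationary n) \<le> (\<Sum>T\<in>?S. \<bar>f T\<bar>) / 2"
    unfolding f_def using set_walk_law[OF T0]
    by (intro tv_dist_le_l1 finite_tournaments) 
      (simp_all add: stationary_def set_pmf_of_set finite_tournaments tournaments_nonempty)
  ultimately show ?thesis by linarith
qed

lemma d_le_l2_bound: "d n t \<le> l2_bound n t"
  unfolding d_def using tv_dist_walk_le tournaments_nonempty finite_tournaments
  by (subst Max_le_iff) auto

lemma gauss_sum_visible_normalized:
  assumes "b \<in> visible n (2 * h)"
  shows "(gauss_sum n b / 2 ^ n)\<^sup>2 = 1 / 4 ^ h"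
proof -
  have "(2::real) ^ (2 * h) = 4 ^ h" by (simp add: power_mult)
  hence "(gauss_sum n b)\<^sup>2 * 4 ^ h = (2 ^ n)\<^sup>2" using gauss_sum_visible[OF assms] by (simp only:)
  thus ?thesis unfolding power_divide by (simp add: divide_simps)
qed

lemma gauss_sum_normalized_le_1: "(gauss_sum n b / 2 ^ n)\<^sup>2 \<le> 1"
proof -
  have "\<bar>gauss_sum n b\<bar> \<le> (\<Sum>x\<in>Vec (verts n). \<bar>sgn2 (qf (edges n) b x)\<bar>)"
    unfolding gauss_sum_def by (rule sum_abs)
  hence "\<bar>gauss_sum n b / 2 ^ n\<bar> \<le> 1" by (simp add: card_Vec)
  thus ?thesis by (simp only: abs_square_le_1)
qed

text \<open>All eigenvalues have absolute value at most 1. This lets an estimate at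
  \<open>n - s\<close> serve all later times without monotonicity of \<open>d\<close>.\<close>

lemma l2_bound_antimono:
  assumes "t \<le> t'"
  shows "l2_bound n t' \<le> l2_bound n t"
  unfolding l2_bound_def power_mult using assms gauss_sum_normalized_le_1
  by (intro mult_left_mono real_sqrt_le_mono sum_mono power_decreasing) auto

lemma l2_bound_nonneg: "0 \<le> l2_bound n t"
  unfolding l2_bound_def by (intro mult_nonneg_nonneg real_sqrt_ge_zero sum_nonneg) (auto simp: power_mult)

lemma l2_sum_le:
  assumes t: "t \<ge> 1"
  shows "(\<Sum>b\<in>Vec (edges n) - {0}. (gauss_sum n b / 2 ^ n) ^ (2 * t)) \<le> 
     (\<Sum>h=1..n. real (card (visible n (2 * h))) / 4 ^ (h * t))"
proof -
  let ?f = "\<lambda>b. (gauss_sum n b / 2 ^ n) ^ (2 * t)"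
  have sub: "{b \<in> Vec (edges n) - {0}. gauss_sum n b \<noteq> 0} \<subseteq> (\<Union>h\<in>{1..n}. visible n (2 * h))"
  proof
    fix b assume "b \<in> {b \<in> Vec (edges n) - {0}. gauss_sum n b \<noteq> 0}"
    hence b: "b \<in> Vec (edges n)" "gauss_sum n b \<noteq> 0" "b \<noteq> 0" by auto
    obtain r where r: "b \<in> visible n r" using gauss_sum_cases[OF b(1,2)] .
    obtain h where h: "r = 2 * h" using visible_rank_even[OF r] by (auto elim: evenE)
    have "r \<noteq> 0" using visible_rank_0[of b n] r b by metis
    moreover have "r \<le> n" by (rule visible_rank_le[OF r])
    ultimately have "h \<in> {1..n}" using h by auto
    thus "b \<in> (\<Union>h\<in>{1..n}. visible n (2 * h))" using r h by blast
  qed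
  \<comment> \<open>A positive time is essential: at \<open>t = 0\<close> a vanishing eigenvalue
    would contribute \<open>0 ^ 0 = 1\<close>.\<close>
  have "(\<Sum>b\<in>Vec (edges n) - {0}. ?f b) = (\<Sum>b\<in>{b \<in> Vec (edges n) - {0}. gauss_sum n b \<noteq> 0}. ?f b)"
    using t by (intro sum.mono_neutral_right) auto
  also have "\<dots> \<le> (\<Sum>b\<in>(\<Union>h\<in>{1..n}. visible n (2 * h)). ?f b)"
    by (intro sum_mono2 sub) (auto simp: power_mult)
  also have "\<dots> = (\<Sum>h\<in>{1..n}. \<Sum>b\<in>visible n (2 * h). ?f b)"
    by (intro sum.UNION_disjoint) (auto simp: visible_def)
  also have "\<dots> = (\<Sum>h\<in>{1..n}. \<Sum>b\<in>visible n (2 * h). 1 / 4 ^ (h * t))"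
    by (intro sum.cong refl) (simp only: power_mult gauss_sum_visible_normalized power_one_over)
  finally show ?thesis by simp
qed

lemma real_card_visible_le:
  assumes "real (card (visible n r) * (\<Prod>i<r. 2 ^ r - 2 ^ i)) \<le> B"
  shows "real (card (visible n r)) * 2 ^ (r * r) \<le> 4 * B"
proof -
  have "real (card (visible n r)) * 2 ^ (r * r) = 4 * (real (card (visible n r)) * 2 ^ (r * r) * (1 / 4))" by simp
  also have "\<dots> \<le> 4 * (real (card (visible n r)) * 2 ^ (r * r) * (\<Prod>i<r. 1 - 1 / 2 ^ Suc i))"
    by (intro mult_left_mono prod_ge_quarter) auto
  also have "\<dots> = 4 * real (card (visible n r) * (\<Prod>i<r. 2 ^ r - 2 ^ i))"
    unfolding of_nat_mult real_prod_pow2_diff by (simp only: mult.assoc)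
  finally show ?thesis using assms by linarith
qed

lemma choose_two_double: "2 * h choose 2 = h * (2 * h - 1)"
  by (simp add: choose_two)

text \<open>With \<open>e = h * (2 * h - 1)\<close> the polar count gives
  \<open>4 / 2 ^ (e + 2 * h)\<close>, and \<open>4 \<le> 2 ^ (2 * h)\<close> absorbs the constant
  lost in counting bases. This produces exactly the terms of the series in
  \<open>C_star\<close>.\<close>

lemma card_visible_div_le:
  assumes "h \<ge> 1"
  shows "real (card (visible n (2 * h))) / 4 ^ (h * n) \<le> 1 / 2 ^ (h * (2 * h - 1))"
proof -
  define N where "N = real (card (visible n (2 * h)))"
  define e where "e = h * (2 * h - 1)"
  have "real (card (visible n (2 * h)) * (\<Prod>i<2 * h. 2 ^ (2 * h) - 2 ^ i)) \<le> real (2 ^ (2 * h choose 2) * 2 ^ (n * (2 * h)))"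
    using card_visible_le_polar[of n "2 * h"] by (simp only: of_nat_le_iff)
  from real_card_visible_le[OF this]
  have 1: "N * 2 ^ (2 * h * (2 * h)) \<le> 4 * (2 ^ e * 2 ^ (n * (2 * h)))"
    by (simp add: choose_two_double N_def e_def)
  have 2: "2 * h * (2 * h) = e + (e + 2 * h)"
    using assms by (cases h) (simp_all add: algebra_simps e_def)
  have "N * 2 ^ e * 2 ^ (2 * h) * 2 ^ e \<le> 4 * 2 ^ (n * (2 * h)) * 2 ^ e"
    using 1 unfolding 2 power_add by (simp only: mult_ac)
  hence 3: "N * 2 ^ e * 2 ^ (2 * h) \<le> 4 * 2 ^ (n * (2 * h))"
    by (rule mult_right_le_imp_le) simp
  have "(4::real) \<le> 4 ^ h"
    using power_increasing[OF assms, of "4::real"] by simp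
  hence "(4::real) \<le> 2 ^ (2 * h)" by (simp add: power_mult)
  hence "N * 2 ^ e * 4 \<le> N * 2 ^ e * 2 ^ (2 * h)" by (intro mult_left_mono) (auto simp: N_def)
  hence 4: "N * 2 ^ e \<le> 2 ^ (n * (2 * h))" using 3 by linarith
  have "n * (2 * h) = 2 * (h * n)" by simp
  hence "(2::real) ^ (n * (2 * h)) = 4 ^ (h * n)" by (simp only: power_mult[of 2 2]) simp
  hence "N * 2 ^ e \<le> 4 ^ (h * n)" using 4 by (simp only:)
  thus ?thesis unfolding N_def[symmetric] e_def[symmetric] by (simp add: field_simps)
qed

lemma summable_C_star: "summable (\<lambda>j. 1 / 2 ^ (Suc j * (2 * Suc j - 1)) :: real)"
proof (rule summable_comparison_test)
  show "summable (\<lambda>j. (1 / 2) ^ j :: real)" by (rule summable_geometric) simp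
  have "j \<le> Suc j * (2 * Suc j - 1)" for j by (induction j) auto
  thus "\<exists>N. \<forall>j\<ge>N. norm (1 / 2 ^ (Suc j * (2 * Suc j - 1)) :: real) \<le> (1 / 2) ^ j"
    by (auto simp: power_one_over simp del: mult_Suc power_Suc intro!: exI[of _ 0] frac_le power_increasing)
qed

text \<open>The extra \<open>c\<close> steps multiply the rank \<open>2 * h\<close> term by
  \<open>1 / 4 ^ (h * c)\<close>, at most \<open>1 / 4 ^ c\<close>; the square root turns this into
  \<open>1 / 2 ^ c\<close>.\<close>

lemma d_upper_late:
  assumes "n \<ge> 1"
  shows "d n (n + c) \<le> C_star * 2 powi (- int c)"
proof -
  let ?a = "\<lambda>j. 1 / 2 ^ (j * (2 * j - 1)) :: real"
  have "(\<Sum>b\<in>Vec (edges n) - {0}. (gauss_sum n b / 2 ^ n) ^ (2 * (n + c))) \<le> 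
     (\<Sum>h=1..n. real (card (visible n (2 * h))) / 4 ^ (h * (n + c)))"
    using assms by (intro l2_sum_le) simp
  also have "\<dots> \<le> (\<Sum>h=1..n. ?a h * (1 / 4 ^ c))"
  proof (rule sum_mono)
    fix h assume "h \<in> {1..n}"
    hence h: "h \<ge> 1" by simp
    have "real (card (visible n (2 * h))) / 4 ^ (h * (n + c)) = 
       real (card (visible n (2 * h))) / 4 ^ (h * n) * (1 / 4 ^ (h * c))"
      by (simp add: distrib_left power_add)
    also have "\<dots> \<le> ?a h * (1 / 4 ^ c)"
    proof (rule mult_mono)
      have "c \<le> h * c" using h by simp
      thus "1 / 4 ^ (h * c) \<le> (1 / 4 ^ c :: real)" by (intro frac_le power_increasing) auto
    qed (use card_visible_div_le[OF h] in auto)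
    finally show "real (card (visible n (2 * h))) / 4 ^ (h * (n + c)) \<le> ?a h * (1 / 4 ^ c)" .
  qed
  also have "\<dots> = (\<Sum>j<n. ?a (Suc j)) * (1 / 4 ^ c)"
    unfolding sum_distrib_right
    by (rule sum.reindex_bij_witness[of _ Suc "\<lambda>h. h - 1"]) auto
  also have "\<dots> \<le> (\<Sum>j. ?a (Suc j)) * (1 / 4 ^ c)"
    by (intro mult_right_mono sum_le_suminf summable_C_star) auto
  finally have "l2_bound n (n + c) \<le> 1 / 2 * sqrt ((\<Sum>j. ?a (Suc j)) * (1 / 4 ^ c))"
    unfolding l2_bound_def by simp
  also have "\<dots> = C_star * (1 / 2 ^ c)"
  proof -
    have "sqrt (4 ^ c) = 2 ^ c" by (simp add: real_sqrt_power)
    thus ?thesis by (simp add: C_star_def real_sqrt_mult real_sqrt_divide)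
  qed
  finally show ?thesis using d_le_l2_bound[of n "n + c"] by (simp add: power_int_minus divide_inverse)
qed

section \<open>The kernel obstruction\<close>

definition sym_mats :: "nat \<Rightarrow> (nat \<times> nat \<Rightarrow> bit) set" where
  "sym_mats n = {S \<in> Vec (verts n \<times> verts n). \<forall>i j. S (i, j) = S (j, i)}"

definition mat_vec :: "nat \<Rightarrow> (nat \<times> nat \<Rightarrow> bit) \<Rightarrow> (nat \<Rightarrow> bit) \<Rightarrow> nat \<Rightarrow> bit" where
  "mat_vec n S v = (\<lambda>i. if i \<in> verts n then \<Sum>j\<in>verts n. S (i, j) * v j else 0)"

definition mat_ker :: "nat \<Rightarrow> (nat \<times> nat \<Rightarrow> bit) \<Rightarrow> (nat \<Rightarrow> bit) set" where
  "mat_ker n S = {v \<in> Vec (verts n). mat_vec n S v = 0}"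

definition killing :: "nat \<Rightarrow> (nat \<Rightarrow> bit) list \<Rightarrow> (nat \<times> nat \<Rightarrow> bit) set" where
  "killing n vs = {S \<in> sym_mats n. \<forall>v\<in>set vs. mat_vec n S v = 0}"

lemma mat_vec_add_left: "mat_vec n (S + S') v = mat_vec n S v + mat_vec n S' v"
  by (auto simp: mat_vec_def fun_eq_iff algebra_simps sum.distrib)

lemma mat_vec_add_right: "mat_vec n S (u + v) = mat_vec n S u + mat_vec n S v"
  by (auto simp: mat_vec_def fun_eq_iff algebra_simps sum.distrib)

lemma mat_vec_0 [simp]: "mat_vec n 0 v = 0" "mat_vec n S 0 = 0"
  by (auto simp: mat_vec_def fun_eq_iff)

lemma finite_sym_mats [simp]: "finite (sym_mats n)"
  by (simp add: sym_mats_def)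

lemma subgrp_sym_mats [simp]: "subgrp (sym_mats n)"
  unfolding subgrp_def sym_mats_def by auto

lemma subgrp_killing [simp]: "subgrp (killing n vs)"
  using subgrp_0[OF subgrp_sym_mats] subgrpD[OF subgrp_sym_mats]
  unfolding subgrp_def killing_def by (auto simp: mat_vec_add_left)

lemma finite_killing [simp]: "finite (killing n vs)"
  by (simp add: killing_def)

lemma subgrp_mat_ker [simp]: "subgrp (mat_ker n S)"
  unfolding subgrp_def mat_ker_def by (auto simp: mat_vec_add_right)

lemma finite_mat_ker [simp]: "finite (mat_ker n S)"
  by (simp add: mat_ker_def)

lemma outer_sq_sym_mats: "p \<in> Vec (verts n) \<Longrightarrow> outer_sq p \<in> sym_mats n"
  by (auto simp: sym_mats_def outer_sq_def Vec_def mult.commute)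

lemma mat_vec_outer_sq:
  assumes "p \<in> Vec (verts n)"
  shows "mat_vec n (outer_sq p) u = (\<lambda>i. p i * dot (verts n) p u)"
proof
  fix i
  show "mat_vec n (outer_sq p) u i = p i * dot (verts n) p u"
    using assms by (cases "i \<in> verts n") 
      (auto simp: mat_vec_def outer_sq_def dot_def sum_distrib_left mult.assoc Vec_def)
qed

text \<open>If \<open>p\<close> annihilates \<open>vs\<close> and pairs to 1 with \<open>v\<close>, then \<open>p p\<^sup>T\<close> kills \<open>vs\<close> and maps \<open>v\<close> to \<open>p\<close>; such \<open>p\<close> generate the
  annihilator of \<open>vs\<close>, so the image of evaluation at \<open>v\<close> is large.\<close>

lemma card_killing_Cons:
  assumes vs: "set vs \<subseteq> Vec (verts n)" and v: "v \<in> Vec (verts n)" and ind: "indep (v # vs)"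
  shows "card (killing n (v # vs)) * 2 ^ (n - length vs) \<le> card (killing n vs)"
proof -
  let ?f = "\<lambda>S. mat_vec n S v"
  define W where "W = ann (verts n) (lspan vs)"
  have sub: "lspan vs \<subseteq> Vec (verts n)" by (intro lspan_subset vs subgrp_Vec)
  have im: "subgrp (?f ` killing n vs)" by (rule subgrp_image) (simp_all add: mat_vec_add_left)
  have one: "p \<in> ?f ` killing n vs" if p: "p \<in> W" "dot (verts n) p v = 1" for p
  proof -
    have pV: "p \<in> Vec (verts n)" and p0: "\<forall>y\<in>set vs. dot (verts n) p y = 0"
      using p(1) unfolding W_def ann_lspan by auto
    have "mat_vec n (outer_sq p) u = 0" if "u \<in> set vs" for u
      using p0 that by (auto simp: mat_vec_outer_sq[OF pV])
    hence "outer_sq p \<in> killing n vs" using outer_sq_sym_mats[OF pV] by (simp add: killing_def)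
    moreover have "p = ?f (outer_sq p)" by (simp add: mat_vec_outer_sq[OF pV] p(2))
    ultimately show ?thesis by blast
  qed
  have "v \<notin> lspan vs" using ind by simp
  then obtain p0 where p0: "p0 \<in> W" "dot (verts n) p0 v = 1"
    using ann_separates[OF finite_verts subgrp_lspan sub v] unfolding W_def by blast
  have "W \<subseteq> ?f ` killing n vs"
  proof
    fix p assume p: "p \<in> W"
    show "p \<in> ?f ` killing n vs"
    proof (cases "dot (verts n) p v = 1")
      case True
      thus ?thesis using one p by blast
    next
      case False
      \<comment> \<open>If \<open>p\<close> pairs to 0 with \<open>v\<close>, write it as
        \<open>p0 + (p0 + p)\<close>, a sum of two vectors that pair to 1.\<close>
      hence "dot (verts n) (p0 + p) v = 1" using p0 by (simp add: dot_add_left)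
      moreover have "p0 + p \<in> W" using p p0 unfolding W_def by (intro subgrpD[OF subgrp_ann])
      ultimately have "p0 + (p0 + p) \<in> ?f ` killing n vs"
        by (intro subgrpD[OF im] one[OF p0] one)
      thus ?thesis by simp
    qed
  qed
  hence "card W \<le> card (?f ` killing n vs)" by (intro card_mono) auto
  moreover have "card W = 2 ^ (n - length vs)"
  proof -
    have "indep vs" using ind by simp
    have "length vs \<le> n" 
      by (rule indep_le_card[of "Vec (verts n)"]) (use vs \<open>indep vs\<close> in \<open>simp_all add: card_Vec\<close>)
    moreover have "2 ^ length vs * card W = 2 ^ n"
      using card_ann[OF finite_verts subgrp_lspan sub] card_lspan[OF \<open>indep vs\<close>] by (simp add: W_def)
    ultimately have "2 ^ length vs * card W = 2 ^ length vs * 2 ^ (n - length vs)"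
      by (simp flip: power_add)
    thus ?thesis by simp
  qed
  moreover have "card (killing n vs) = card (?f ` killing n vs) * card {S \<in> killing n vs. ?f S = 0}"
    by (rule card_hom) (simp_all add: mat_vec_add_left)
  moreover have "{S \<in> killing n vs. ?f S = 0} = killing n (v # vs)" by (auto simp: killing_def)
  ultimately show ?thesis by (simp add: mult.commute)
qed

lemma card_sym_mats_le: "card (sym_mats n) \<le> 2 ^ ((n choose 2) + n)"
proof -
  \<comment> \<open>\<open>utri n\<close> is indexed from 0 and the vertices from 1, hence the shift
    by \<open>Suc\<close>.\<close>
  let ?f = "\<lambda>S p. if p \<in> utri n then S (Suc (fst p), Suc (snd p)) else (0::bit)"
  have "inj_on ?f (sym_mats n)"
  proof (rule inj_onI)
    fix S S' assume S: "S \<in> sym_mats n" "S' \<in> sym_mats n" and eq: "?f S = ?f S'"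
    have le: "S (i, j) = S' (i, j)" if "i \<le> j" for i j
    proof (cases "i \<in> verts n \<and> j \<in> verts n")
      case True
      have "(i - 1, j - 1) \<in> utri n" using True that by (auto simp: verts_def)
      hence "S (Suc (i - 1), Suc (j - 1)) = S' (Suc (i - 1), Suc (j - 1))"
        using fun_cong[OF eq, of "(i - 1, j - 1)"] by (simp only: if_True fst_conv snd_conv)
      thus ?thesis using True by (simp add: verts_def)
    next
      case False
      thus ?thesis using S by (simp add: sym_mats_def Vec_def)
    qed
    show "S = S'"
    proof
      fix p :: "nat \<times> nat"
      obtain i j where p: "p = (i, j)" by (cases p)
      show "S p = S' p"
        using le[of i j] le[of j i] S unfolding sym_mats_def p by (cases "i \<le> j") auto
    qed
  qed
  hence "card (sym_mats n) \<le> card (Vec (utri n))"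
    by (rule card_inj_on_le[OF _ _ finite_Vec[OF finite_upper(1)]]) (auto simp: Vec_def)
  thus ?thesis by (simp add: card_Vec card_upper)
qed

text \<open>The vector after the first \<open>k\<close> imposes \<open>n - k\<close> conditions
  rather than \<open>n\<close>: symmetry confines its image to the annihilator of the earlier
  vectors, and all of that annihilator is attained.\<close>

lemma card_killing_le:
  assumes "set vs \<subseteq> Vec (verts n)" "indep vs"
  shows "card (killing n vs) * 2 ^ (\<Sum>k<length vs. n - k) \<le> 2 ^ ((n choose 2) + n)"
  using assms
proof (induction vs)
  case Nil
  have "killing n [] = sym_mats n" by (simp add: killing_def)
  thus ?case using card_sym_mats_le by simp
next
  case (Cons v vs)
  have "card (killing n (v # vs)) * 2 ^ (\<Sum>k<length (v # vs). n - k) = 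
      card (killing n (v # vs)) * 2 ^ (n - length vs) * 2 ^ (\<Sum>k<length vs. n - k)"
    by (simp add: power_add mult_ac)
  also have "\<dots> \<le> card (killing n vs) * 2 ^ (\<Sum>k<length vs. n - k)"
    using Cons.prems by (intro mult_right_mono card_killing_Cons) auto
  also have "\<dots> \<le> 2 ^ ((n choose 2) + n)" using Cons by simp
  finally show ?case .
qed

definition big_ker :: "nat \<Rightarrow> nat \<Rightarrow> (nat \<times> nat \<Rightarrow> bit) set" where
  "big_ker n s = {S \<in> sym_mats n. 2 ^ s \<le> card (mat_ker n S)}"

lemma finite_big_ker [simp]: "finite (big_ker n s)"
  by (simp add: big_ker_def)

text \<open>The origin of \<open>tri s\<close>: \<open>n + (n - 1) + ...\<close> conditions on the
  matrix and \<open>s * s\<close> from the number of bases, against \<open>n * s\<close> for the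
  choice of \<open>s\<close> vectors.\<close>

lemma sum_diff_plus_square:
  assumes "s \<le> n"
  shows "(\<Sum>k<s. n - k) + s * s = n * s + tri s"
  using assms
proof (induction s)
  case (Suc s)
  have "tri (Suc s) = tri s + Suc s" by (simp add: tri_def numeral_2_eq_2)
  thus ?case using Suc by simp
qed (simp add: tri_def)

text \<open>Double counting of pairs of a matrix and an independent list of length \<open>s\<close>
  in its kernel. A kernel of dimension above \<open>s\<close> only has more such lists.\<close>

lemma card_big_ker_le:
  assumes s: "s \<le> n"
  shows "real (card (big_ker n s)) * (\<Prod>i<s. 1 - 1 / 2 ^ Suc i) * 2 ^ tri s \<le> 2 ^ ((n choose 2) + n)"
proof -
  let ?V = "Vec (verts n)" and ?e = "\<Sum>k<s. n - k"
  have "card (big_ker n s) * (\<Prod>i<s. 2 ^ s - 2 ^ i) = (\<Sum>S\<in>big_ker n s. \<Prod>i<s. 2 ^ s - 2 ^ i)" by simp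
  also have "\<dots> \<le> (\<Sum>S\<in>big_ker n s. card (indep_lists (mat_ker n S) s))"
  proof (rule sum_mono)
    fix S assume "S \<in> big_ker n s"
    hence "2 ^ s \<le> card (mat_ker n S)" by (simp add: big_ker_def)
    thus "(\<Prod>i<s. 2 ^ s - 2 ^ i) \<le> card (indep_lists (mat_ker n S) s)"
      by (subst card_indep_lists) (auto intro!: prod_mono)
  qed
  also have "\<dots> = card (SIGMA S:big_ker n s. indep_lists (mat_ker n S) s)"
    by (rule card_SigmaI[symmetric]) auto
  also have "\<dots> \<le> card (SIGMA vs:indep_lists ?V s. killing n vs)"
  proof (rule card_inj_on_le[of prod.swap])
    show "finite (SIGMA vs:indep_lists ?V s. killing n vs)" by (intro finite_SigmaI) auto
  qed (auto simp: big_ker_def indep_lists_def killing_def mat_ker_def)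
  also have "\<dots> = (\<Sum>vs\<in>indep_lists ?V s. card (killing n vs))"
    by (rule card_SigmaI) auto
  finally have "card (big_ker n s) * (\<Prod>i<s. 2 ^ s - 2 ^ i) * 2 ^ ?e 
      \<le> (\<Sum>vs\<in>indep_lists ?V s. card (killing n vs) * 2 ^ ?e)"
    unfolding sum_distrib_right[symmetric] by (intro mult_right_mono) auto
  also have "\<dots> \<le> (\<Sum>vs\<in>indep_lists ?V s. 2 ^ ((n choose 2) + n))"
    by (rule sum_mono) (use card_killing_le in \<open>auto simp: indep_lists_def\<close>)
  also have "\<dots> = card (indep_lists ?V s) * 2 ^ ((n choose 2) + n)" by simp
  also have "card (indep_lists ?V s) \<le> card (coord_lists n s)"
    by (rule card_mono) (auto simp: indep_lists_def coord_lists_def finite_lists_length_eq)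
  finally have "card (big_ker n s) * (\<Prod>i<s. 2 ^ s - 2 ^ i) * 2 ^ ?e \<le> 2 ^ (n * s) * 2 ^ ((n choose 2) + n)"
    by (simp add: card_coord_lists)
  hence "real (card (big_ker n s) * (\<Prod>i<s. 2 ^ s - 2 ^ i) * 2 ^ ?e) \<le> real (2 ^ (n * s) * 2 ^ ((n choose 2) + n))"
    by (simp only: of_nat_le_iff)
  hence "real (card (big_ker n s)) * (2 ^ (s * s) * (\<Prod>i<s. 1 - 1 / 2 ^ Suc i)) * 2 ^ ?e 
      \<le> 2 ^ (n * s) * 2 ^ ((n choose 2) + n)"
    by (simp only: of_nat_mult real_prod_pow2_diff of_nat_power of_nat_numeral)
  also have "real (card (big_ker n s)) * (2 ^ (s * s) * (\<Prod>i<s. 1 - 1 / 2 ^ Suc i)) * 2 ^ ?e = 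
      real (card (big_ker n s)) * (\<Prod>i<s. 1 - 1 / 2 ^ Suc i) * 2 ^ (?e + s * s)"
    by (simp only: power_add mult_ac)
  also have "\<dots> = 2 ^ (n * s) * (real (card (big_ker n s)) * (\<Prod>i<s. 1 - 1 / 2 ^ Suc i) * 2 ^ tri s)"
    by (simp only: sum_diff_plus_square[OF s] power_add mult_ac)
  finally show ?thesis by (rule mult_left_le_imp_le) simp
qed

section \<open>The walk's displacement as a Gram matrix and the lower bound\<close>

lemma walk_law_gram:
  assumes "T0 \<in> tournaments n" "T \<in> set_pmf (walk_law n T0 t)"
  shows "\<exists>xs. length xs = t \<and> set xs \<subseteq> Vec (verts n) \<and> 
      (\<forall>p\<in>edges n. tcode n T p = tcode n T0 p + (\<Sum>x\<leftarrow>xs. outer_sq x) p)"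
  using assms(2)
proof (induction t arbitrary: T)
  case (Suc t)
  then obtain T' where T': "T' \<in> set_pmf (walk_law n T0 t)" "T \<in> set_pmf (inversion_kernel n T')"
    by (auto simp: set_bind_pmf)
  have "T' \<in> tournaments n" using set_walk_law[OF assms(1)] T'(1) by blast
  obtain X where X: "X \<subseteq> {1..n}" "T = invert X T'"
    using T'(2) unfolding inversion_kernel_def set_map_pmf by (subst (asm) set_pmf_of_set) auto
  obtain xs where xs: "length xs = t" "set xs \<subseteq> Vec (verts n)"
      "\<forall>p\<in>edges n. tcode n T' p = tcode n T0 p + (\<Sum>x\<leftarrow>xs. outer_sq x) p" using Suc.IH[OF T'(1)] by blast
  have "ind X \<in> Vec (verts n)" using X bij_betw_ind[of n] by (auto simp: bij_betw_def)
  thus ?case using xs tcode_invert[OF \<open>T' \<in> tournaments n\<close>]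
    by (intro exI[of _ "ind X # xs"]) (simp add: X add_ac)
qed auto

lemma gram_sym_mats:
  "set xs \<subseteq> Vec (verts n) \<Longrightarrow> (\<Sum>x\<leftarrow>xs. outer_sq x) \<in> sym_mats n"
proof (induction xs)
  case Nil
  show ?case using subgrp_0[OF subgrp_sym_mats] by (simp only: list.map sum_list.Nil)
next
  case (Cons x xs)
  hence "x \<in> Vec (verts n)" "(\<Sum>x\<leftarrow>xs. outer_sq x) \<in> sym_mats n" by simp_all
  thus ?case unfolding list.map sum_list.Cons
    by (intro subgrpD[OF subgrp_sym_mats outer_sq_sym_mats])
qed

lemma mat_vec_gram:
  "set xs \<subseteq> Vec (verts n) \<Longrightarrow> (\<And>x. x \<in> set xs \<Longrightarrow> dot (verts n) x u = 0) \<Longrightarrow> 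
     mat_vec n (\<Sum>x\<leftarrow>xs. outer_sq x) u = 0"
  by (induction xs) (auto simp: mat_vec_add_left mat_vec_outer_sq fun_eq_iff)

lemma card_lspan_le: "card (lspan ys) \<le> 2 ^ length ys"
proof (induction ys)
  case (Cons y ys)
  have "card (lspan (y # ys)) \<le> card (lspan ys) + card ((\<lambda>v. y + v) ` lspan ys)"
    unfolding lspan.simps by (rule card_Un_le)
  also have "card ((\<lambda>v. y + v) ` lspan ys) \<le> card (lspan ys)" by (intro card_image_le) simp
  finally show ?case using Cons by simp
qed simp

text \<open>The \<open>n - s\<close> increment vectors have a common annihilator of dimension at
  least \<open>s\<close>, and every rank-one summand kills it.\<close>

lemma gram_big_ker:
  assumes xs: "set xs \<subseteq> Vec (verts n)" "length xs = n - s" and s: "s \<le> n"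
  shows "(\<Sum>x\<leftarrow>xs. outer_sq x) \<in> big_ker n s"
proof -
  let ?S = "\<Sum>x\<leftarrow>xs. outer_sq x" and ?A = "ann (verts n) (lspan xs)"
  have "card (lspan xs) * card ?A = 2 ^ n"
    using card_ann[OF finite_verts subgrp_lspan lspan_subset[OF subgrp_Vec xs(1)]] by simp
  hence "2 ^ (n - s) * 2 ^ s = card (lspan xs) * card ?A"
    using s by (simp flip: power_add)
  also have "\<dots> \<le> 2 ^ (n - s) * card ?A"
    using card_lspan_le[of xs] xs(2) by (intro mult_right_mono) auto
  finally have "2 ^ s \<le> card ?A" by simp
  also have "card ?A \<le> card (mat_ker n ?S)"
    by (intro card_mono finite_mat_ker subsetI)
       (use mat_vec_gram[OF xs(1)] in \<open>auto simp: ann_lspan mat_ker_def dot_commute\<close>)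
  finally show ?thesis using gram_sym_mats[OF xs(1)] by (simp add: big_ker_def)
qed

text \<open>Comparing finite products with \<open>prodinf\<close> requires convergence. All factors
  exceed 1, and their excess \<open>1 / (2 ^ Suc i - 1)\<close> is dominated by
  \<open>(1 / 2) ^ i\<close>.\<close>

lemma kappa_ge: "(\<Prod>i<s. inverse (1 - 1 / 2 ^ Suc i)) \<le> kappa"
proof -
  let ?f = "\<lambda>i. inverse (1 - 1 / 2 ^ Suc i) :: real"
  have gt1: "1 < ?f i" for i
  proof -
    have "(1::real) < 2 ^ Suc i" using one_less_power[of "2::real" "Suc i"] by simp
    thus ?thesis by (intro one_less_inverse) (simp_all add: field_simps)
  qed
  hence ge1: "1 \<le> ?f i" for i by (rule less_imp_le)
  have "summable (\<lambda>i. ?f i - 1)"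
  proof (rule summable_comparison_test)
    show "summable (\<lambda>i. (1 / 2) ^ i :: real)" by (rule summable_geometric) simp
    have "norm (?f i - 1) \<le> (1 / 2) ^ i" for i
    proof -
      define a :: real where "a = 2 ^ i"
      have a: "1 \<le> a" by (simp add: a_def)
      have "?f i - 1 = 1 / (2 * a - 1)" using a by (simp add: a_def[symmetric] field_simps)
      also have "\<dots> \<le> 1 / a" using a by (intro frac_le) auto
      also have "\<dots> = (1 / 2) ^ i" by (simp add: a_def power_one_over)
      finally show ?thesis using ge1[of i] by simp
    qed
    thus "\<exists>N. \<forall>i\<ge>N. norm (?f i - 1) \<le> (1 / 2) ^ i" by blast
  qed
  hence "convergent_prod (\<lambda>i. 1 + (?f i - 1))"
    using gt1 by (subst convergent_prod_iff_summable_real) (simp_all only: diff_gt_0_iff_gt)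
  hence "convergent_prod ?f" by simp
  hence hp: "?f has_prod prodinf ?f" by (rule convergent_prod_has_prod)
  show ?thesis unfolding kappa_def
    using ge1 order_trans[OF zero_le_one ge1] by (intro prod_le_prodinf[OF hp])
qed

lemma d_lower:
  assumes s: "s \<le> n"
  shows "d n (n - s) \<ge> 1 - kappa * 2 powi (int n - int (tri s))"
proof -
  let ?m = "n choose 2"
  obtain T0 where T0: "T0 \<in> tournaments n" using tournaments_nonempty by blast
  \<comment> \<open>The distinguishing event: the displacement from \<open>T0\<close> is the part
    above the diagonal of a symmetric matrix with large kernel. The walk satisfies it surely at time
    \<open>n - s\<close>.\<close>
  define E where "E = {T \<in> tournaments n. \<exists>S\<in>big_ker n s. \<forall>p\<in>edges n. tcode n T p = tcode n T0 p + S p}"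
  have E: "E \<subseteq> tournaments n" by (auto simp: E_def)
  have "set_pmf (walk_law n T0 (n - s)) \<subseteq> E"
  proof
    fix T assume T: "T \<in> set_pmf (walk_law n T0 (n - s))"
    obtain xs where "length xs = n - s" "set xs \<subseteq> Vec (verts n)"
      "\<forall>p\<in>edges n. tcode n T p = tcode n T0 p + (\<Sum>x\<leftarrow>xs. outer_sq x) p"
      using walk_law_gram[OF T0 T] by blast
    thus "T \<in> E" using gram_big_ker[of xs n s] s set_walk_law[OF T0] T unfolding E_def by blast
  qed
  hence "measure_pmf.prob (walk_law n T0 (n - s)) E = 1"
    by (subst measure_pmf.prob_eq_1) (auto simp: AE_measure_pmf_iff)
  moreover have "measure_pmf.prob (stationary n) E = card E / 2 ^ ?m"
    using E unfolding stationary_def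
    by (subst measure_pmf_of_set) (auto simp: finite_tournaments tournaments_nonempty card_tournaments Int_absorb1)
  moreover have "\<bar>measure_pmf.prob (walk_law n T0 (n - s)) E - measure_pmf.prob (stationary n) E\<bar>
      \<le> tv_dist (tournaments n) (walk_law n T0 (n - s)) (stationary n)"
    unfolding tv_dist_def using E by (intro Max_ge) (auto simp: finite_tournaments)
  moreover have "\<dots> \<le> d n (n - s)" unfolding d_def using T0 by (intro Max_ge) (auto simp: finite_tournaments)
  ultimately have 1: "1 - card E / 2 ^ ?m \<le> d n (n - s)" by linarith
  \<comment> \<open>Choosing one matrix per tournament is injective because the entries above the
    diagonal recover the tournament. Comparing \<open>2 ^ (?m + n)\<close> symmetric matrices with
    \<open>2 ^ ?m\<close> tournaments costs the factor \<open>2 ^ n\<close>.\<close>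
  have "\<forall>T\<in>E. \<exists>S. S \<in> big_ker n s \<and> (\<forall>p\<in>edges n. tcode n T p = tcode n T0 p + S p)"
    by (auto simp: E_def)
  from bchoice[OF this] obtain f where f: "\<forall>T\<in>E. f T \<in> big_ker n s \<and> 
      (\<forall>p\<in>edges n. tcode n T p = tcode n T0 p + f T p)" ..
  have "inj_on f E"
  proof (rule inj_onI)
    fix T T' assume *: "T \<in> E" "T' \<in> E" "f T = f T'"
    have "tcode n T p = tcode n T' p" for p
    proof (cases "p \<in> edges n")
      case True
      thus ?thesis using f * by simp
    next
      case False
      thus ?thesis by (simp add: tcode_def)
    qed
    hence "tcode n T = tcode n T'" by blast
    thus "T = T'" using * E bij_betw_tcode[of n] by (auto simp: bij_betw_def dest: inj_onD)
  qed
  hence "card E \<le> card (big_ker n s)" using f by (intro card_inj_on_le[of f]) auto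
  also have "real (card (big_ker n s)) \<le> kappa * 2 ^ (?m + n) / 2 ^ tri s"
  proof -
    let ?P = "\<Prod>i<s. 1 - 1 / 2 ^ Suc i :: real"
    have P: "?P > 0" using prod_ge_quarter[of s] by linarith
    have "real (card (big_ker n s)) * 2 ^ tri s * ?P \<le> 2 ^ (?m + n)"
      using card_big_ker_le[OF s] by (simp only: mult_ac)
    hence "real (card (big_ker n s)) * 2 ^ tri s \<le> 2 ^ (?m + n) * inverse ?P"
      using P by (simp add: field_simps)
    also have "inverse ?P \<le> kappa" using kappa_ge[of s] by (simp only: prod_inversef[symmetric] comp_def)
    finally show ?thesis by (simp add: field_simps)
  qed
  finally have "card E / 2 ^ ?m \<le> kappa * 2 ^ (?m + n) / 2 ^ tri s / 2 ^ ?m" 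
    by (intro divide_right_mono) auto
  also have "\<dots> = kappa * (2 ^ n / 2 ^ tri s)" by (simp add: power_add)
  also have "2 ^ n / 2 ^ tri s = (2::real) powi (int n - int (tri s))"
    by (simp add: power_int_diff)
  finally show ?thesis using 1 by linarith
qed

lemma tv_dist_le_1:
  assumes "finite S"
  shows "tv_dist S \<mu> \<nu> \<le> 1"
proof -
  have "\<bar>measure_pmf.prob \<mu> E - measure_pmf.prob \<nu> E\<bar> \<le> 1" for E
    using measure_pmf.prob_le_1[of \<mu> E] measure_pmf.prob_le_1[of \<nu> E]
      measure_nonneg[of \<mu> E] measure_nonneg[of \<nu> E] by linarith
  thus ?thesis unfolding tv_dist_def using assms by (subst Max_le_iff) auto
qed

lemma d_le_1: "d n t \<le> 1"
  unfolding d_def using tournaments_nonempty finite_tournaments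
  by (subst Max_le_iff) (auto intro!: tv_dist_le_1)

lemma d_nonneg: "0 \<le> d n t"
proof -
  obtain T0 where T0: "T0 \<in> tournaments n" using tournaments_nonempty by blast
  have "0 \<le> tv_dist (tournaments n) (walk_law n T0 t) (stationary n)"
    unfolding tv_dist_def
  proof (rule Max_ge)
    show "0 \<in> (\<lambda>E. \<bar>measure_pmf.prob (walk_law n T0 t) E - measure_pmf.prob (stationary n) E\<bar>) ` Pow (tournaments n)"
      by (rule image_eqI[of _ _ "{}"]) auto
  qed (simp add: finite_tournaments)
  also have "\<dots> \<le> d n t" unfolding d_def using T0 by (intro Max_ge) (auto simp: finite_tournaments)
  finally show ?thesis .
qed

section \<open>Asymptotics\<close>

lemma tri_double: "2 * tri s = s * (s + 1)"
  by (simp add: tri_def choose_two)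

lemma real_tri: "real (tri s) = real s * (real s + 1) / 2"
proof -
  have "real (2 * tri s) = real (s * (s + 1))" by (simp only: tri_double)
  thus ?thesis by (simp add: algebra_simps)
qed

lemma tri_Suc: "tri (Suc s) = tri s + Suc s"
  by (simp add: tri_def numeral_2_eq_2)

lemma tri_add_le: "a \<le> b \<Longrightarrow> tri a + (b - a) \<le> tri b"
  by (induction b rule: dec_induct) (auto simp: tri_Suc)

lemma tri_mono: "a \<le> b \<Longrightarrow> tri a \<le> tri b"
  using tri_add_le[of a b] by simp

lemma le_tri: "s \<le> tri s"
  using tri_add_le[of 0 s] by simp

section \<open>Size of the Fourier terms before time \<open>n\<close>\<close>

lemma sum_half_powers_le:
  assumes "finite B" "inj_on g B"
  shows "(\<Sum>r\<in>B. (1 / 2 :: real) ^ g r) \<le> 2"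
proof -
  have "(\<Sum>r\<in>B. (1 / 2 :: real) ^ g r) = (\<Sum>j\<in>g ` B. (1 / 2) ^ j)"
    using assms by (simp add: sum.reindex)
  also have "\<dots> \<le> (\<Sum>j. (1 / 2) ^ j)"
    using assms by (intro sum_le_suminf summable_geometric) auto
  also have "\<dots> = 2" by (subst suminf_geometric) auto
  finally show ?thesis .
qed

text \<open>With truncated subtraction the exponent is the distance between \<open>r\<close> and
  \<open>s\<close>; each side of \<open>s\<close> contributes at most a full geometric
  series.\<close>

lemma sum_half_powers_dist_le:
  assumes "finite A"
  shows "(\<Sum>r\<in>A. (1 / 2 :: real) ^ ((r - s) + (s - r))) \<le> 4"
proof -
  have "(\<Sum>r\<in>A. (1 / 2 :: real) ^ ((r - s) + (s - r))) = 
     (\<Sum>r\<in>A \<inter> {..s}. (1 / 2) ^ ((r - s) + (s - r))) + (\<Sum>r\<in>A - {..s}. (1 / 2) ^ ((r - s) + (s - r)))"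
    by (rule sum.Int_Diff[OF assms])
  also have "\<dots> \<le> 2 + 2"
    using assms by (intro add_mono sum_half_powers_le) (auto simp: inj_on_def)
  finally show ?thesis by simp
qed

text \<open>Exponents of 2: \<open>2 * h * h + h\<close> from the reduced forms, minus
  \<open>4 * h * h\<close> from the bases, plus \<open>2 * h * s\<close> for the \<open>s\<close>
  missing steps. The power with exponent \<open>n\<close> is the proportion of zeros.\<close>

lemma l2_term_le:
  assumes s: "s \<le> n"
  shows "real (card (visible n (2 * h))) / 4 ^ (h * (n - s)) \<le> 
     4 * ((1 + 1 / 2 ^ h) / 2) ^ n * 2 ^ (h + 2 * h * s) / 2 ^ (2 * h * h)"
proof -
  define N where "N = real (card (visible n (2 * h)))"
  define P where "P = (\<Prod>i<2 * h. (2::nat) ^ (2 * h) - 2 ^ i)"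
  define q :: real where "q = (4 ^ h + 2 ^ h) ^ n / 2 ^ n"
  have q: "q = 4 ^ (h * n) * ((1 + 1 / 2 ^ h) / 2) ^ n"
  proof -
    have "(4::real) ^ h = 2 ^ h * 2 ^ h" by (simp add: power_mult_distrib[symmetric])
    hence "(4::real) ^ h + 2 ^ h = 4 ^ h * (1 + 1 / 2 ^ h)" by (simp add: field_simps)
    thus ?thesis unfolding q_def by (simp add: power_mult_distrib power_divide power_mult)
  qed
  have "real (2 ^ n * (card (visible n (2 * h)) * P)) \<le> real (2 ^ ((2 * h choose 2) + 2 * h) * (4 ^ h + 2 ^ h) ^ n)"
    using card_visible_le_zeros[of n h] unfolding P_def by (simp only: of_nat_le_iff)
  hence "2 ^ n * real (card (visible n (2 * h)) * P) \<le> 2 ^ ((2 * h choose 2) + 2 * h) * (4 ^ h + 2 ^ h) ^ n"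
    by simp
  hence "real (card (visible n (2 * h)) * P) \<le> 2 ^ ((2 * h choose 2) + 2 * h) * q"
    by (simp add: q_def field_simps)
  hence 0: "N * 2 ^ (2 * h * (2 * h)) \<le> 4 * (2 ^ ((2 * h choose 2) + 2 * h) * q)"
    unfolding P_def N_def by (rule real_card_visible_le)
  have e1: "(2 * h choose 2) + 2 * h = 2 * h * h + h"
    unfolding choose_two_double by (cases h) (simp_all add: algebra_simps)
  have e2: "2 * h * (2 * h) = (2 * h * h) + (2 * h * h)" by simp
  have "N * 2 ^ (2 * h * h) * 2 ^ (2 * h * h) \<le> 4 * 2 ^ h * q * 2 ^ (2 * h * h)"
    using 0 unfolding e1 unfolding e2 power_add by (simp only: mult_ac)
  hence 1: "N * 2 ^ (2 * h * h) \<le> 4 * 2 ^ h * q"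
    by (rule mult_right_le_imp_le) simp
  have 4: "(4::real) ^ (h * n) = 4 ^ (h * (n - s)) * 2 ^ (2 * h * s)"
  proof -
    have "h * n = h * (n - s) + h * s" using s by (simp flip: distrib_left)
    hence "(4::real) ^ (h * n) = 4 ^ (h * (n - s)) * 4 ^ (h * s)" by (simp only: power_add)
    also have "(4::real) ^ (h * s) = 2 ^ (2 * h * s)" by (simp add: power_mult)
    finally show ?thesis .
  qed
  have "N * 2 ^ (2 * h * h) \<le> 4 * ((1 + 1 / 2 ^ h) / 2) ^ n * 2 ^ (h + 2 * h * s) * 4 ^ (h * (n - s))"
    using 1 unfolding q 4 power_add by (simp only: mult_ac)
  thus ?thesis unfolding N_def by (simp add: divide_le_eq le_divide_eq mult_ac)
qed

text \<open>For \<open>h \<ge> 1\<close> the proportion of zeros is at most 3/4, and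
  \<open>2 ^ h \<le> n\<close> turns \<open>2 ^ (2 * h * s)\<close> into a power of
  \<open>n\<close>.\<close>

lemma l2_term_le_small:
  assumes s: "s \<le> n" and h: "2 ^ h \<le> n" "h \<ge> 1"
  shows "real (card (visible n (2 * h))) / 4 ^ (h * (n - s)) \<le> 4 * (3 / 4) ^ n * real n ^ (2 * s)"
proof -
  have "(2::real) ^ 1 \<le> 2 ^ h" using h by (intro power_increasing) auto
  hence a: "(1 + 1 / 2 ^ h) / 2 \<le> (3 / 4 :: real)" by (simp add: field_simps)
  have "h \<le> 2 * h * h" by (cases h) auto
  hence "(2::real) ^ h \<le> 2 ^ (2 * h * h)" by (intro power_increasing) auto
  hence b: "2 ^ (h + 2 * h * s) / 2 ^ (2 * h * h) \<le> (2::real) ^ (2 * h * s)"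
    by (simp add: power_add divide_le_eq)
  have "(2::real) ^ (2 * h * s) = (2 ^ h) ^ (2 * s)" by (simp add: power_mult[symmetric] mult_ac)
  also have "\<dots> \<le> real n ^ (2 * s)"
  proof (rule power_mono)
    have "real (2 ^ h) \<le> real n" using h(1) by (simp only: of_nat_le_iff)
    thus "2 ^ h \<le> real n" by simp
  qed simp
  finally have c: "2 ^ (h + 2 * h * s) / 2 ^ (2 * h * h) \<le> real n ^ (2 * s)" using b by linarith
  have "real (card (visible n (2 * h))) / 4 ^ (h * (n - s)) \<le> 
      4 * ((1 + 1 / 2 ^ h) / 2) ^ n * (2 ^ (h + 2 * h * s) / 2 ^ (2 * h * h))"
    using l2_term_le[OF s, of h] by simp
  also have "\<dots> \<le> 4 * (3 / 4) ^ n * real n ^ (2 * s)"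
    by (intro mult_mono power_mono a c) auto
  finally show ?thesis .
qed

text \<open>With \<open>r = 2 * h\<close>, the exponent \<open>r s - r (r - 1) / 2\<close> equals \<open>tri s - (r - s) (r - s - 1) / 2\<close>.\<close>

lemma l2_exponent:
  "h + 2 * h * s + ((2 * h - s) + (s - 2 * h)) \<le> tri s + 2 * h * h + 1"
proof -
  define k where "k = int (2 * h) - int s"
  \<comment> \<open>The quadratic loss \<open>k * (k - 1) / 2\<close> away from the optimal rank is
    weakened to the linear \<open>\<bar>k\<bar> - 1\<close>, enough for geometric summation; this is
    the \<open>+ 1\<close> in the claim.\<close>
  have "2 * (\<bar>k\<bar> - 1) \<le> k * (k - 1)"
  proof (cases "k \<ge> 1")
    case True
    have "(k - 1) * (k - 2) \<ge> 0"
    proof (cases "k = 1")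
      case False
      thus ?thesis using True by (intro mult_nonneg_nonneg) auto
    qed simp
    hence "2 * (k - 1) \<le> k * (k - 1)" by (simp add: algebra_simps)
    thus ?thesis using True by linarith
  next
    case False
    have "k * (k + 1) \<ge> 0"
    proof (cases "k = 0")
      case neq: False
      thus ?thesis using False by (intro mult_nonpos_nonpos) auto
    qed simp
    hence *: "2 * (- k) \<le> k * (k - 1)" by (simp add: algebra_simps)
    have "\<bar>k\<bar> = - k" using False by linarith
    hence "2 * (\<bar>k\<bar> - 1) \<le> 2 * (- k)" by (simp only:) simp
    thus ?thesis using * by (rule order_trans)
  qed
  moreover have "k * (k - 1) = int s * (int s + 1) + 4 * int h * int h - 4 * int h * int s - 2 * int h"
    by (simp add: k_def algebra_simps)
  moreover have "2 * int (tri s) = int s * (int s + 1)"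
    using arg_cong[OF tri_double[of s], of int] by (simp add: algebra_simps)
  moreover have "int ((2 * h - s) + (s - 2 * h)) = \<bar>k\<bar>" by (auto simp: k_def)
  ultimately have "2 * int (h + 2 * h * s + ((2 * h - s) + (s - 2 * h))) \<le> 2 * int (tri s + 2 * h * h + 1)"
    by simp
  hence "int (h + 2 * h * s + ((2 * h - s) + (s - 2 * h))) \<le> int (tri s + 2 * h * h + 1)"
    by (rule mult_left_le_imp_le) simp
  thus ?thesis by (simp only: of_nat_le_iff)
qed

text \<open>For \<open>2 ^ h \<ge> n\<close> the correction \<open>(1 + 1 / 2 ^ h) ^ n\<close> is at
  most \<open>exp 1 \<le> 3\<close>. The constant is \<open>24 = 4 * 3 * 2\<close>: bases, this
  correction, and the \<open>+ 1\<close> of \<open>l2_exponent\<close>.\<close>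

lemma l2_term_le_large:
  assumes s: "s \<le> n" and h: "n \<le> 2 ^ h"
  shows "real (card (visible n (2 * h))) / 4 ^ (h * (n - s)) \<le> 
     24 * (2 ^ tri s / 2 ^ n) * (1 / 2) ^ ((2 * h - s) + (s - 2 * h))"
proof -
  let ?D = "(2 * h - s) + (s - 2 * h)"
  have "(1 + 1 / 2 ^ h :: real) ^ n \<le> exp (1 / 2 ^ h) ^ n"
    by (intro power_mono exp_ge_add_one_self) auto
  also have "\<dots> = exp (real n / 2 ^ h)" by (simp add: exp_of_nat_mult[symmetric])
  also have "\<dots> \<le> exp 1"
  proof -
    have "real n \<le> real (2 ^ h)" using h by (simp only: of_nat_le_iff)
    thus ?thesis by (simp add: divide_le_eq)
  qed
  also have "\<dots> \<le> 3" by (rule exp_le)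
  finally have a: "((1 + 1 / 2 ^ h) / 2 :: real) ^ n \<le> 3 / 2 ^ n" by (simp add: power_divide divide_right_mono)
  have "(2::real) ^ (h + 2 * h * s + ?D) \<le> 2 ^ (tri s + 2 * h * h + 1)"
    by (intro power_increasing l2_exponent) auto
  hence "2 ^ (h + 2 * h * s) * 2 ^ ?D \<le> (2::real) ^ tri s * 2 ^ (2 * h * h) * 2" 
    by (simp only: power_add power_one_right)
  hence b: "2 ^ (h + 2 * h * s) / 2 ^ (2 * h * h) \<le> (2::real) * 2 ^ tri s * (1 / 2) ^ ?D"
    by (simp add: power_one_over field_simps)
  have "real (card (visible n (2 * h))) / 4 ^ (h * (n - s)) \<le> 
      4 * ((1 + 1 / 2 ^ h) / 2) ^ n * (2 ^ (h + 2 * h * s) / 2 ^ (2 * h * h))"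
    using l2_term_le[OF s, of h] by simp
  also have "\<dots> \<le> 4 * (3 / 2 ^ n) * (2 * 2 ^ tri s * (1 / 2) ^ ?D)"
    by (intro mult_mono a b mult_left_mono) auto
  finally show ?thesis by simp
qed

text \<open>Every rank is bounded by the sum of the small-rank and large-rank estimates, which
  avoids splitting the range of \<open>h\<close>. The constant is \<open>96 = 24 * 4\<close>, with 4
  from the two geometric series.\<close>

lemma l2_bound_square_le:
  assumes s: "s < n"
  shows "(2 * l2_bound n (n - s))\<^sup>2 \<le> 4 * real n * (3 / 4) ^ n * real n ^ (2 * s) + 96 * (2 ^ tri s / 2 ^ n)"
proof -
  let ?D = "\<lambda>r. (r - s) + (s - r)"
  let ?A = "4 * (3 / 4) ^ n * real n ^ (2 * s)" and ?B = "24 * (2 ^ tri s / 2 ^ n) :: real"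
  let ?S = "\<Sum>b\<in>Vec (edges n) - {0}. (gauss_sum n b / 2 ^ n) ^ (2 * (n - s))"
  have "?S \<ge> 0" by (intro sum_nonneg) (auto simp: power_mult)
  hence "(2 * l2_bound n (n - s))\<^sup>2 = ?S"
    unfolding l2_bound_def by simp
  also have "\<dots> \<le> (\<Sum>h=1..n. real (card (visible n (2 * h))) / 4 ^ (h * (n - s)))"
    using s by (intro l2_sum_le) simp
  also have "\<dots> \<le> (\<Sum>h=1..n. ?A + ?B * (1 / 2) ^ ?D (2 * h))"
  proof (rule sum_mono)
    fix h assume h: "h \<in> {1..n}"
    have "?A \<ge> 0" "?B * (1 / 2) ^ ?D (2 * h) \<ge> 0" by auto
    thus "real (card (visible n (2 * h))) / 4 ^ (h * (n - s)) \<le> ?A + ?B * (1 / 2) ^ ?D (2 * h)"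
      using l2_term_le_small[of s n h] l2_term_le_large[of s n h] s h
      by (cases "2 ^ h \<le> n") (auto intro: order_trans)
  qed
  also have "\<dots> = real n * ?A + ?B * (\<Sum>h=1..n. (1 / 2) ^ ?D (2 * h))"
    by (simp add: sum.distrib sum_distrib_left)
  also have "(\<Sum>h=1..n. (1 / 2 :: real) ^ ?D (2 * h)) = (\<Sum>r\<in>(\<lambda>h. 2 * h) ` {1..n}. (1 / 2) ^ ?D r)"
    by (subst sum.reindex) (auto simp: inj_on_def)
  also have "?B * \<dots> \<le> ?B * 4"
    by (intro mult_left_mono sum_half_powers_dist_le) auto
  finally show ?thesis by (simp add: mult_ac)
qed

section \<open>Limits along sequences of times\<close>

lemma filterlim_int_at_top_mono:
  fixes f :: "nat \<Rightarrow> int" and g :: "nat \<Rightarrow> real"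
  assumes "filterlim g at_top sequentially" "\<forall>\<^sub>F n in sequentially. g n \<le> of_int (f n)"
  shows "filterlim f at_top sequentially"
  unfolding filterlim_at_top
proof
  fix Z
  have "\<forall>\<^sub>F n in sequentially. of_int Z \<le> g n"
    using assms(1) by (simp add: filterlim_at_top)
  with assms(2) show "\<forall>\<^sub>F n in sequentially. Z \<le> f n"
  proof eventually_elim
    case (elim n)
    hence "real_of_int Z \<le> of_int (f n)" by linarith
    thus ?case by simp
  qed
qed

lemma filterlim_int_at_bot_mono:
  fixes f :: "nat \<Rightarrow> int" and g :: "nat \<Rightarrow> real"
  assumes "filterlim g at_bot sequentially" "\<forall>\<^sub>F n in sequentially. of_int (f n) \<le> g n"
  shows "filterlim f at_bot sequentially"
  unfolding filterlim_at_bot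
proof
  fix Z
  have "\<forall>\<^sub>F n in sequentially. g n \<le> of_int Z"
    using assms(1) by (simp add: filterlim_at_bot)
  with assms(2) show "\<forall>\<^sub>F n in sequentially. f n \<le> Z"
  proof eventually_elim
    case (elim n)
    hence "real_of_int (f n) \<le> of_int Z" by linarith
    thus ?case by simp
  qed
qed

lemma tendsto_powi_at_bot:
  fixes f :: "nat \<Rightarrow> int"
  assumes "filterlim f at_bot sequentially"
  shows "(\<lambda>n. 2 powi f n :: real) \<longlonglongrightarrow> 0"
proof -
  have "filterlim (\<lambda>n. real_of_int (f n)) at_bot sequentially"
    unfolding filterlim_at_bot
  proof
    fix Z :: real
    have "\<forall>\<^sub>F n in sequentially. f n \<le> \<lfloor>Z\<rfloor>" using assms by (simp add: filterlim_at_bot)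
    thus "\<forall>\<^sub>F n in sequentially. real_of_int (f n) \<le> Z" by (simp add: le_floor_iff)
  qed
  moreover have "((\<lambda>x. 2 powr x :: real) \<longlongrightarrow> 0) at_bot" by real_asymp
  ultimately have "(\<lambda>n. 2 powr real_of_int (f n) :: real) \<longlonglongrightarrow> 0"
    by (rule filterlim_compose[rotated])
  thus ?thesis by (simp add: powr_real_of_int')
qed

lemma l2_bound_tendsto_0:
  assumes lim: "filterlim (\<lambda>n. int (tri (s n)) - int n) at_bot sequentially"
  shows "(\<lambda>n. l2_bound n (n - s n)) \<longlonglongrightarrow> 0"
proof -
  \<comment> \<open>The unknown exponent \<open>2 * s n\<close> is replaced by
    \<open>2 * sqrt (2 * n)\<close>, a consequence of \<open>tri (s n) \<le> n\<close>, so the first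
    summand becomes an explicit function of \<open>n\<close>.\<close>
  let ?g = "\<lambda>n. 4 * real n * (3 / 4) ^ n * real n powr (2 * sqrt (2 * real n)) + 96 * 2 powi (int (tri (s n)) - int n)"
  have "(\<lambda>n. 4 * real n * (3 / 4) ^ n * real n powr (2 * sqrt (2 * real n))) \<longlonglongrightarrow> 0"
    by real_asymp
  hence "?g \<longlonglongrightarrow> 0 + 96 * 0"
    by (intro tendsto_add tendsto_mult tendsto_const tendsto_powi_at_bot lim)
  hence g0: "?g \<longlonglongrightarrow> 0" by simp
  have "\<forall>\<^sub>F n in sequentially. int (tri (s n)) - int n \<le> 0"
    using lim unfolding filterlim_at_bot by blast
  hence "\<forall>\<^sub>F n in sequentially. (2 * l2_bound n (n - s n))\<^sup>2 \<le> ?g n"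
    using eventually_ge_at_top[of "2::nat"]
  proof eventually_elim
    case (elim n)
    hence tri: "tri (s n) \<le> n" by simp
    have "s n * (s n + 1) \<le> 2 * n" using tri tri_double[of "s n"] by linarith
    \<comment> \<open>The time \<open>n - s n\<close> must be positive for the \<open>L2\<close>
      estimate; \<open>tri n > n\<close> for \<open>n \<ge> 2\<close> since
      \<open>tri 2 = 3\<close>.\<close>
    have "s n \<noteq> n"
    proof
      assume "s n = n"
      hence "tri 2 + (n - 2) \<le> n" using tri_add_le[of 2 n] tri elim by simp
      thus False using elim by (simp add: tri_def choose_two)
    qed
    hence lt: "s n < n" using le_tri[of "s n"] tri by linarith
    have "(real (s n))\<^sup>2 \<le> 2 * real n"
    proof -
      have "s n * s n \<le> 2 * n" using \<open>s n * (s n + 1) \<le> 2 * n\<close> by simp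
      hence "real (s n * s n) \<le> real (2 * n)" by (simp only: of_nat_le_iff)
      thus ?thesis by (simp add: power2_eq_square)
    qed
    hence "real (s n) \<le> sqrt (2 * real n)" by (rule real_le_rsqrt)
    hence "real n powr (2 * real (s n)) \<le> real n powr (2 * sqrt (2 * real n))"
      using elim by (intro powr_mono) auto
    moreover have "real n powr (2 * real (s n)) = real n ^ (2 * s n)"
      using elim powr_realpow[of "real n" "2 * s n"] by simp
    ultimately have "4 * real n * (3 / 4) ^ n * real n ^ (2 * s n) \<le> 
       4 * real n * (3 / 4) ^ n * real n powr (2 * sqrt (2 * real n))"
      by (intro mult_left_mono) auto
    moreover have "(2::real) powi (int (tri (s n)) - int n) = 2 ^ tri (s n) / 2 ^ n"
      by (simp add: power_int_diff)
    ultimately show ?case using l2_bound_square_le[OF lt] by linarith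
  qed
  hence "(\<lambda>n. (2 * l2_bound n (n - s n))\<^sup>2) \<longlonglongrightarrow> 0"
    by (intro tendsto_sandwich[OF _ _ tendsto_const g0]) auto
  hence "(\<lambda>n. sqrt ((2 * l2_bound n (n - s n))\<^sup>2) / 2) \<longlonglongrightarrow> sqrt 0 / 2"
    by (intro tendsto_divide tendsto_real_sqrt tendsto_const) auto
  moreover have "sqrt ((2 * l2_bound n (n - s n))\<^sup>2) / 2 = l2_bound n (n - s n)" for n
    using l2_bound_nonneg[of n "n - s n"] unfolding real_sqrt_abs by simp
  ultimately show ?thesis by simp
qed

lemma d_tendsto_0:
  assumes "filterlim (\<lambda>n. int (tri (s n)) - int n) at_bot sequentially"
    "\<forall>\<^sub>F n in sequentially. n - s n \<le> t n"
  shows "(\<lambda>n. d n (t n)) \<longlonglongrightarrow> 0"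
proof (rule tendsto_sandwich[OF _ _ tendsto_const l2_bound_tendsto_0[OF assms(1)]])
  show "\<forall>\<^sub>F n in sequentially. d n (t n) \<le> l2_bound n (n - s n)"
    using assms(2)
  proof eventually_elim
    case (elim n)
    thus ?case using d_le_l2_bound[of n "t n"] l2_bound_antimono[OF elim, of n] by linarith
  qed
qed (simp add: d_nonneg)

lemma d_tendsto_1:
  assumes lim: "filterlim (\<lambda>n. int (tri (s n)) - int n) at_top sequentially"
    and ev: "\<forall>\<^sub>F n in sequentially. s n \<le> n \<and> t n = n - s n"
  shows "(\<lambda>n. d n (t n)) \<longlonglongrightarrow> 1"
proof (rule tendsto_sandwich[OF _ _ _ tendsto_const])
  have "filterlim (\<lambda>n. - (int (tri (s n)) - int n)) at_bot sequentially"
    unfolding filterlim_at_bot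
  proof
    fix Z
    have "\<forall>\<^sub>F n in sequentially. - Z \<le> int (tri (s n)) - int n"
      using lim unfolding filterlim_at_top by blast
    thus "\<forall>\<^sub>F n in sequentially. - (int (tri (s n)) - int n) \<le> Z"
      by eventually_elim linarith
  qed
  hence "(\<lambda>n. 2 powi (- (int (tri (s n)) - int n)) :: real) \<longlonglongrightarrow> 0" by (rule tendsto_powi_at_bot)
  hence "(\<lambda>n. 1 - kappa * 2 powi (int n - int (tri (s n)))) \<longlonglongrightarrow> 1 - kappa * 0"
    by (intro tendsto_diff tendsto_mult tendsto_const) simp
  thus "(\<lambda>n. 1 - kappa * 2 powi (int n - int (tri (s n)))) \<longlonglongrightarrow> 1" by simp
  show "\<forall>\<^sub>F n in sequentially. 1 - kappa * 2 powi (int n - int (tri (s n))) \<le> d n (t n)"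
    using ev by eventually_elim (use d_lower in auto)
qed (simp add: d_le_1)

section \<open>The integer threshold \<open>sigma_n\<close>\<close>

lemma sigma_n_bounds:
  shows "tri (sigma_n n) \<le> n" "n < tri (Suc (sigma_n n))"
proof -
  have fin: "finite {s. tri s \<le> n}"
    by (rule finite_subset[of _ "{..n}"]) (use le_tri order_trans in auto)
  have "tri 0 \<le> n" by (simp add: tri_def numeral_2_eq_2)
  hence "sigma_n n \<in> {s. tri s \<le> n}"
    unfolding sigma_n_def using fin by (intro Max_in) auto
  thus "tri (sigma_n n) \<le> n" by simp
  show "n < tri (Suc (sigma_n n))"
  proof (rule ccontr)
    assume "\<not> n < tri (Suc (sigma_n n))"
    hence "Suc (sigma_n n) \<le> sigma_n n"
      unfolding sigma_n_def[of n] using fin by (intro Max_ge) (auto simp: sigma_n_def)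
    thus False by simp
  qed
qed

lemma real_sigma_n_bounds:
  "real (sigma_n n) * (real (sigma_n n) + 1) \<le> 2 * real n"
  "2 * real n < (real (sigma_n n) + 1) * (real (sigma_n n) + 2)"
proof -
  have "real (tri (sigma_n n)) \<le> real n" "real n < real (tri (Suc (sigma_n n)))"
    using sigma_n_bounds[of n] by simp_all
  thus "real (sigma_n n) * (real (sigma_n n) + 1) \<le> 2 * real n"
    "2 * real n < (real (sigma_n n) + 1) * (real (sigma_n n) + 2)"
    unfolding real_tri by (simp_all add: algebra_simps)
qed

lemma sigma_n_le_sqrt: "real (sigma_n n) \<le> sqrt (2 * real n)"
  using real_sigma_n_bounds(1)[of n] by (intro real_le_rsqrt) (simp add: power2_eq_square algebra_simps)

lemma sqrt_less_sigma_n: "sqrt (2 * real n) < real (sigma_n n) + 2"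
proof (rule real_less_lsqrt)
  have "(real (sigma_n n) + 1) * (real (sigma_n n) + 2) \<le> (real (sigma_n n) + 2)\<^sup>2"
    unfolding power2_eq_square by (intro mult_right_mono) auto
  thus "2 * real n < (real (sigma_n n) + 2)\<^sup>2" using real_sigma_n_bounds(2)[of n] by linarith
qed auto

text \<open>Completing the square, \<open>8 * tri s + 1 = (2 * s + 1) ^ 2\<close>, so
  \<open>sqrt (8 * n + 1)\<close> lies between two consecutive odd numbers.\<close>

lemma sigma_n_eq_floor: "int (sigma_n n) = \<lfloor>(sqrt (8 * real n + 1) - 1) / 2\<rfloor>"
proof (rule floor_unique[symmetric])
  have "2 * real (sigma_n n) + 1 \<le> sqrt (8 * real n + 1)"
    using real_sigma_n_bounds(1)[of n] by (intro real_le_rsqrt) (simp add: power2_eq_square algebra_simps)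
  thus "real_of_int (int (sigma_n n)) \<le> (sqrt (8 * real n + 1) - 1) / 2" by simp
  have "sqrt (8 * real n + 1) < 2 * real (sigma_n n) + 3"
    using real_sigma_n_bounds(2)[of n] by (intro real_less_lsqrt) (simp_all add: power2_eq_square algebra_simps)
  thus "(sqrt (8 * real n + 1) - 1) / 2 < real_of_int (int (sigma_n n)) + 1" by simp
qed

lemma sigma_n_at_top: "filterlim (\<lambda>n. real (sigma_n n)) at_top sequentially"
proof (rule filterlim_at_top_mono)
  show "filterlim (\<lambda>n. sqrt (2 * real n) - 2) at_top sequentially" by real_asymp
  show "\<forall>\<^sub>F n in sequentially. sqrt (2 * real n) - 2 \<le> real (sigma_n n)"
    using sqrt_less_sigma_n by (intro always_eventually allI) (simp add: less_imp_le diff_le_eq)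
qed

lemma sigma_n_le: "sigma_n n \<le> n"
  using le_tri[of "sigma_n n"] sigma_n_bounds(1)[of n] by linarith

text \<open>At triangular \<open>n\<close> the difference \<open>tri (sigma_n n) - n\<close> is 0,
  so \<open>sigma_n\<close> itself gives no divergence. Lowering it by one gains
  \<open>sigma_n n\<close>, which explains the \<open>+ 1\<close> in the upper end of the mixing
  window.\<close>

lemma tri_pred_sigma_at_bot:
  "filterlim (\<lambda>n. int (tri (sigma_n n - 1)) - int n) at_bot sequentially"
proof (rule filterlim_int_at_bot_mono)
  show "filterlim (\<lambda>n. - real (sigma_n n)) at_bot sequentially"
    using sigma_n_at_top by (simp add: filterlim_uminus_at_bot)
  have "\<forall>\<^sub>F n in sequentially. 1 \<le> real (sigma_n n)"
    using sigma_n_at_top unfolding filterlim_at_top by blast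
  thus "\<forall>\<^sub>F n in sequentially. real_of_int (int (tri (sigma_n n - 1)) - int n) \<le> - real (sigma_n n)"
  proof eventually_elim
    case (elim n)
    hence "tri (sigma_n n) = tri (sigma_n n - 1) + sigma_n n"
      using tri_Suc[of "sigma_n n - 1"] by simp
    hence "int (tri (sigma_n n - 1)) - int n \<le> - int (sigma_n n)" using sigma_n_bounds(1)[of n] by linarith
    thus ?case by linarith
  qed
qed

lemma d_after_sigma_tendsto_0:
  assumes "\<forall>\<^sub>F n in sequentially. real n - real (sigma_n n) + 1 \<le> real (t n)"
  shows "(\<lambda>n. d n (t n)) \<longlonglongrightarrow> 0"
proof (rule d_tendsto_0[OF tri_pred_sigma_at_bot])
  have "\<forall>\<^sub>F n in sequentially. 1 \<le> real (sigma_n n)"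
    using sigma_n_at_top unfolding filterlim_at_top by blast
  with assms show "\<forall>\<^sub>F n in sequentially. n - (sigma_n n - 1) \<le> t n"
    by eventually_elim (use sigma_n_le in linarith)
qed

text \<open>For \<open>s\<close> near \<open>a * sqrt n\<close>, \<open>tri s - n\<close> is
  \<open>(a ^ 2 / 2 - 1) * n\<close> up to order \<open>sqrt n\<close>, so its sign changes at
  \<open>a = sqrt 2\<close>.\<close>

lemma d_sqrt_above:
  assumes "a > sqrt 2"
  shows "(\<lambda>n. d n (nat (int n - \<lfloor>a * sqrt (real n)\<rfloor>))) \<longlonglongrightarrow> 1"
proof (rule d_tendsto_1)
  let ?s = "\<lambda>n. nat \<lfloor>a * sqrt (real n)\<rfloor>"
  have a0: "a > 0" using assms by (smt (verit) real_sqrt_ge_0_iff)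
  define c where "c = a\<^sup>2 / 2 - 1"
  have "(sqrt 2)\<^sup>2 < a\<^sup>2" using assms by (intro power_strict_mono) auto
  hence c: "c > 0" by (simp add: c_def)
  show "filterlim (\<lambda>n. int (tri (?s n)) - int n) at_top sequentially"
  proof (rule filterlim_int_at_top_mono)
    show "filterlim (\<lambda>n. c * real n - a * sqrt (real n)) at_top sequentially"
      using c a0 by real_asymp
    have ev: "\<forall>\<^sub>F n in sequentially. 1 \<le> a * sqrt (real n)"
      using a0 by real_asymp
    show "\<forall>\<^sub>F n in sequentially. c * real n - a * sqrt (real n) \<le> of_int (int (tri (?s n)) - int n)"
      using ev
    proof eventually_elim
      case (elim n)
      define x where "x = a * sqrt (real n)"
      have x: "1 \<le> x" "x\<^sup>2 = a\<^sup>2 * real n" using elim by (simp_all add: x_def power_mult_distrib)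
      have s: "x - 1 \<le> real (?s n)" using x unfolding x_def[symmetric] by linarith
      have "(x - 1) * x \<le> real (?s n) * (real (?s n) + 1)"
        using s x by (intro mult_mono) auto
      hence "x\<^sup>2 - x \<le> 2 * real (tri (?s n))" by (simp add: real_tri algebra_simps power2_eq_square)
      hence "x\<^sup>2 / 2 - x \<le> real (tri (?s n))" using x by linarith
      thus ?case unfolding x(2) x_def[symmetric] by (simp add: c_def algebra_simps)
    qed
  qed
  have "\<forall>\<^sub>F n in sequentially. a * sqrt (real n) \<le> real n" by real_asymp
  thus "\<forall>\<^sub>F n in sequentially. ?s n \<le> n \<and> nat (int n - \<lfloor>a * sqrt (real n)\<rfloor>) = n - ?s n"
  proof eventually_elim
    case (elim n)
    have "0 \<le> a * sqrt (real n)" using a0 by simp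
    hence "0 \<le> \<lfloor>a * sqrt (real n)\<rfloor>" "\<lfloor>a * sqrt (real n)\<rfloor> \<le> int n" using elim by linarith+
    thus ?case by linarith
  qed
qed

lemma d_sqrt_below:
  assumes "0 \<le> a" "a < sqrt 2"
  shows "(\<lambda>n. d n (nat (int n - \<lfloor>a * sqrt (real n)\<rfloor>))) \<longlonglongrightarrow> 0"
proof (rule d_tendsto_0)
  let ?s = "\<lambda>n. nat \<lfloor>a * sqrt (real n)\<rfloor>"
  define c where "c = 1 - a\<^sup>2 / 2"
  have "a\<^sup>2 < (sqrt 2)\<^sup>2" using assms by (intro power_strict_mono) auto
  hence c: "c > 0" by (simp add: c_def)
  show "filterlim (\<lambda>n. int (tri (?s n)) - int n) at_bot sequentially"
  proof (rule filterlim_int_at_bot_mono)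
    show "filterlim (\<lambda>n. a * sqrt (real n) - c * real n) at_bot sequentially"
      using c assms(1) by real_asymp
    show "\<forall>\<^sub>F n in sequentially. of_int (int (tri (?s n)) - int n) \<le> a * sqrt (real n) - c * real n"
    proof (intro always_eventually allI)
      fix n
      define x where "x = a * sqrt (real n)"
      have x: "0 \<le> x" "x\<^sup>2 = a\<^sup>2 * real n" using assms by (simp_all add: x_def power_mult_distrib)
      have s: "real (?s n) \<le> x" using x unfolding x_def[symmetric] by linarith
      have "real (?s n) * (real (?s n) + 1) \<le> x * (x + 1)"
        using s x by (intro mult_mono) auto
      hence "2 * real (tri (?s n)) \<le> x\<^sup>2 + x" by (simp add: real_tri algebra_simps power2_eq_square)
      hence "real (tri (?s n)) \<le> x\<^sup>2 / 2 + x" using x by linarith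
      thus "of_int (int (tri (?s n)) - int n) \<le> a * sqrt (real n) - c * real n"
        unfolding x(2) x_def[symmetric] by (simp add: c_def algebra_simps)
    qed
  qed
  show "\<forall>\<^sub>F n in sequentially. n - ?s n \<le> nat (int n - \<lfloor>a * sqrt (real n)\<rfloor>)"
    by (intro always_eventually allI) linarith
qed

section \<open>Mixing time and cutoff window\<close>

lemma t_mix_le_ev:
  assumes "0 < \<epsilon>"
  shows "\<forall>\<^sub>F n in sequentially. d n (t_mix n \<epsilon>) \<le> \<epsilon> \<and> t_mix n \<epsilon> \<le> n - sigma_n n + 1"
proof -
  have "(\<lambda>n. d n (n - sigma_n n + 1)) \<longlonglongrightarrow> 0"
    by (rule d_after_sigma_tendsto_0) (use sigma_n_le in \<open>auto intro!: always_eventually simp: of_nat_diff\<close>)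
  hence "\<forall>\<^sub>F n in sequentially. d n (n - sigma_n n + 1) < \<epsilon>"
    using assms by (rule order_tendstoD)
  thus ?thesis
  proof eventually_elim
    case (elim n)
    hence le: "d n (n - sigma_n n + 1) \<le> \<epsilon>" by simp
    show ?case unfolding t_mix_def using LeastI[of "\<lambda>t. d n t \<le> \<epsilon>", OF le] Least_le[of "\<lambda>t. d n t \<le> \<epsilon>", OF le] by blast
  qed
qed

text \<open>Since \<open>tri (sigma_n n + 1) > n\<close>, one more unit of \<open>s\<close> adds at
  least \<open>sigma_n n\<close> to the surplus. The bound is uniform in \<open>t\<close>, so it can
  be applied at \<open>t_mix\<close> itself without monotonicity of \<open>d\<close>.\<close>

lemma d_before_sigma:
  assumes "t + sigma_n n + 2 \<le> n"
  shows "1 - kappa * 2 powi (- int (sigma_n n)) \<le> d n t"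
proof -
  define s where "s = n - t"
  have s: "s \<le> n" "n - s = t" "sigma_n n + 2 \<le> s" using assms by (auto simp: s_def)
  have "tri (sigma_n n + 2) = tri (Suc (sigma_n n)) + (sigma_n n + 2)" using tri_Suc[of "Suc (sigma_n n)"] by simp
  hence "n + sigma_n n \<le> tri s" using sigma_n_bounds(2)[of n] tri_mono[OF s(3)] by linarith
  hence "(2::real) powi (int n - int (tri s)) \<le> 2 powi (- int (sigma_n n))"
    by (intro power_int_increasing) auto
  moreover have "0 \<le> kappa" using kappa_ge[of 0] by simp
  ultimately have "kappa * 2 powi (int n - int (tri s)) \<le> kappa * 2 powi (- int (sigma_n n))"
    by (intro mult_left_mono)
  thus ?thesis using d_lower[OF s(1)] unfolding s(2) by linarith
qed

lemma t_mix_window: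
  assumes "0 < \<epsilon>" "\<epsilon> < 1"
  shows "\<forall>\<^sub>F n in sequentially. int n - int (sigma_n n) - 1 \<le> int (t_mix n \<epsilon>) \<and>
             int (t_mix n \<epsilon>) \<le> int n - int (sigma_n n) + 1"
proof -
  have "filterlim (\<lambda>n. - int (sigma_n n)) at_bot sequentially"
    by (rule filterlim_int_at_bot_mono[of "\<lambda>n. - real (sigma_n n)"])
      (use sigma_n_at_top in \<open>simp_all add: filterlim_uminus_at_bot\<close>)
  hence "(\<lambda>n. 1 - kappa * 2 powi (- int (sigma_n n))) \<longlonglongrightarrow> 1 - kappa * 0"
    by (intro tendsto_diff tendsto_mult tendsto_const tendsto_powi_at_bot)
  hence "\<forall>\<^sub>F n in sequentially. \<epsilon> < 1 - kappa * 2 powi (- int (sigma_n n))"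
    using assms(2) by (intro order_tendstoD) auto
  with t_mix_le_ev[OF assms(1)] show ?thesis
  proof eventually_elim
    case (elim n)
    have "\<not> t_mix n \<epsilon> + sigma_n n + 2 \<le> n"
      using d_before_sigma[of "t_mix n \<epsilon>" n] elim by linarith
    thus ?case using elim sigma_n_le[of n] by linarith
  qed
qed

lemma t_mix_bigo:
  assumes "0 < \<epsilon>" "\<epsilon> < 1"
  shows "(\<lambda>n. real (t_mix n \<epsilon>) - (real n - real (sigma_n n))) \<in> O(\<lambda>_. 1)"
    "(\<lambda>n. real (t_mix n \<epsilon>) - (real n - sqrt (2 * real n))) \<in> O(\<lambda>_. 1)"
proof -
  have ev: "\<forall>\<^sub>F n in sequentially. \<bar>real (t_mix n \<epsilon>) - (real n - real (sigma_n n))\<bar> \<le> 1"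
    using t_mix_window[OF assms] by eventually_elim linarith
  show "(\<lambda>n. real (t_mix n \<epsilon>) - (real n - real (sigma_n n))) \<in> O(\<lambda>_. 1)"
    by (rule bigoI[of _ 1]) (use ev in simp)
  \<comment> \<open>Within 1 of \<open>n - sigma_n n\<close>, which is within 2 of
    \<open>n - sqrt (2 * n)\<close>.\<close>
  have "\<forall>\<^sub>F n in sequentially. \<bar>real (t_mix n \<epsilon>) - (real n - sqrt (2 * real n))\<bar> \<le> 3"
    using ev
  proof eventually_elim
    case (elim n)
    thus ?case using sigma_n_le_sqrt[of n] sqrt_less_sigma_n[of n] by linarith
  qed
  thus "(\<lambda>n. real (t_mix n \<epsilon>) - (real n - sqrt (2 * real n))) \<in> O(\<lambda>_. 1)"
    by (intro bigoI[of _ 3]) simp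
qed

lemma cutoff_window:
  fixes w :: "nat \<Rightarrow> real"
  assumes w: "filterlim w at_top sequentially" "w \<in> o(\<lambda>n. real n)" and \<delta>: "\<delta> > 0"
  shows "(\<lambda>n. d n (nat (round (real n - real (sigma_n n) - \<delta> * w n)))) \<longlonglongrightarrow> 1"
    "(\<lambda>n. d n (nat (round (real n - real (sigma_n n) + \<delta> * w n)))) \<longlonglongrightarrow> 0"
proof -
  have dw: "filterlim (\<lambda>n. \<delta> * w n) at_top sequentially"
    by (rule filterlim_tendsto_pos_mult_at_top[OF tendsto_const \<delta> w(1)])
  have ge: "\<forall>\<^sub>F n in sequentially. Z \<le> \<delta> * w n" for Z
    using dw unfolding filterlim_at_top by blast
  define t1 where "t1 n = nat (round (real n - real (sigma_n n) - \<delta> * w n))" for n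
  define s1 where "s1 n = n - t1 n" for n
  \<comment> \<open>Chosen so that eventually \<open>\<delta> * w n \<le> n / 4\<close>; the early
    time then stays positive and \<open>nat\<close> does not truncate it.\<close>
  have "1 / (4 * \<delta>) > 0" using \<delta> by simp
  from landau_o.smallD[OF w(2) this] have "\<forall>\<^sub>F n in sequentially. norm (w n) \<le> 1 / (4 * \<delta>) * norm (real n)" .
  moreover have "\<forall>\<^sub>F n in sequentially. sqrt (2 * real n) + real n / 4 + 1 \<le> real n" by real_asymp
  moreover note ge[of 2]
  ultimately have t1: "\<forall>\<^sub>F n in sequentially. t1 n \<le> n \<and> real (sigma_n n) + \<delta> * w n - 1 / 2 \<le> real n - real (t1 n)"
  proof eventually_elim
    case (elim n)
    have "\<delta> * w n \<le> \<delta> * (1 / (4 * \<delta>) * real n)"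
      using elim \<delta> by (intro mult_left_mono) auto
    also have "\<dots> = real n / 4" using \<delta> by simp
    finally have pos: "1 \<le> real n - real (sigma_n n) - \<delta> * w n"
      using elim sigma_n_le_sqrt[of n] by linarith
    define x where "x = real n - real (sigma_n n) - \<delta> * w n"
    have "0 \<le> round x" using pos unfolding x_def[symmetric] round_def by linarith
    hence "real (t1 n) = real_of_int (round x)" by (simp add: t1_def x_def)
    also have "\<dots> \<le> x + 1 / 2" by (rule of_int_round_le)
    finally have "real (t1 n) \<le> x + 1 / 2" .
    thus ?case using elim by (auto simp: x_def)
  qed
  have "(\<lambda>n. d n (t1 n)) \<longlonglongrightarrow> 1"
  proof (rule d_tendsto_1[of s1])
    show "\<forall>\<^sub>F n in sequentially. s1 n \<le> n \<and> t1 n = n - s1 n"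
      using t1 by eventually_elim (auto simp: s1_def)
    show "filterlim (\<lambda>n. int (tri (s1 n)) - int n) at_top sequentially"
    proof (rule filterlim_int_at_top_mono)
      \<comment> \<open>Rounding loses 1/2, and comparison starts from
        \<open>Suc (sigma_n n)\<close>, the first index whose \<open>tri\<close> exceeds
        \<open>n\<close>, which loses 1.\<close>
      show "filterlim (\<lambda>n. - 3 / 2 + \<delta> * w n) at_top sequentially"
        by (rule filterlim_tendsto_add_at_top[OF tendsto_const dw])
      show "\<forall>\<^sub>F n in sequentially. - 3 / 2 + \<delta> * w n \<le> of_int (int (tri (s1 n)) - int n)"
        using t1 ge[of 2]
      proof eventually_elim
        case (elim n)
        have s: "real (s1 n) \<ge> real (sigma_n n) + \<delta> * w n - 1 / 2" using elim by (simp add: s1_def of_nat_diff)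
        hence "Suc (sigma_n n) \<le> s1 n" using elim by linarith
        from tri_add_le[OF this] have "n + (s1 n - Suc (sigma_n n)) \<le> tri (s1 n)"
          using sigma_n_bounds(2)[of n] by linarith
        hence "real n + (real (s1 n) - real (Suc (sigma_n n))) \<le> real (tri (s1 n))"
          using \<open>Suc (sigma_n n) \<le> s1 n\<close> by linarith
        thus ?case using s by simp
      qed
    qed
  qed
  thus "(\<lambda>n. d n (nat (round (real n - real (sigma_n n) - \<delta> * w n)))) \<longlonglongrightarrow> 1" unfolding t1_def .
  show "(\<lambda>n. d n (nat (round (real n - real (sigma_n n) + \<delta> * w n)))) \<longlonglongrightarrow> 0"
  proof (rule d_after_sigma_tendsto_0)
    show "\<forall>\<^sub>F n in sequentially. real n - real (sigma_n n) + 1 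
       \<le> real (nat (round (real n - real (sigma_n n) + \<delta> * w n)))"
      using ge[of 2]
    proof eventually_elim
      case (elim n)
      define x where "x = real n - real (sigma_n n) + \<delta> * w n"
      have "x - 1 / 2 \<le> of_int (round x)" by (rule of_int_round_ge)
      also have "\<dots> \<le> real (nat (round x))" by simp
      finally show ?case using elim by (simp add: x_def)
    qed
  qed
qed

theorem theorem1p1:
  "(\<forall>n\<ge>1. \<forall>s\<le>n. d n (n - s) \<ge> 1 - kappa * 2 powi (int n - int (tri s)))
   \<and> (\<forall>s. (\<forall>n\<ge>1. s n \<le> n) \<and>
          filterlim (\<lambda>n. int (tri (s n)) - int n) at_top sequentially \<longrightarrow>
          (\<lambda>n. d n (n - s n)) \<longlonglongrightarrow> 1)
   \<and> (\<forall>s. (\<forall>n\<ge>1. s n \<le> n) \<and>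
          filterlim (\<lambda>n. int (tri (s n)) - int n) at_bot sequentially \<longrightarrow>
          (\<lambda>n. d n (n - s n)) \<longlonglongrightarrow> 0)
   \<and> (\<forall>n\<ge>1. \<forall>c::nat. d n (n + c) \<le> C_star * 2 powi (- int c))
   \<and> (\<forall>a::real. a \<ge> 0 \<and> a \<noteq> sqrt 2 \<longrightarrow>
          (\<lambda>n. d n (nat (int n - \<lfloor>a * sqrt (real n)\<rfloor>)))
            \<longlonglongrightarrow> (if a > sqrt 2 then 1 else 0))
   \<and> (\<forall>n\<ge>1. int (sigma_n n) = \<lfloor>(sqrt (8 * real n + 1) - 1) / 2\<rfloor>)
   \<and> (\<forall>\<epsilon>::real. 0 < \<epsilon> \<and> \<epsilon> < 1 \<longrightarrow>
          (\<forall>\<^sub>F n in sequentially.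
             int n - int (sigma_n n) - 1 \<le> int (t_mix n \<epsilon>) \<and>
             int (t_mix n \<epsilon>) \<le> int n - int (sigma_n n) + 1)
        \<and> (\<lambda>n. real (t_mix n \<epsilon>) - (real n - real (sigma_n n))) \<in> O(\<lambda>_. 1)
        \<and> (\<lambda>n. real (t_mix n \<epsilon>) - (real n - sqrt (2 * real n))) \<in> O(\<lambda>_. 1))
   \<and> (\<forall>w :: nat \<Rightarrow> real.
          filterlim w at_top sequentially \<and> w \<in> o(\<lambda>n. real n) \<longrightarrow>
          (\<forall>\<delta>>0.
             (\<lambda>n. d n (nat (round (real n - real (sigma_n n) - \<delta> * w n)))) \<longlonglongrightarrow> 1 \<and>
             (\<lambda>n. d n (nat (round (real n - real (sigma_n n) + \<delta> * w n)))) \<longlonglongrightarrow> 0))"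
proof (intro conjI allI impI, goal_cases)
  case (1 n s)
  thus ?case by (intro d_lower)
next
  case (2 s)
  thus ?case by (intro d_tendsto_1[of s]) (auto intro: eventually_mono[OF eventually_ge_at_top[of 1]])
next
  case (3 s)
  thus ?case by (intro d_tendsto_0[of s]) auto
next
  case (4 n c)
  thus ?case by (intro d_upper_late)
next
  case (5 a)
  thus ?case using d_sqrt_above[of a] d_sqrt_below[of a] by (cases "a > sqrt 2") auto
next
  case (6 n)
  show ?case by (rule sigma_n_eq_floor)
next
  case (7 \<epsilon>)
  thus ?case using t_mix_window[of \<epsilon>] by blast
next
  case (8 \<epsilon>)
  thus ?case using t_mix_bigo(1)[of \<epsilon>] by blast
next
  case (9 \<epsilon>)
  thus ?case using t_mix_bigo(2)[of \<epsilon>] by blast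
next
  case (10 w \<delta>)
  thus ?case using cutoff_window(1)[of w \<delta>] by blast
next
  case (11 w \<delta>)
  thus ?case using cutoff_window(2)[of w \<delta>] by blast
qed

end
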